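(* For every fixed integer $k\ge 1$, as $n\to\infty$, \[ P^S_k(n)= \begin{cases} \tilde{\Theta}\left(n^{\lfloor 2(k+3)/5\rfloor}\right), & \text{if } k\equiv 0,1,3,4 \pmod 5,\\[4pt] \tilde{\Theta}\left(n^{\lfloor 2(k+3)/5\rfloor-2/3}\right), & \text{if } k\equiv 2 \pmod 5. \end{cases} \]
   Context: $\mathbb{S}^2$ denotes the sphere of radius $1/\sqrt{2}$ in $\mathbb{R}^3$ (centred at the origin), and two of its points are at unit distance if their Euclidean distance in $\mathbb{R}^3$ is $1$. A unit distance path with $k$ vertices (a $k$-path) in a finite set $P\subseteq\mathbb{S}^2$ is a $k$-tuple $(p_1,\dots,p_k)$ of pairwise distinct points of $P$ such that $\|p_i-p_{i+1}\|=1$ for all $1\le i\le k-1$. $P^S_k(n)$ denotes the maximum, over all sets $P$ of $n$ points of $\mathbb{S}^2$, of the number of unit distance paths with $k$ vertices in $P$. Notation: $\tilde{\Theta}$ hides polylogarithmic factors, i.e. $f(n)=\tilde{\Theta}(g(n))$ means that there are constants $C,c>0$ (which may depend on $k$) such that $\frac{g(n)}{C(\log n)^{c}}\le f(n)\le C\,g(n)(\log n)^{c}$ for all sufficiently large $n$. *)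

theory Defs
  imports "HOL-Analysis.Analysis"
begin

definition S2 :: "(real ^ 3) set" where
  "S2 = sphere 0 (1 / sqrt 2)"

definition unit_paths :: "nat \<Rightarrow> (real ^ 3) set \<Rightarrow> (real ^ 3) list set" where
  "unit_paths k P = {p. length p = k \<and> set p \<subseteq> P \<and> distinct p \<and>
     (\<forall>i. Suc i < k \<longrightarrow> dist (p ! i) (p ! Suc i) = 1)}"

definition unit_path_counts :: "nat \<Rightarrow> nat \<Rightarrow> nat set" where
  "unit_path_counts k n = {card (unit_paths k P) | P. P \<subseteq> S2 \<and> finite P \<and> card P = n}"

definition P_S :: "nat \<Rightarrow> nat \<Rightarrow> nat" where
  "P_S k n = Max (unit_path_counts k n)"

text \<open>The following facts show that the maximum in the definition of \<open>P_S\<close> is attained.\<close>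

lemma finite_unit_paths: "finite P \<Longrightarrow> finite (unit_paths k P)"
  by (rule finite_subset[OF _ finite_lists_length_eq[of P k]]) (auto simp: unit_paths_def)

lemma finite_unit_path_counts: "finite (unit_path_counts k n)"
proof (rule finite_subset)
  show "unit_path_counts k n \<subseteq> {..n ^ k}"
  proof
    fix m assume "m \<in> unit_path_counts k n"
    then obtain P where P: "finite P" "card P = n" "m = card (unit_paths k P)"
      by (auto simp: unit_path_counts_def)
    have "card (unit_paths k P) \<le> card {xs. set xs \<subseteq> P \<and> length xs = k}"
      using P by (intro card_mono finite_lists_length_eq) (auto simp: unit_paths_def)
    with P show "m \<in> {..n ^ k}" by (simp add: card_lists_length_eq)
  qed
qed simp

lemma infinite_S2: "infinite S2"
proof
  assume fin: "finite S2"
  have "connected S2"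
    unfolding S2_def by (rule connected_sphere) simp
  moreover have "axis 1 (1 / sqrt 2) \<in> S2" "axis 1 (- (1 / sqrt 2)) \<in> S2"
    by (simp_all add: S2_def norm_eq_sqrt_inner inner_axis_axis real_sqrt_divide)
  moreover have "axis 1 (1 / sqrt 2) \<noteq> (axis 1 (- (1 / sqrt 2)) :: real ^ 3)"
    by (simp add: axis_eq_axis)
  ultimately show False
    using fin connected_finite_iff_sing[of S2] by (metis emptyE singletonD)
qed

lemma unit_path_counts_nonempty: "unit_path_counts k n \<noteq> {}"
  using infinite_arbitrarily_large[OF infinite_S2, of n] by (auto simp: unit_path_counts_def)

definition soft_theta :: "(nat \<Rightarrow> real) \<Rightarrow> (nat \<Rightarrow> real) \<Rightarrow> bool" where
  "soft_theta f g \<longleftrightarrow> (\<exists>C>0. \<exists>c>0. \<forall>\<^sub>F n in sequentially.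
     g n / (C * ln (real n) powr c) \<le> f n \<and> f n \<le> C * g n * ln (real n) powr c)"

end

(* Orthogonality turns the unit distance graph on the sphere into an incidence graph: after a generic
   rotation, points and their polar great circles become points and lines of the plane. Up to logarithms
   the Szemeredi-Trotter bound suffices. It follows from a crossing inequality whose only planarity input
   is that a straight line drawing without crossings on v vertices has O(v log v) edges, proved by
   splitting at a vertical line.

   Two points that are neither equal nor antipodal have at most two common neighbours. Hence, writing N_k
   for the number of k-paths, the paths with p_(i+2) different from - p_i number at most
   2 N_i N_(k-i-1), with p_(i+1) as the forgotten vertex. As p_2 = - p_4 = p_6 is impossible, cutting in
   one or two such places reduces all upper bounds to those for k = 1, 2, 3, 4. For k = 4 one sums the
   product of the degrees over all edges, in dyadic classes of degrees: for degrees below sqrt n the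
   incidence bound is enough, and a point of larger degree is handled by counting common neighbours.

   For the lower bounds, a path is prolonged by five vertices x, a, x', - a, x'' with x, x', x'' on the
   great circle polar to a generic a; here x is determined by the previous vertex while x' and x'' are
   free. For k = 2 a grid of points and lines is used. *)
theory Submission
  imports Defs
begin

section \<open>Crossings in straight line drawings\<close>

text \<open>The obstacle is the antipodal pair: its common neighbours fill a whole great circle, so
  the vertex between two antipodal ones is free, and five vertices can give \<open>n^3\<close>
  paths. Upper bounds must therefore distinguish whether vertices two steps apart on the path are
  antipodal, and the exponents decide where to cut. Four vertices have exponent \<open>2\<close>, no
  more than three, so cutting off four vertices and forgetting the fifth costs exactly what five
  further vertices are allowed. If the pair around this cut is antipodal, the cuts two places before
  and after it are open. They leave two blocks of two vertices, of total exponent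
  \<open>8/3\<close>; the surplus \<open>2/3\<close> is paid for by the two additional vertices
  consumed, except when \<open>k\<close> is 2 mod 5, where the target is lower by
  \<open>2/3\<close>. That class uses only the earlier of these two cuts.\<close>

text \<open>A finite set of points with distinct abscissas is the graph of a function \<open>y\<close>: a vertex is
  represented by its abscissa, an edge by the pair of the abscissas of its ends.\<close>

definition seg :: "(real \<Rightarrow> real) \<Rightarrow> real \<times> real \<Rightarrow> real \<Rightarrow> real" where
  "seg y e t = y (fst e) + (y (snd e) - y (fst e)) / (snd e - fst e) * (t - fst e)"

text \<open>The inequalities are strict, so edges that merely share an end do not cross, whereas
  overlapping collinear edges do.\<close>

definition crosses :: "(real \<Rightarrow> real) \<Rightarrow> real \<times> real \<Rightarrow> real \<times> real \<Rightarrow> bool" where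
  "crosses y e f \<longleftrightarrow>
     (\<exists>t. fst e < t \<and> t < snd e \<and> fst f < t \<and> t < snd f \<and> seg y e t = seg y f t)"

text \<open>Ordered pairs, so each crossing counts twice; this matches the later bound by the number
  of ordered pairs of lines.\<close>

definition crossings :: "(real \<Rightarrow> real) \<Rightarrow> (real \<times> real) set \<Rightarrow> ((real \<times> real) \<times> (real \<times> real)) set" where
  "crossings y E = {(e, f). e \<in> E \<and> f \<in> E \<and> e \<noteq> f \<and> crosses y e f}"

text \<open>Edges run from left to right and contain no vertex in their interior. The latter makes
  the four ends of two crossing edges distinct.\<close>

definition geometric_graph :: "(real \<Rightarrow> real) \<Rightarrow> real set \<Rightarrow> (real \<times> real) set \<Rightarrow> bool" where
  "geometric_graph y V E \<longleftrightarrow> finite V \<and>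
     (\<forall>e\<in>E. fst e \<in> V \<and> snd e \<in> V \<and> fst e < snd e \<and>
        (\<forall>x\<in>V. fst e < x \<and> x < snd e \<longrightarrow> y x \<noteq> seg y e x))"

lemma seg_fst [simp]: "seg y e (fst e) = y (fst e)"
  by (simp add: seg_def)

lemma seg_snd [simp]: "fst e < snd e \<Longrightarrow> seg y e (snd e) = y (snd e)"
  by (simp add: seg_def)

lemma geometric_graphD:
  assumes "geometric_graph y V E" "e \<in> E"
  shows "fst e \<in> V" "snd e \<in> V" "fst e < snd e"
    "x \<in> V \<Longrightarrow> fst e < x \<Longrightarrow> x < snd e \<Longrightarrow> y x \<noteq> seg y e x"
  using assms by (auto simp: geometric_graph_def)

lemma geometric_graph_finite:
  assumes "geometric_graph y V E"
  shows "finite V" "finite E"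
proof -
  show V: "finite V"
    using assms by (simp add: geometric_graph_def)
  have "E \<subseteq> V \<times> V"
  proof
    fix e assume "e \<in> E"
    then show "e \<in> V \<times> V"
      using geometric_graphD(1,2)[OF assms, of e] by (cases e) auto
  qed
  then show "finite E"
    using V by (meson finite_SigmaI finite_subset)
qed

lemma geometric_graph_subset:
  assumes "geometric_graph y V E" "V' \<subseteq> V" "E' \<subseteq> {e \<in> E. fst e \<in> V' \<and> snd e \<in> V'}"
  shows "geometric_graph y V' E'"
  using assms finite_subset[of V' V] unfolding geometric_graph_def by blast

lemma finite_crossings: "finite E \<Longrightarrow> finite (crossings y E)"
  by (rule finite_subset[of _ "E \<times> E"]) (auto simp: crossings_def)

lemma crossings_mono: "E' \<subseteq> E \<Longrightarrow> crossings y E' \<subseteq> crossings y E"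
  by (auto simp: crossings_def)

lemma crossings_emptyD:
  assumes "crossings y E = {}" "e \<in> E" "f \<in> E" "e \<noteq> f"
  shows "\<not> crosses y e f"
proof
  assume "crosses y e f"
  then have "(e, f) \<in> crossings y E"
    using assms unfolding crossings_def by blast
  then show False using assms by simp
qed

text \<open>The zero is given by its relative position \<open>l\<close> between \<open>p\<close> and
  \<open>x\<close>, so that one statement serves for \<open>p\<close> on either side of
  \<open>x\<close>.\<close>

lemma affine_zero_between:
  fixes \<alpha> \<beta> p x :: real
  assumes "\<alpha> * p + \<beta> < 0" "0 < \<alpha> * x + \<beta>"
  obtains l where "0 < l" "l < 1" "\<alpha> * (p + (x - p) * l) + \<beta> = 0"
proof
  define l where "l = - (\<alpha> * p + \<beta>) / (\<alpha> * (x - p))"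
  have pos: "\<alpha> * (x - p) > 0"
    using assms by (simp add: algebra_simps)
  show "0 < l" "l < 1"
    using assms pos by (simp_all add: l_def field_simps)
  have "\<alpha> * (x - p) * l = - (\<alpha> * p + \<beta>)"
    unfolding l_def using pos by (metis nonzero_mult_div_cancel_left times_divide_eq_right less_irrefl)
  then show "\<alpha> * (p + (x - p) * l) + \<beta> = 0"
    by (simp add: algebra_simps)
qed

lemma seg_diff_affine: "\<exists>\<alpha> \<beta>. \<forall>t. seg y e t - seg y f t = \<alpha> * t + \<beta>"
proof -
  define a where "a = (y (snd e) - y (fst e)) / (snd e - fst e)"
  define b where "b = (y (snd f) - y (fst f)) / (snd f - fst f)"
  have "seg y e t - seg y f t = (a - b) * t + (y (fst e) - a * fst e - y (fst f) + b * fst f)" for t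
    unfolding seg_def a_def[symmetric] b_def[symmetric] by (simp add: algebra_simps)
  then show ?thesis by blast
qed

text \<open>The difference of two segments is affine, so a change of sign from \<open>x\<close> to
  \<open>p\<close> would force a common point in between.\<close>

lemma seg_sign:
  assumes "seg y f x < seg y e x"
    and "\<And>l. 0 < l \<Longrightarrow> l < 1 \<Longrightarrow> seg y f (p + (x - p) * l) \<noteq> seg y e (p + (x - p) * l)"
  shows "seg y f p \<le> seg y e p"
proof (rule ccontr)
  obtain \<alpha> \<beta> where *: "\<And>t. seg y e t - seg y f t = \<alpha> * t + \<beta>"
    using seg_diff_affine by blast
  assume "\<not> ?thesis"
  then have "\<alpha> * p + \<beta> < 0" "0 < \<alpha> * x + \<beta>"
    using *[of p] *[of x] assms(1) by linarith+
  then obtain l where "0 < l" "l < 1" "\<alpha> * (p + (x - p) * l) + \<beta> = 0"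
    by (rule affine_zero_between)
  with *[of "p + (x - p) * l"] assms(2)[of l] show False by simp
qed

lemma between_pos:
  fixes p x a b l :: real
  assumes "a < x" "x < b" "a \<le> p" "p \<le> b" "0 < l" "l < 1"
  shows "a < p + (x - p) * l" "p + (x - p) * l < b"
proof -
  have eq: "p + (x - p) * l = (1 - l) * p + l * x" by (simp add: algebra_simps)
  have "(1 - l) * a + l * a < (1 - l) * p + l * x"
    using assms by (intro add_le_less_mono mult_left_mono mult_strict_left_mono) auto
  then show "a < p + (x - p) * l" by (simp add: eq algebra_simps)
  have "(1 - l) * p + l * x < (1 - l) * b + l * b"
    using assms by (intro add_le_less_mono mult_left_mono mult_strict_left_mono) auto
  then show "p + (x - p) * l < b" by (simp add: eq algebra_simps)
qed

text \<open>On the line at \<open>x\<close> the edge \<open>g\<close> lies between \<open>e\<close>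
  and \<open>f\<close>, which share the end \<open>p\<close>. Crossing neither of them,
  \<open>g\<close> stays between them up to \<open>p\<close>, where both have height
  \<open>y p\<close>; so the vertex \<open>p\<close> would lie in the interior of
  \<open>g\<close>.\<close>

lemma no_edge_between:
  assumes G: "geometric_graph y V E" and nc: "crossings y E = {}"
    and span: "\<And>e. e \<in> E \<Longrightarrow> fst e < x \<and> x < snd e"
    and mem: "e \<in> E" "f \<in> E" "g \<in> E"
    and p: "p = fst e \<and> p = fst f \<or> p = snd e \<and> p = snd f"
    and pg: "fst g < p" "p < snd g"
    and lt: "seg y e x < seg y g x" "seg y g x < seg y f x"
  shows False
proof -
  have *: "seg y d (p + (x - p) * l) \<noteq> seg y g (p + (x - p) * l)"
    if "d \<in> {e, f}" "0 < l" "l < 1" for d l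
  proof
    assume eq: "seg y d (p + (x - p) * l) = seg y g (p + (x - p) * l)"
    have d: "d \<in> E" "d \<noteq> g" "fst d \<le> p" "p \<le> snd d"
      using that(1) mem lt p geometric_graphD(3)[OF G mem(1)] geometric_graphD(3)[OF G mem(2)]
      by (auto simp: less_imp_le)
    have "crosses y d g"
      unfolding crosses_def using between_pos[of "fst d" x "snd d" p l] between_pos[of "fst g" x "snd g" p l]
        span[OF d(1)] span[OF mem(3)] d pg that eq by (intro exI[of _ "p + (x - p) * l"]) auto
    then show False
      using crossings_emptyD[OF nc d(1) mem(3) d(2)] by simp
  qed
  have "seg y e p \<le> seg y g p"
    using * by (intro seg_sign[OF lt(1)]) auto
  moreover have "seg y g p \<le> seg y f p"
    using *[of f] by (intro seg_sign[OF lt(2)]) (metis insertCI)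
  moreover have "seg y e p = y p" "seg y f p = y p"
    using p geometric_graphD(3)[OF G mem(1)] geometric_graphD(3)[OF G mem(2)]
    by (metis seg_fst seg_snd)+
  ultimately have "y p = seg y g p" by simp
  moreover have "p \<in> V"
    using p geometric_graphD(1,2)[OF G mem(1)] by auto
  ultimately show False
    using geometric_graphD(4)[OF G mem(3)] pg by blast
qed

lemma ex_maximal_value:
  fixes h :: "'e \<Rightarrow> real"
  assumes "finite A" "A \<noteq> {}"
  shows "\<exists>m\<in>A. \<forall>e\<in>A. h e \<le> h m"
proof -
  have "Max (h ` A) \<in> h ` A" using assms by (intro Max_in) auto
  then obtain m where "m \<in> A" "h m = Max (h ` A)" by auto
  then show ?thesis using assms by (intro bexI[of _ m]) auto
qed

lemma ex_minimal_value:
  fixes h :: "'e \<Rightarrow> real"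
  assumes "finite A" "A \<noteq> {}"
  shows "\<exists>m\<in>A. \<forall>e\<in>A. h m \<le> h e"
  using ex_maximal_value[OF assms, of "\<lambda>e. - h e"] by simp

text \<open>As \<open>h\<close> is injective, each value of \<open>\<pi>\<close> has at most one
  extremal edge, so \<open>\<pi>\<close> is injective on these edges.\<close>

lemma card_extremal_le:
  fixes h :: "'e \<Rightarrow> real" and \<pi> :: "'e \<Rightarrow> 'v"
  assumes "finite E" "inj_on h E" "finite W" "\<pi> ` E \<subseteq> W"
  shows "card {e \<in> E. \<forall>f\<in>E. \<pi> f = \<pi> e \<longrightarrow> h f \<le> h e} \<le> card W"
    and "card {e \<in> E. \<forall>f\<in>E. \<pi> f = \<pi> e \<longrightarrow> h e \<le> h f} \<le> card W"
proof -
  have "inj_on \<pi> {e \<in> E. \<forall>f\<in>E. \<pi> f = \<pi> e \<longrightarrow> h f \<le> h e}"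
    "inj_on \<pi> {e \<in> E. \<forall>f\<in>E. \<pi> f = \<pi> e \<longrightarrow> h e \<le> h f}"
    by (rule inj_onI, rule inj_onD[OF assms(2)]; force intro: order_antisym)+
  then show "card {e \<in> E. \<forall>f\<in>E. \<pi> f = \<pi> e \<longrightarrow> h f \<le> h e} \<le> card W"
    "card {e \<in> E. \<forall>f\<in>E. \<pi> f = \<pi> e \<longrightarrow> h e \<le> h f} \<le> card W"
    using assms by (auto intro!: card_inj_on_le[of \<pi>])
qed

text \<open>Order the edges by height on the vertical line at \<open>x\<close>. If two consecutive ones have different
  left (or right) ends, then, looking at the end closer to the line, the lower edge is the topmost one
  at its end or the upper edge is the bottommost one at its end. Thus every edge except the highest
  one is charged to an extremal edge at some vertex.\<close>

lemma card_edges_through_line: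
  assumes G: "geometric_graph y V E" and nc: "crossings y E = {}"
    and span: "\<And>e. e \<in> E \<Longrightarrow> fst e < x \<and> x < snd e"
  shows "card E \<le> 2 * card V + 1"
proof (cases "E = {}")
  case False
  define h where "h e = seg y e x" for e
  define A where "A = fst ` E"
  define B where "B = snd ` E"
  have fin: "finite E" "finite V" using geometric_graph_finite[OF G] by auto
  have inj: "inj_on h E"
  proof (rule inj_onI, rule ccontr)
    fix e f assume ef: "e \<in> E" "f \<in> E" "h e = h f" "e \<noteq> f"
    then have "crosses y e f"
      using span unfolding crosses_def h_def by blast
    then show False using crossings_emptyD[OF nc] ef by blast
  qed
  have hneq: "h e < h f \<or> h f < h e" if "e \<in> E" "f \<in> E" "e \<noteq> f" for e f
    using inj_onD[OF inj] that by (meson linorder_neqE_linordered_idom)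
  define TL where "TL = {e \<in> E. \<forall>f\<in>E. fst f = fst e \<longrightarrow> h f \<le> h e}"
  define BL where "BL = {e \<in> E. \<forall>f\<in>E. fst f = fst e \<longrightarrow> h e \<le> h f}"
  define TR where "TR = {e \<in> E. \<forall>f\<in>E. snd f = snd e \<longrightarrow> h f \<le> h e}"
  define BR where "BR = {e \<in> E. \<forall>f\<in>E. snd f = snd e \<longrightarrow> h e \<le> h f}"
  have cards: "card TL \<le> card A" "card BL \<le> card A" "card TR \<le> card B" "card BR \<le> card B"
    using card_extremal_le[OF fin(1) inj, of A fst] card_extremal_le[OF fin(1) inj, of B snd] fin
    by (auto simp: TL_def BL_def TR_def BR_def A_def B_def)
  \<comment> \<open>The line separates left ends from right ends, so the four extremal families have
    at most \<open>2 * card V\<close> members together. The \<open>1\<close> in the claim is for the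
    highest edge \<open>m\<close>.\<close>
  have AB: "card A + card B \<le> card V"
  proof -
    have "a < x" if "a \<in> A" for a using that span by (auto simp: A_def)
    moreover have "x < b" if "b \<in> B" for b using that span by (auto simp: B_def)
    ultimately have "A \<inter> B = {}" by (meson disjoint_iff less_asym)
    then have "card A + card B = card (A \<union> B)"
      using fin by (simp add: A_def B_def card_Un_disjoint)
    also have "\<dots> \<le> card V"
      using fin geometric_graphD(1,2)[OF G] by (intro card_mono) (auto simp: A_def B_def)
    finally show ?thesis .
  qed
  obtain m where m: "m \<in> E" "\<And>e. e \<in> E \<Longrightarrow> h e \<le> h m"
    using ex_maximal_value[OF fin(1) False, of h] by blast
  \<comment> \<open>\<open>s e\<close> will be the edge directly above \<open>e\<close> on the line;
    only the highest edge has none.\<close>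
  have "\<exists>e'. e' \<in> E \<and> h e < h e' \<and> (\<forall>f\<in>E. h e < h f \<longrightarrow> h e' \<le> h f)" if "e \<in> E - {m}" for e
  proof -
    have "h e < h m" using m(1) m(2)[of e] that hneq[of e m] by auto
    then have "m \<in> {f \<in> E. h e < h f}" using m(1) by simp
    then have ne: "{f \<in> E. h e < h f} \<noteq> {}" "finite {f \<in> E. h e < h f}"
      using fin by (blast, simp)
    then show ?thesis using ex_minimal_value[OF ne(2,1), of h] by blast
  qed
  then obtain s where s: "\<And>e. e \<in> E - {m} \<Longrightarrow> s e \<in> E \<and> h e < h (s e) \<and> (\<forall>f\<in>E. h e < h f \<longrightarrow> h (s e) \<le> h f)"
    by metis
  have inj_s: "inj_on s (E - {m})"
  proof (rule inj_onI, rule ccontr)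
    fix e f assume ef: "e \<in> E - {m}" "f \<in> E - {m}" "s e = s f" "e \<noteq> f"
    then show False using s[OF ef(1)] s[OF ef(2)] hneq[of e f] by force
  qed
  have charge: "e \<in> TL \<or> s e \<in> BL \<or> e \<in> TR \<or> s e \<in> BR" if e: "e \<in> E - {m}" for e
  proof -
    have eE: "e \<in> E" and sE: "s e \<in> E" and lt: "h e < h (s e)"
      and nx: "\<And>f. f \<in> E \<Longrightarrow> h e < h f \<Longrightarrow> h (s e) \<le> h f" using s[OF e] e by auto
    \<comment> \<open>A higher edge \<open>f\<close> from the same end would lie above
      \<open>s e\<close> too, so that \<open>s e\<close> would be squeezed between \<open>e\<close>
      and \<open>f\<close> over that end. \<open>main'\<close> is the mirror image, with the roles
      of \<open>e\<close> and \<open>s e\<close> exchanged.\<close>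
    have main: "e \<in> {e \<in> E. \<forall>f\<in>E. \<pi> f = \<pi> e \<longrightarrow> h f \<le> h e}"
      if pi: "\<pi> = fst \<or> \<pi> = snd" and ne: "\<pi> e \<noteq> \<pi> (s e)" and near: "fst (s e) < \<pi> e" "\<pi> e < snd (s e)" for \<pi>
    proof (rule ccontr)
      assume "\<not> ?thesis"
      then obtain f where f: "f \<in> E" "\<pi> f = \<pi> e" "h e < h f" using eE by force
      then have "h (s e) < h f" using nx[OF f(1)] hneq[of f "s e"] ne sE by force
      then show False
        using no_edge_between[OF G nc span eE f(1) sE, of "\<pi> e"] pi near f lt by (auto simp: h_def)
    qed
    have main': "s e \<in> {e \<in> E. \<forall>f\<in>E. \<pi> f = \<pi> e \<longrightarrow> h e \<le> h f}"
      if pi: "\<pi> = fst \<or> \<pi> = snd" and ne: "\<pi> e \<noteq> \<pi> (s e)" and near: "fst e < \<pi> (s e)" "\<pi> (s e) < snd e" for \<pi>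
    proof (rule ccontr)
      assume "\<not> ?thesis"
      then obtain f where f: "f \<in> E" "\<pi> f = \<pi> (s e)" "h f < h (s e)" using sE by force
      then have "h f < h e" using nx[OF f(1)] hneq[of f e] ne eE by force
      then show False
        using no_edge_between[OF G nc span f(1) sE eE, of "\<pi> (s e)"] pi near f lt by (auto simp: h_def)
    qed
    have sp: "fst e < x" "x < snd e" "fst (s e) < x" "x < snd (s e)" using span eE sE by auto
    have "fst e \<noteq> fst (s e) \<or> snd e \<noteq> snd (s e)" using lt by (metis less_irrefl prod_eqI)
    then show ?thesis
    proof
      assume ne: "fst e \<noteq> fst (s e)"
      then show ?thesis
        using main[of fst] main'[of fst] sp unfolding TL_def BL_def
        by (cases "fst e < fst (s e)") auto
    next
      assume ne: "snd e \<noteq> snd (s e)"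
      then show ?thesis
        using main[of snd] main'[of snd] sp unfolding TR_def BR_def
        by (cases "snd e < snd (s e)") auto
    qed
  qed
  have "E \<subseteq> {m} \<union> (TL \<union> {e \<in> E - {m}. s e \<in> BL} \<union> (TR \<union> {e \<in> E - {m}. s e \<in> BR}))"
    using charge by auto
  then have "card E \<le> card ({m} \<union> (TL \<union> {e \<in> E - {m}. s e \<in> BL} \<union> (TR \<union> {e \<in> E - {m}. s e \<in> BR})))"
    using fin by (intro card_mono) (auto simp: TL_def TR_def)
  also have "\<dots> \<le> 1 + ((card TL + card {e \<in> E - {m}. s e \<in> BL}) + (card TR + card {e \<in> E - {m}. s e \<in> BR}))"
    by (rule order_trans[OF card_Un_le], intro add_mono order_trans[OF card_Un_le]) auto
  also have "card {e \<in> E - {m}. s e \<in> BL} \<le> card BL"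
    using fin by (intro card_inj_on_le[of s] inj_on_subset[OF inj_s]) (auto simp: BL_def)
  also have "card {e \<in> E - {m}. s e \<in> BR} \<le> card BR"
    using fin by (intro card_inj_on_le[of s] inj_on_subset[OF inj_s]) (auto simp: BR_def)
  finally show ?thesis using cards AB by linarith
qed simp

text \<open>The cut moves to the right over one point of \<open>V\<close> at a time and stops
  strictly before the next one, so that it never hits a vertex.\<close>

lemma obtain_cut:
  fixes V :: "real set"
  assumes "finite V" "j \<le> card V"
  shows "\<exists>x. x \<notin> V \<and> card {v \<in> V. v < x} = j"
  using assms(2)
proof (induction j)
  case 0
  obtain x where x: "\<And>v. v \<in> V \<Longrightarrow> x < v"
  proof (cases "V = {}")
    case False
    then show thesis using that[of "Min V - 1"] assms(1)
      by (metis Min_le diff_strict_left_mono diff_zero less_le_trans zero_less_one)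
  qed auto
  then have "x \<notin> V" "{v \<in> V. v < x} = {}" by fastforce+
  then show ?case by (metis card.empty)
next
  case (Suc j)
  then obtain x where x: "x \<notin> V" "card {v \<in> V. v < x} = j" by auto
  define R where "R = {v \<in> V. x < v}"
  have "R \<noteq> {}"
  proof
    assume "R = {}"
    then have "v < x" if "v \<in> V" for v
      using that x(1) by (cases v x rule: linorder_cases) (auto simp: R_def)
    then have "{v \<in> V. v < x} = V" by auto
    then show False using x Suc.prems by simp
  qed
  then obtain w where w: "w \<in> R" "\<And>v. v \<in> R \<Longrightarrow> w \<le> v"
    using assms(1) ex_minimal_value[of R "\<lambda>v. v"] by (auto simp: R_def)
  obtain z where z: "w < z" "\<And>v. v \<in> R \<Longrightarrow> v \<noteq> w \<Longrightarrow> z < v"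
  proof (cases "R = {w}")
    case True
    then show thesis using that[of "w + 1"] by auto
  next
    case False
    then have "R - {w} \<noteq> {}" using w by auto
    then obtain w' where w': "w' \<in> R - {w}" "\<And>v. v \<in> R - {w} \<Longrightarrow> w' \<le> v"
      using assms(1) ex_minimal_value[of "R - {w}" "\<lambda>v. v"] by (auto simp: R_def)
    then have "w < w'" using w by force
    then show thesis using that[of "(w + w') / 2"] w' by force
  qed
  have wV: "w \<in> V" "x < w" using w(1) by (auto simp: R_def)
  have zR: "z < v" if "v \<in> V" "x < v" "v \<noteq> w" for v using z(2)[of v] that by (simp add: R_def)
  have "v < z \<longleftrightarrow> v = w \<or> v < x" if "v \<in> V" for v
  proof (cases "v = w")
    case False
    then show ?thesis
      using that x(1) z(1) wV zR[of v] by (cases v x rule: linorder_cases) auto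
  qed (use z(1) in simp)
  then have "{v \<in> V. v < z} = insert w {v \<in> V. v < x}" using wV by auto
  moreover have "z \<notin> V" using z(2)[of z] z(1) wV by (auto simp: R_def)
  ultimately show ?case
    using x(2) wV assms(1) by (intro exI[of _ z]) simp
qed

text \<open>The edges through the cutting line number at most
  \<open>2 * card V + 1 \<le> 3 * card V\<close>. The vertex counts of the halves add up to
  \<open>card V\<close>, so every level of the recursion costs \<open>3 * card V\<close>, and
  \<open>k\<close> bounds the number of levels.\<close>

lemma card_noncrossing_edges:
  assumes "geometric_graph y V E" "crossings y E = {}" "card V \<le> 2 ^ k"
  shows "card E \<le> 3 * k * card V"
  using assms
proof (induction k arbitrary: V E)
  case 0
  then have fV: "finite V" and "card V \<le> 1" using geometric_graph_finite by auto
  have "e \<notin> E" for e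
  proof
    assume "e \<in> E"
    with 0 have "fst e \<in> V" "snd e \<in> V" "fst e < snd e" using geometric_graphD by metis+
    then show False using \<open>card V \<le> 1\<close> fV by (metis card_le_Suc0_iff_eq One_nat_def less_irrefl)
  qed
  then show ?case by (metis all_not_in_conv card.empty zero_le)
next
  case (Suc k)
  note G = Suc.prems(1)
  have fin: "finite V" "finite E" using geometric_graph_finite[OF G] by auto
  show ?case
  proof (cases "E = {}")
    case False
    then obtain e where "e \<in> E" by auto
    then have "V \<noteq> {}" using geometric_graphD(1)[OF G, of e] by auto
    then have V1: "card V \<ge> 1" using fin by (simp add: Suc_leI card_gt_0_iff)
    obtain x where x: "x \<notin> V" "card {v \<in> V. v < x} = card V div 2"
      using obtain_cut[OF fin(1), of "card V div 2"] by auto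
    define V1 where "V1 = {v \<in> V. v < x}"
    define V2 where "V2 = {v \<in> V. x < v}"
    define E1 where "E1 = {e \<in> E. snd e < x}"
    define E2 where "E2 = {e \<in> E. x < fst e}"
    define E3 where "E3 = {e \<in> E. fst e < x \<and> x < snd e}"
    have "v < x \<or> x < v" if "v \<in> V" for v
      using that x(1) by (cases v x rule: linorder_cases) auto
    then have V: "V = V1 \<union> V2" "V1 \<inter> V2 = {}" by (auto simp: V1_def V2_def)
    have cV: "card V = card V1 + card V2"
      using V fin by (metis card_Un_disjoint finite_Un)
    then have le: "card V1 \<le> 2 ^ k" "card V2 \<le> 2 ^ k"
      using x(2) Suc.prems(3) unfolding V1_def[symmetric] by auto
    have "E \<subseteq> E1 \<union> E2 \<union> E3"
    proof
      fix e assume e: "e \<in> E"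
      then have "fst e \<noteq> x" "snd e \<noteq> x" using x(1) geometric_graphD(1,2)[OF G e] by auto
      with e show "e \<in> E1 \<union> E2 \<union> E3" by (auto simp: E1_def E2_def E3_def)
    qed
    then have "card E \<le> card (E1 \<union> E2 \<union> E3)"
      using fin by (intro card_mono) (auto simp: E1_def E2_def E3_def)
    also have "\<dots> \<le> card E1 + card E2 + card E3"
      by (meson card_Un_le add_le_mono1 order_trans)
    finally have cE: "card E \<le> card E1 + card E2 + card E3" .
    have sub: "E1 \<subseteq> E" "E2 \<subseteq> E" "E3 \<subseteq> E" by (auto simp: E1_def E2_def E3_def)
    have nc: "crossings y E1 = {}" "crossings y E2 = {}" "crossings y E3 = {}"
      using crossings_mono[OF sub(1), of y] crossings_mono[OF sub(2), of y]
        crossings_mono[OF sub(3), of y] Suc.prems(2) by auto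
    have "geometric_graph y V1 E1"
      using geometric_graphD(1,2,3)[OF G]
      by (intro geometric_graph_subset[OF G]) (force simp: V1_def E1_def)+
    then have 1: "card E1 \<le> 3 * k * card V1" using Suc.IH nc le by blast
    have "geometric_graph y V2 E2"
      using geometric_graphD(1,2,3)[OF G]
      by (intro geometric_graph_subset[OF G]) (force simp: V2_def E2_def)+
    then have 2: "card E2 \<le> 3 * k * card V2" using Suc.IH nc le by blast
    have "geometric_graph y V E3"
      using geometric_graphD(1,2)[OF G]
      by (intro geometric_graph_subset[OF G]) (auto simp: E3_def)
    then have 3: "card E3 \<le> 2 * card V + 1"
      using nc by (intro card_edges_through_line[of _ _ _ x]) (auto simp: E3_def)
    have "card E \<le> 3 * k * card V1 + 3 * k * card V2 + (2 * card V + 1)"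
      using cE 1 2 3 by linarith
    also have "\<dots> = 3 * k * card V + (2 * card V + 1)" by (simp add: cV algebra_simps)
    also have "\<dots> \<le> 3 * Suc k * card V" using V1 by (simp add: algebra_simps)
    finally show ?thesis .
  qed simp
qed

text \<open>Deleting one edge of a crossing lowers the number of edges by one and the number of
  crossings by at least one, so the excess over the crossing-free bound is paid for by
  crossings.\<close>

lemma card_edges_le_crossings:
  assumes "geometric_graph y V E" "card V \<le> 2 ^ k"
  shows "card E \<le> card (crossings y E) + 3 * k * card V"
  using assms
proof (induction "card E" arbitrary: E rule: less_induct)
  case less
  note G = less.prems(1)
  have fin: "finite E" "finite (crossings y E)"
    using geometric_graph_finite[OF G] finite_crossings by auto
  show ?case
  proof (cases "crossings y E = {}")
    case True
    then show ?thesis using card_noncrossing_edges[OF G True less.prems(2)] by simp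
  next
    case False
    then obtain e f where ef: "(e, f) \<in> crossings y E" by auto
    then have e: "e \<in> E" by (simp add: crossings_def)
    let ?E = "E - {e}"
    have "card ?E < card E" using e fin by (metis card_Diff1_less)
    moreover have "geometric_graph y V ?E"
      using geometric_graphD(1,2)[OF G] by (intro geometric_graph_subset[OF G]) auto
    ultimately have IH: "card ?E \<le> card (crossings y ?E) + 3 * k * card V"
      using less by blast
    have "crossings y ?E \<subset> crossings y E"
      using ef unfolding crossings_def by blast
    then have "card (crossings y ?E) < card (crossings y E)"
      using fin by (simp add: psubset_card_mono)
    then show ?thesis using IH e fin by (simp add: card_Diff_singleton)
  qed
qed

section \<open>Random subgraphs and the crossing inequality\<close>

lemma sum_card_swap:
  assumes "finite F" "finite E"
  shows "(\<Sum>f\<in>F. card {e \<in> E. R f e}) = (\<Sum>e\<in>E. card {f \<in> F. R f e})"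
  by (rule sum_multicount_gen[OF assms]) simp

text \<open>Functions into \<open>{..<q}\<close> model the sampling: a vertex survives if its value
  is \<open>0\<close>. The lemma says that all of \<open>A\<close> survives with probability
  \<open>q\<close> to the power \<open>- card A\<close>; expectations become counts and stay natural
  numbers.\<close>

lemma card_functions_vanishing:
  assumes "finite V" "A \<subseteq> V" "q \<ge> (1::nat)"
  shows "card {f \<in> V \<rightarrow>\<^sub>E {..<q}. \<forall>a\<in>A. f a = 0} * q ^ card A = q ^ card V"
proof -
  have fA: "finite A" using assms finite_subset by blast
  have "f \<in> V \<rightarrow>\<^sub>E {..<q} \<and> (\<forall>a\<in>A. f a = 0) \<longleftrightarrow> f \<in> PiE V (\<lambda>v. if v \<in> A then {0} else {..<q})" for f
  proof -
    have "f v < q \<and> (v \<in> A \<longrightarrow> f v = 0) \<longleftrightarrow> f v \<in> (if v \<in> A then {0} else {..<q})" for v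
      using assms(3) by auto
    moreover have "(\<forall>a\<in>A. f a = 0) \<longleftrightarrow> (\<forall>v\<in>V. v \<in> A \<longrightarrow> f v = 0)"
      using assms(2) by blast
    ultimately show ?thesis unfolding PiE_iff lessThan_iff by blast
  qed
  then have "{f \<in> V \<rightarrow>\<^sub>E {..<q}. \<forall>a\<in>A. f a = 0} = PiE V (\<lambda>v. if v \<in> A then {0} else {..<q})"
    by blast
  then have "card {f \<in> V \<rightarrow>\<^sub>E {..<q}. \<forall>a\<in>A. f a = 0} = (\<Prod>v\<in>V. card (if v \<in> A then {0} else {..<q}))"
    using assms by (simp add: card_PiE)
  also have "\<dots> = (\<Prod>v\<in>V. if v \<in> A then 1 else q)"
    by (intro prod.cong) auto
  also have "\<dots> = q ^ card (V - A)"
    using assms by (simp add: prod.If_cases Diff_eq Compl_eq)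
  finally show ?thesis
    using assms fA by (simp add: card_Diff_subset card_mono flip: power_add)
qed

lemma seg_eq_if_eq_twice:
  assumes "seg y e p = seg y f p" "seg y e t = seg y f t" "p \<noteq> t"
  shows "seg y e s = seg y f s"
proof -
  obtain \<alpha> \<beta> where *: "\<And>t. seg y e t - seg y f t = \<alpha> * t + \<beta>"
    using seg_diff_affine by blast
  have "\<alpha> * p + \<beta> = 0" "\<alpha> * t + \<beta> = 0"
    using *[of p] *[of t] assms by auto
  then have "\<alpha> * p = \<alpha> * t" by linarith
  then have "\<alpha> = 0" using assms(3) by simp
  then show ?thesis using *[of s] \<open>\<alpha> * p + \<beta> = 0\<close> by simp
qed

text \<open>Crossing edges with a common left or right end would agree at two abscissas, hence lie
  on one line, and the other end of the shorter one would be a vertex inside the longer one. A left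
  end cannot be a right end because the abscissa \<open>t\<close> separates them. So a crossing
  survives the sampling with probability \<open>1 / q ^ 4\<close>.\<close>

lemma crossing_distinct_ends:
  assumes G: "geometric_graph y V E" and c: "(e, f) \<in> crossings y E"
  shows "card {fst e, snd e, fst f, snd f} = 4"
proof -
  from c obtain t where t: "fst e < t" "t < snd e" "fst f < t" "t < snd f" "seg y e t = seg y f t"
    and ef: "e \<in> E" "f \<in> E" "e \<noteq> f" by (auto simp: crossings_def crosses_def)
  have le: "fst e < snd e" "fst f < snd f" using geometric_graphD(3)[OF G] ef by auto
  have nin: "\<not> (fst d < x \<and> x < snd d)" if "d \<in> {e, f}" "x \<in> {fst e, snd e, fst f, snd f}"
    "seg y d x = y x" for d x
    using geometric_graphD[OF G] ef that by (metis insert_iff singletonD)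
  have 1: "fst e \<noteq> fst f"
  proof
    assume eq: "fst e = fst f"
    have same: "seg y e s = seg y f s" for s
      using seg_eq_if_eq_twice[of y e "fst e" f t s] t eq seg_fst[of y e] seg_fst[of y f]
      by (metis less_irrefl)
    have "\<not> snd e < snd f" using nin[of f "snd e"] same[of "snd e"] eq le by auto
    moreover have "\<not> snd f < snd e" using nin[of e "snd f"] same[of "snd f"] eq le by auto
    ultimately show False using ef(3) eq by (simp add: prod_eq_iff)
  qed
  have 2: "snd e \<noteq> snd f"
  proof
    assume eq: "snd e = snd f"
    have same: "seg y e s = seg y f s" for s
      using seg_eq_if_eq_twice[of y e "snd e" f t s] t eq seg_snd[of e y] seg_snd[of f y] le
      by (metis less_irrefl)
    have "\<not> fst e < fst f" using nin[of e "fst f"] same[of "fst f"] eq le by auto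
    moreover have "\<not> fst f < fst e" using nin[of f "fst e"] same[of "fst e"] eq le by auto
    ultimately show False using ef(3) eq by (simp add: prod_eq_iff)
  qed
  have "fst e \<noteq> snd e" "fst e \<noteq> snd f" "snd e \<noteq> fst f" "fst f \<noteq> snd f" using t by auto
  with 1 2 show ?thesis by simp
qed

text \<open>Averaging the previous bound over random subgraphs, in which every vertex survives
  with probability \<open>1 / q\<close>.\<close>

lemma crossing_inequality:
  assumes G: "geometric_graph y V E" and k: "card V \<le> 2 ^ k" and q: "q \<ge> 1"
  shows "card E * q\<^sup>2 \<le> card (crossings y E) + 3 * k * card V * q ^ 3"
proof -
  have fin: "finite V" "finite E" "finite (crossings y E)"
    using geometric_graph_finite[OF G] finite_crossings by auto
  define F where "F = V \<rightarrow>\<^sub>E {..<q}"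
  define N where "N = q ^ card V"
  have fF: "finite F" unfolding F_def using fin by (simp add: finite_PiE)
  have cnt: "card {f \<in> F. \<forall>a\<in>A. f a = 0} * q ^ card A = N" if "A \<subseteq> V" for A
    unfolding F_def N_def by (rule card_functions_vanishing[OF fin(1) that q])
  define Q where "Q c = {fst (fst c), snd (fst c), fst (snd c), snd (snd c)}"
    for c :: "(real \<times> real) \<times> (real \<times> real)"
  have each: "card {e \<in> E. \<forall>a\<in>{fst e, snd e}. f a = 0}
      \<le> card {c \<in> crossings y E. \<forall>a\<in>Q c. f a = 0} + 3 * k * card {v \<in> V. f v = 0}" for f :: "real \<Rightarrow> nat"
  proof -
    let ?E = "{e \<in> E. \<forall>a\<in>{fst e, snd e}. f a = 0}" and ?V = "{v \<in> V. f v = 0}"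
    have "geometric_graph y ?V ?E"
      using geometric_graphD(1,2)[OF G] by (intro geometric_graph_subset[OF G]) auto
    moreover have "card ?V \<le> 2 ^ k"
      by (rule order_trans[OF card_mono k]) (use fin in auto)
    ultimately have le: "card ?E \<le> card (crossings y ?E) + 3 * k * card ?V"
      by (rule card_edges_le_crossings)
    have eq: "crossings y ?E = {c \<in> crossings y E. \<forall>a\<in>Q c. f a = 0}"
      by (rule set_eqI) (simp add: crossings_def Q_def case_prod_beta conj_ac)
    show ?thesis using le unfolding eq .
  qed
  have "(\<Sum>f\<in>F. card {e \<in> E. \<forall>a\<in>{fst e, snd e}. f a = 0})
      \<le> (\<Sum>f\<in>F. card {c \<in> crossings y E. \<forall>a\<in>Q c. f a = 0} + 3 * k * card {v \<in> V. f v = 0})"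
    by (intro sum_mono each)
  also have "\<dots> = (\<Sum>f\<in>F. card {c \<in> crossings y E. \<forall>a\<in>Q c. f a = 0})
      + 3 * k * (\<Sum>f\<in>F. card {v \<in> V. f v = 0})"
    by (simp add: sum.distrib sum_distrib_left)
  finally have "(\<Sum>e\<in>E. card {f \<in> F. \<forall>a\<in>{fst e, snd e}. f a = 0})
      \<le> (\<Sum>c\<in>crossings y E. card {f \<in> F. \<forall>a\<in>Q c. f a = 0})
        + 3 * k * (\<Sum>v\<in>V. card {f \<in> F. f v = 0})"
    unfolding sum_card_swap[OF fF fin(2), of "\<lambda>f e. \<forall>a\<in>{fst e, snd e}. f a = 0"]
      sum_card_swap[OF fF fin(3), of "\<lambda>f c. \<forall>a\<in>Q c. f a = 0"]
      sum_card_swap[OF fF fin(1), of "\<lambda>f v. f v = 0"] .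
  \<comment> \<open>The factor \<open>q ^ 4\<close> clears all denominators: an edge then counts
    \<open>N * q ^ 2\<close>, a crossing \<open>N\<close> and a vertex
    \<open>N * q ^ 3\<close>.\<close>
  from mult_right_mono[OF this, of "q ^ 4"]
  have "(\<Sum>e\<in>E. card {f \<in> F. \<forall>a\<in>{fst e, snd e}. f a = 0}) * q ^ 4
      \<le> (\<Sum>c\<in>crossings y E. card {f \<in> F. \<forall>a\<in>Q c. f a = 0}) * q ^ 4
        + 3 * k * ((\<Sum>v\<in>V. card {f \<in> F. f v = 0}) * q ^ 4)"
    by (simp only: distrib_right mult.assoc)
  then have "(\<Sum>e\<in>E. card {f \<in> F. \<forall>a\<in>{fst e, snd e}. f a = 0} * q ^ 4)
      \<le> (\<Sum>c\<in>crossings y E. card {f \<in> F. \<forall>a\<in>Q c. f a = 0} * q ^ 4)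
        + 3 * k * (\<Sum>v\<in>V. card {f \<in> F. f v = 0} * q ^ 4)"
    by (simp only: sum_distrib_right)
  moreover have "card {f \<in> F. \<forall>a\<in>{fst e, snd e}. f a = 0} * q ^ 4 = N * q\<^sup>2" if "e \<in> E" for e
  proof -
    have "card {fst e, snd e} = 2" using geometric_graphD(3)[OF G that] by simp
    then have "card {f \<in> F. \<forall>a\<in>{fst e, snd e}. f a = 0} * q\<^sup>2 = N"
      using cnt[of "{fst e, snd e}"] geometric_graphD(1,2)[OF G that] by simp
    moreover have q4: "q ^ 4 = q\<^sup>2 * q\<^sup>2" by (simp flip: power_add)
    ultimately show ?thesis unfolding q4 mult.assoc[symmetric] by simp
  qed
  moreover have "card {f \<in> F. \<forall>a\<in>Q c. f a = 0} * q ^ 4 = N" if "c \<in> crossings y E" for c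
  proof -
    have "fst c \<in> E" "snd c \<in> E" using that by (auto simp: crossings_def)
    then have "Q c \<subseteq> V" using geometric_graphD(1,2)[OF G] by (simp add: Q_def)
    moreover have "card (Q c) = 4" using crossing_distinct_ends[OF G, of "fst c" "snd c"] that by (simp add: Q_def)
    ultimately show ?thesis using cnt[of "Q c"] by simp
  qed
  moreover have "card {f \<in> F. f v = 0} * q ^ 4 = N * q ^ 3" if "v \<in> V" for v
  proof -
    have "card {f \<in> F. f v = 0} * q = N" using cnt[of "{v}"] that by simp
    moreover have q4: "q ^ 4 = q * q ^ 3" by (simp flip: power_Suc)
    ultimately show ?thesis unfolding q4 mult.assoc[symmetric] by simp
  qed
  ultimately have "(\<Sum>e\<in>E. N * q\<^sup>2) \<le> (\<Sum>c\<in>crossings y E. N) + 3 * k * (\<Sum>v\<in>V. N * q ^ 3)"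
    by simp
  then have "N * (card E * q\<^sup>2) \<le> N * (card (crossings y E) + 3 * k * card V * q ^ 3)"
    by (simp add: algebra_simps)
  moreover have "N > 0" using q by (simp add: N_def)
  ultimately show ?thesis by simp
qed

section \<open>Incidences of points and lines\<close>

text \<open>A line is its slope and intercept, so vertical lines do not occur; on the sphere a
  generic frame ensures this.\<close>

definition on_line :: "(real \<Rightarrow> real) \<Rightarrow> real \<times> real \<Rightarrow> real \<Rightarrow> bool" where
  "on_line y l x \<longleftrightarrow> y x = fst l * x + snd l"

text \<open>These pairs are the edges of the drawing: neighbouring points on a line are
  joined.\<close>

definition consecutive :: "(real \<Rightarrow> real) \<Rightarrow> real set \<Rightarrow> real \<times> real \<Rightarrow> real \<times> real \<Rightarrow> bool" where
  "consecutive y X l e \<longleftrightarrow> fst e \<in> X \<and> snd e \<in> X \<and> fst e < snd e \<and> on_line y l (fst e) \<and>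
     on_line y l (snd e) \<and> (\<forall>x\<in>X. fst e < x \<and> x < snd e \<longrightarrow> \<not> on_line y l x)"

lemma seg_on_line:
  assumes "on_line y l (fst e)" "on_line y l (snd e)" "fst e < snd e"
  shows "seg y e t = fst l * t + snd l"
proof -
  have "y (snd e) - y (fst e) = fst l * (snd e - fst e)"
    using assms by (simp add: on_line_def algebra_simps)
  then have "(y (snd e) - y (fst e)) / (snd e - fst e) = fst l"
    using assms(3) by simp
  then show ?thesis using assms(1) by (simp add: seg_def on_line_def algebra_simps)
qed

lemma on_line_unique:
  assumes "on_line y l a" "on_line y l b" "on_line y m a" "on_line y m b" "a < b"
  shows "l = m"
proof -
  have "(fst l - fst m) * (a - b) = 0" using assms by (simp add: on_line_def algebra_simps)
  then have "fst l = fst m" using assms(5) by simp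
  then show ?thesis using assms by (simp add: on_line_def prod_eq_iff)
qed

lemma consecutive_unique:
  assumes "consecutive y X l e" "consecutive y X l f"
    "fst e < t" "t < snd e" "fst f < t" "t < snd f"
  shows "e = f"
proof -
  have "\<not> fst e < fst f" "\<not> fst f < fst e" "\<not> snd e < snd f" "\<not> snd f < snd e"
    using assms unfolding consecutive_def by (meson less_trans)+
  then show ?thesis by (simp add: prod_eq_iff)
qed

lemma powr_two_thirds_cube:
  assumes "(z::real) \<ge> 0"
  shows "(z powr (2 / 3)) ^ 3 = z\<^sup>2"
proof (cases "z = 0")
  case False
  then show ?thesis
    using assms powr_powr[of z "2 / 3" 3] powr_numeral[of "z powr (2 / 3)" "Num.Bit1 Num.One"]
      powr_numeral[of z "Num.Bit0 Num.One"] by simp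
qed simp

text \<open>The constant comes from \<open>288 \<le> 7 ^ 3\<close>; enlarging \<open>k ^ 2\<close>
  to \<open>k ^ 3\<close> lets \<open>k\<close> leave the cube root.\<close>

lemma cube_le_bound:
  fixes e v m k :: nat
  assumes "k \<ge> 1" "e ^ 3 \<le> 288 * k\<^sup>2 * v\<^sup>2 * m\<^sup>2"
  shows "real e \<le> 7 * real k * (real v * real m) powr (2 / 3)"
proof -
  let ?r = "7 * real k * (real v * real m) powr (2 / 3)"
  have p3: "((real v * real m) powr (2 / 3)) ^ 3 = (real v * real m)\<^sup>2"
    by (rule powr_two_thirds_cube) simp
  have "real e ^ 3 \<le> 288 * (real k)\<^sup>2 * (real v)\<^sup>2 * (real m)\<^sup>2"
    using of_nat_mono[OF assms(2), where 'a = real] by simp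
  also have "\<dots> = 288 * (real k)\<^sup>2 * (real v * real m)\<^sup>2" by (simp add: power_mult_distrib)
  also have "\<dots> \<le> 343 * real k ^ 3 * (real v * real m)\<^sup>2"
    using assms(1) by (intro mult_right_mono mult_mono power_increasing) auto
  also have "\<dots> = ?r ^ 3" by (simp add: power_mult_distrib p3)
  finally show ?thesis using power_mono_iff[of "real e" ?r 3] by simp
qed

text \<open>Optimal choice of \<open>q\<close>: with \<open>w = 6 * k * v\<close> and
  \<open>q\<close> the integer part of \<open>e / w\<close>, the vertex term is at most half of the
  left side, whence \<open>e * q ^ 2 \<le> 2 * m ^ 2\<close>. Since \<open>q\<close> is at least
  \<open>e / (2 * w)\<close>, this gives \<open>e ^ 3 \<le> 8 * w ^ 2 * m ^ 2\<close>, and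
  \<open>8 * 36 = 288\<close>.\<close>

lemma cube_le_of_sampling:
  fixes e c k v m :: nat
  assumes samp: "\<And>q. q \<ge> 1 \<Longrightarrow> e * q\<^sup>2 \<le> c + 3 * k * v * q ^ 3"
    and c: "c \<le> m\<^sup>2" and w0: "6 * k * v > 0" and we: "6 * k * v \<le> e"
  shows "e ^ 3 \<le> 288 * k\<^sup>2 * v\<^sup>2 * m\<^sup>2"
proof -
  define w where "w = 6 * k * v"
  define q where "q = e div w"
  have w: "w > 0" "w \<le> e" using w0 we by (simp_all add: w_def)
  have q1: "q \<ge> 1" using w by (simp add: q_def Suc_le_eq div_greater_zero_iff)
  have qE: "q * w \<le> e" by (simp add: q_def)
  have "e < w + q * w" using w(1) unfolding q_def by (rule dividend_less_div_times)
  moreover have "w \<le> q * w" using q1 by simp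
  ultimately have Eq: "e \<le> 2 * (q * w)" by linarith
  have "6 * k * v * q ^ 3 = q\<^sup>2 * (q * w)"
    by (simp add: w_def power2_eq_square power3_eq_cube)
  also have "\<dots> \<le> q\<^sup>2 * e" using qE by (rule mult_left_mono) simp
  finally have "6 * k * v * q ^ 3 \<le> e * q\<^sup>2" by (simp only: mult.commute)
  then have "2 * (e * q\<^sup>2) \<le> 2 * c + e * q\<^sup>2"
    using samp[OF q1] by linarith
  then have Eq2: "e * q\<^sup>2 \<le> 2 * m\<^sup>2" using c by linarith
  have "e ^ 3 = e * e\<^sup>2" by (simp add: power2_eq_square power3_eq_cube)
  also have "\<dots> \<le> e * (2 * (q * w))\<^sup>2" using Eq by (intro mult_left_mono power_mono) simp_all
  also have "\<dots> = (e * q\<^sup>2) * (4 * w\<^sup>2)" by (simp add: power2_eq_square)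
  also have "\<dots> \<le> (2 * m\<^sup>2) * (4 * w\<^sup>2)" using Eq2 by (rule mult_right_mono) simp
  also have "\<dots> = 288 * k\<^sup>2 * v\<^sup>2 * m\<^sup>2" by (simp add: w_def power2_eq_square)
  finally show ?thesis .
qed

text \<open>Szekely's argument: in the drawing that joins neighbouring points on every line,
  crossings are few because two lines meet at most once, and there are almost as many edges as
  incidences.\<close>

theorem incidence_bound:
  fixes X :: "real set" and L :: "(real \<times> real) set"
  assumes fin: "finite X" "finite L" and k: "card X \<le> 2 ^ k" "k \<ge> 1"
  shows "real (card {(x, l). x \<in> X \<and> l \<in> L \<and> on_line y l x})
    \<le> 7 * real k * ((real (card X) * real (card L)) powr (2 / 3) + real (card X) + real (card L))"
proof -
  define E where "E = {e. \<exists>l\<in>L. consecutive y X l e}"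
  define I where "I = {(x, l). x \<in> X \<and> l \<in> L \<and> on_line y l x}"
  have finI: "finite I" using fin by (intro finite_subset[of I "X \<times> L"]) (auto simp: I_def)
  have finE: "finite E"
    using fin by (intro finite_subset[of E "X \<times> X"]) (auto simp: E_def consecutive_def)
  have "\<forall>e\<in>E. \<exists>l. l \<in> L \<and> consecutive y X l e" unfolding E_def by blast
  from bchoice[OF this] obtain c where c: "\<And>e. e \<in> E \<Longrightarrow> c e \<in> L \<and> consecutive y X (c e) e"
    by blast
  have segc: "seg y e t = fst (c e) * t + snd (c e)" if "e \<in> E" for e t
    using c[OF that] by (intro seg_on_line) (auto simp: consecutive_def)
  have G: "geometric_graph y X E"
    unfolding geometric_graph_def
  proof (intro conjI ballI impI fin)
    fix e assume e: "e \<in> E"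
    then show "fst e \<in> X" "snd e \<in> X" "fst e < snd e" using c[OF e] by (auto simp: consecutive_def)
    fix x assume "x \<in> X" "fst e < x \<and> x < snd e"
    then show "y x \<noteq> seg y e x" using c[OF e] segc[OF e] by (auto simp: consecutive_def on_line_def)
  qed
  \<comment> \<open>A crossing determines the ordered pair of its lines, which are distinct. These
    fix the meeting abscissa, and over it each line has only one edge.\<close>
  have cr: "card (crossings y E) \<le> (card L)\<^sup>2"
  proof -
    have "inj_on (\<lambda>p. (c (fst p), c (snd p))) (crossings y E)"
    proof (rule inj_onI)
      fix p q
      assume pq: "p \<in> crossings y E" "q \<in> crossings y E"
        and "(c (fst p), c (snd p)) = (c (fst q), c (snd q))"
      then have eqs: "c (fst p) = c (fst q)" "c (snd p) = c (snd q)" by auto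
      obtain e f where p: "p = (e, f)" by (cases p)
      obtain e' f' where q: "q = (e', f')" by (cases q)
      from pq obtain t t' where E: "e \<in> E" "f \<in> E" "e' \<in> E" "f' \<in> E"
        and t: "fst e < t" "t < snd e" "fst f < t" "t < snd f" "seg y e t = seg y f t"
        and t': "fst e' < t'" "t' < snd e'" "fst f' < t'" "t' < snd f'" "seg y e' t' = seg y f' t'"
        and ne: "e \<noteq> f"
        unfolding crossings_def crosses_def p q by auto
      have cc: "c e' = c e" "c f' = c f" using eqs by (simp_all add: p q)
      have con: "consecutive y X (c e) e" "consecutive y X (c f) f"
        "consecutive y X (c e) e'" "consecutive y X (c f) f'"
        using c[OF E(1)] c[OF E(2)] c[OF E(3)] c[OF E(4)] by (simp_all add: cc)
      have cne: "c e \<noteq> c f"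
        using consecutive_unique[OF con(1), of f t] con(2) t ne by auto
      have "t = t'"
      proof (rule ccontr)
        assume "t \<noteq> t'"
        have 1: "fst (c e) * t + snd (c e) = fst (c f) * t + snd (c f)"
          using t(5) segc[OF E(1)] segc[OF E(2)] by simp
        have 2: "fst (c e) * t' + snd (c e) = fst (c f) * t' + snd (c f)"
          using t'(5) segc[OF E(3)] segc[OF E(4)] cc by simp
        from 1 2 have "(fst (c e) - fst (c f)) * (t - t') = 0"
          by (simp add: algebra_simps)
        then have "fst (c e) = fst (c f)" using \<open>t \<noteq> t'\<close> by simp
        with 1 cne show False by (simp add: prod_eq_iff)
      qed
      then have "e = e'" "f = f'"
        using consecutive_unique[OF con(1) con(3) t(1,2)] t'(1,2)
          consecutive_unique[OF con(2) con(4) t(3,4)] t'(3,4) by simp_all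
      then show "p = q" by (simp add: p q)
    qed
    then have "card (crossings y E) \<le> card (L \<times> L)"
      using c fin by (intro card_inj_on_le) (auto simp: crossings_def)
    then show ?thesis by (simp add: power2_eq_square card_cartesian_product)
  qed
  have IE: "card I \<le> card E + card L"
  proof -
    \<comment> \<open>\<open>M\<close> collects the incidences at the last point of each line; every
      other incidence is charged to the edge that leads to the next point.\<close>
    define M where "M = {(x, l) \<in> I. \<forall>z\<in>X. x < z \<longrightarrow> \<not> on_line y l z}"
    have "inj_on snd M"
    proof (rule inj_onI)
      fix p q assume pq: "p \<in> M" "q \<in> M" "snd p = snd q"
      then have "\<not> fst p < fst q" "\<not> fst q < fst p" by (auto simp: M_def I_def)
      then show "p = q" using pq by (simp add: prod_eq_iff)
    qed
    then have cM: "card M \<le> card L"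
      using fin by (intro card_inj_on_le[of snd]) (auto simp: M_def I_def)
    have "\<exists>z. consecutive y X (snd p) (fst p, z)" if p: "p \<in> I - M" for p
    proof -
      let ?Z = "{z \<in> X. fst p < z \<and> on_line y (snd p) z}"
      have "?Z \<noteq> {}" using p by (auto simp: M_def)
      then obtain z where z: "z \<in> ?Z" "\<forall>w\<in>?Z. z \<le> w"
        using ex_minimal_value[of ?Z "\<lambda>z. z"] fin by auto
      then have "consecutive y X (snd p) (fst p, z)"
        using p by (force simp: consecutive_def I_def)
      then show ?thesis by blast
    qed
    then have "\<forall>p\<in>I - M. \<exists>z. consecutive y X (snd p) (fst p, z)" by blast
    from bchoice[OF this] obtain z where z: "\<And>p. p \<in> I - M \<Longrightarrow> consecutive y X (snd p) (fst p, z p)"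
      by blast
    have "inj_on (\<lambda>p. (fst p, z p)) (I - M)"
    proof (rule inj_onI)
      fix p q assume pq: "p \<in> I - M" "q \<in> I - M" "(fst p, z p) = (fst q, z q)"
      then have "snd p = snd q"
        using z[OF pq(1)] z[OF pq(2)] on_line_unique[of y "snd p" "fst p" "z p" "snd q"]
        by (auto simp: consecutive_def)
      then show "p = q" using pq by (simp add: prod_eq_iff)
    qed
    moreover have "(\<lambda>p. (fst p, z p)) ` (I - M) \<subseteq> E"
    proof (rule image_subsetI)
      fix p assume p: "p \<in> I - M"
      then have "snd p \<in> L" by (auto simp: I_def)
      then show "(fst p, z p) \<in> E" using z[OF p] unfolding E_def by blast
    qed
    ultimately have cD: "card (I - M) \<le> card E"
      using finE by (rule card_inj_on_le)
    have "(I - M) \<union> M = I" unfolding M_def by blast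
    then have "card I \<le> card (I - M) + card M" using card_Un_le[of "I - M" M] by simp
    then show ?thesis using cM cD by linarith
  qed
  have "real (card E) \<le> 6 * real k * real (card X) + 7 * real k * (real (card X) * real (card L)) powr (2 / 3)"
  \<comment> \<open>With so few edges no \<open>q \<ge> 1\<close> would be available, but then the
    linear term alone suffices.\<close>
  proof (cases "card E < 6 * k * card X")
    case True
    then have "real (card E) \<le> real (6 * k * card X)" by (intro of_nat_mono) simp
    then have "real (card E) \<le> 6 * real k * real (card X)" by simp
    then show ?thesis by (rule add_increasing2[rotated]) simp
  next
    case False
    show ?thesis
    proof (cases "card X = 0")
      case True
      then have "E = {}" using fin geometric_graphD(1)[OF G] by auto
      then show ?thesis by simp
    next
      case False
      have "card E ^ 3 \<le> 288 * k\<^sup>2 * (card X)\<^sup>2 * (card L)\<^sup>2"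
      proof (rule cube_le_of_sampling[OF _ cr])
        show "card E * q\<^sup>2 \<le> card (crossings y E) + 3 * k * card X * q ^ 3" if "q \<ge> 1" for q
          by (rule crossing_inequality[OF G k(1) that])
        show "6 * k * card X > 0" using False k(2) by simp
        show "6 * k * card X \<le> card E" using \<open>\<not> card E < 6 * k * card X\<close> by simp
      qed
      then have "real (card E) \<le> 7 * real k * (real (card X) * real (card L)) powr (2 / 3)"
        by (rule cube_le_bound[OF k(2)])
      then show ?thesis by (rule add_increasing[rotated]) simp
    qed
  qed
  moreover have "real (card I) \<le> real (card E) + real (card L)" using IE by linarith
  moreover have "real (card L) \<le> 7 * real k * real (card L)"
    using k(2) by (simp add: mult_le_cancel_right1)
  moreover have "6 * real k * real (card X) \<le> 7 * real k * real (card X)"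
    by (intro mult_right_mono) simp_all
  ultimately show ?thesis unfolding I_def distrib_left by linarith
qed

section \<open>Orthogonality on the sphere\<close>

unbundle cross3_syntax

lemma card_le_fibres:
  assumes "finite I" "finite J" "f ` I \<subseteq> J" "\<And>j. j \<in> J \<Longrightarrow> card {i \<in> I. f i = j} \<le> c"
  shows "card I \<le> c * card J"
proof -
  have "I = (\<Union>j\<in>J. {i \<in> I. f i = j})" using assms(3) by blast
  then have "card I \<le> (\<Sum>j\<in>J. card {i \<in> I. f i = j})"
    using card_UN_le[OF assms(2), of "\<lambda>j. {i \<in> I. f i = j}"] by simp
  also have "\<dots> \<le> (\<Sum>j\<in>J. c)" by (intro sum_mono assms(4))
  finally show ?thesis by (simp add: mult.commute)
qed

lemma mem_S2_iff: "p \<in> S2 \<longleftrightarrow> p \<bullet> p = 1 / 2"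
proof -
  have "p \<in> S2 \<longleftrightarrow> norm p = sqrt (1 / 2)" by (simp add: S2_def real_sqrt_divide)
  also have "\<dots> \<longleftrightarrow> p \<bullet> p = 1 / 2"
    unfolding norm_eq_sqrt_inner by (rule real_sqrt_eq_iff)
  finally show ?thesis .
qed

lemma uminus_mem_S2 [simp]: "- p \<in> S2 \<longleftrightarrow> p \<in> S2"
  by (simp add: mem_S2_iff)

lemma S2_nonzero: "p \<in> S2 \<Longrightarrow> p \<noteq> 0"
  by (auto simp: mem_S2_iff)

lemma S2_neq_uminus: "p \<in> S2 \<Longrightarrow> p \<noteq> - p"
proof
  assume "p \<in> S2" "p = - p"
  then have "p \<bullet> p = - (p \<bullet> p)" by (metis inner_minus_right)
  then show False using \<open>p \<in> S2\<close> by (simp add: mem_S2_iff)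
qed

text \<open>This is what the radius \<open>1 / sqrt 2\<close> is for: the squared distance is
  \<open>1 - 2 * (p \<bullet> q)\<close>.\<close>

lemma dist_eq_1_iff:
  assumes "p \<in> S2" "q \<in> S2"
  shows "dist p q = 1 \<longleftrightarrow> p \<bullet> q = 0"
proof -
  have "dist p q = 1 \<longleftrightarrow> (norm (p - q))\<^sup>2 = 1"
    by (simp add: dist_norm power2_eq_1_iff)
      (metis norm_ge_zero not_one_le_zero neg_0_le_iff_le le_minus_one_simps(3) order_trans)
  also have "(norm (p - q))\<^sup>2 = 1 - 2 * (p \<bullet> q)"
    using assms by (simp add: mem_S2_iff power2_norm_eq_inner inner_diff_left inner_diff_right inner_commute)
  finally show ?thesis by simp
qed

text \<open>Radial projection to the sphere. As \<open>hat 0 = 0\<close> is not on it, nonzero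
  hypotheses accompany its use.\<close>

definition hat :: "real ^ 3 \<Rightarrow> real ^ 3" where
  "hat x = (1 / (sqrt 2 * norm x)) *\<^sub>R x"

lemma hat_mem_S2: "x \<noteq> 0 \<Longrightarrow> hat x \<in> S2"
  by (simp add: hat_def S2_def)

lemma inner_hat_eq_0_iff: "x \<noteq> 0 \<Longrightarrow> hat x \<bullet> y = 0 \<longleftrightarrow> x \<bullet> y = 0"
  by (simp add: hat_def)

lemma cross_hat_eq_0_iff: "x \<noteq> 0 \<Longrightarrow> y \<times> hat x = 0 \<longleftrightarrow> y \<times> x = 0"
  by (simp add: hat_def cross_mult_right)

text \<open>The Lagrange identity for \<open>p \<times> (p \<times> q)\<close> makes
  \<open>q\<close> a multiple of \<open>p\<close>, and comparing norms leaves the factors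
  \<open>1\<close> and \<open>- 1\<close>.\<close>

lemma S2_parallel:
  assumes "p \<in> S2" "q \<in> S2" "p \<times> q = 0"
  shows "q = p \<or> q = - p"
proof -
  have "p \<times> (p \<times> q) = (p \<bullet> q) *\<^sub>R p - (p \<bullet> p) *\<^sub>R q" by (rule Lagrange)
  then have "(1 / 2) *\<^sub>R q = (p \<bullet> q) *\<^sub>R p" using assms by (simp add: mem_S2_iff)
  then have "2 *\<^sub>R ((1 / 2) *\<^sub>R q) = 2 *\<^sub>R ((p \<bullet> q) *\<^sub>R p)" by simp
  then have q: "q = (2 * (p \<bullet> q)) *\<^sub>R p" by simp
  then have "q \<bullet> q = (2 * (p \<bullet> q))\<^sup>2 * (p \<bullet> p)"
    by (metis inner_scaleR_left inner_scaleR_right mult.assoc power2_eq_square)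
  then have "1 / 2 = (2 * (p \<bullet> q))\<^sup>2 * (1 / 2)" using assms unfolding mem_S2_iff by metis
  then have "(2 * (p \<bullet> q))\<^sup>2 = 1" by simp
  then have "2 * (p \<bullet> q) = 1 \<or> 2 * (p \<bullet> q) = - 1" by (simp only: power2_eq_1_iff)
  then show ?thesis using q by (metis scaleR_one scaleR_minus1_left)
qed

definition common :: "real ^ 3 \<Rightarrow> real ^ 3 \<Rightarrow> (real ^ 3) set" where
  "common u v = {z \<in> S2. z \<bullet> u = 0 \<and> z \<bullet> v = 0}"

text \<open>A vector orthogonal to both points is parallel to \<open>u \<times> v\<close>, and this
  line meets the sphere in two antipodal points.\<close>

lemma common_neighbours:
  assumes "u \<in> S2" "v \<in> S2" "v \<noteq> u" "v \<noteq> - u"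
  shows "finite (common u v)" "card (common u v) \<le> 2"
proof -
  define c where "c = hat (u \<times> v)"
  have nz: "u \<times> v \<noteq> 0" using S2_parallel[of u v] assms by auto
  have "common u v \<subseteq> {c, - c}"
  proof
    fix z assume z: "z \<in> common u v"
    then have "z \<times> (u \<times> v) = 0" by (simp add: common_def Lagrange)
    then have "z \<times> c = 0" using nz by (simp add: c_def cross_hat_eq_0_iff)
    then have "c = z \<or> c = - z"
      using z hat_mem_S2[OF nz] by (intro S2_parallel) (auto simp: common_def c_def)
    then show "z \<in> {c, - c}" by auto
  qed
  moreover have "finite {c, - c}" "card {c, - c} \<le> 2" by (simp_all add: card_insert_if)
  ultimately show "finite (common u v)" "card (common u v) \<le> 2"
    by (meson finite_subset, meson card_mono order_trans)
qed

section \<open>Generic vectors and frames\<close>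

lemma ex_generic_vector:
  fixes Z :: "(real ^ 3) set"
  assumes "finite Z" "0 \<notin> Z"
  shows "\<exists>a \<in> S2. \<forall>z\<in>Z. a \<bullet> z \<noteq> 0"
proof -
  \<comment> \<open>The extra plane orthogonal to \<open>axis 1 1\<close> guarantees
    \<open>x \<noteq> 0\<close> even for empty \<open>Z\<close>.\<close>
  let ?N = "\<Union>z\<in>insert (axis 1 1) Z. {x. z \<bullet> x = 0}"
  have "negligible ?N"
    using assms by (intro negligible_Union) (auto intro!: negligible_hyperplane)
  then have "?N \<noteq> UNIV" using non_negligible_UNIV by metis
  then obtain x where x: "x \<notin> ?N" by blast
  then have "x \<noteq> 0" by auto
  then show ?thesis
    using x by (intro bexI[of _ "hat x"]) (auto simp: inner_hat_eq_0_iff hat_mem_S2 inner_commute[of _ x])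
qed

lemma ex_generic_unit_vector:
  fixes Z :: "(real ^ 3) set"
  assumes "finite Z" "0 \<notin> Z"
  shows "\<exists>a. norm a = 1 \<and> (\<forall>z\<in>Z. a \<bullet> z \<noteq> 0)"
proof -
  obtain a where a: "a \<in> S2" "\<forall>z\<in>Z. a \<bullet> z \<noteq> 0" using ex_generic_vector[OF assms] by blast
  then show ?thesis by (intro exI[of _ "sqrt 2 *\<^sub>R a"]) (auto simp: S2_def)
qed

text \<open>Avoiding the line through \<open>p\<close> is reduced to avoiding a plane that contains
  it: if \<open>g p\<close> is orthogonal to \<open>p\<close>, then
  \<open>a \<bullet> g p \<noteq> 0\<close> prevents \<open>a\<close> from being parallel to
  \<open>p\<close>.\<close>

lemma ex_generic_non_parallel:
  fixes P Z :: "(real ^ 3) set"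
  assumes "finite P" "0 \<notin> P" "finite Z" "0 \<notin> Z"
  shows "\<exists>a\<in>S2. (\<forall>p\<in>P. p \<times> a \<noteq> 0) \<and> (\<forall>z\<in>Z. a \<bullet> z \<noteq> 0)"
proof -
  have "\<exists>z. z \<noteq> 0 \<and> p \<bullet> z = 0" for p :: "real ^ 3"
    using orthogonal_to_vector_exists[of p] by (auto simp: orthogonal_def)
  then obtain g :: "real ^ 3 \<Rightarrow> real ^ 3" where g: "\<And>p. g p \<noteq> 0" "\<And>p. p \<bullet> g p = 0" by metis
  obtain a where a: "a \<in> S2" "\<forall>z\<in>g ` P \<union> Z. a \<bullet> z \<noteq> 0"
    using ex_generic_vector[of "g ` P \<union> Z"] assms g by force
  have "p \<times> a \<noteq> 0" if p: "p \<in> P" for p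
  proof
    assume 0: "p \<times> a = 0"
    have "p \<times> (p \<times> a) = (p \<bullet> a) *\<^sub>R p - (p \<bullet> p) *\<^sub>R a" by (rule Lagrange)
    then have "(p \<bullet> p) *\<^sub>R a = (p \<bullet> a) *\<^sub>R p" using 0 by simp
    then have "(p \<bullet> p) * (a \<bullet> g p) = (p \<bullet> a) * (p \<bullet> g p)" by (metis inner_scaleR_left)
    moreover have "a \<bullet> g p \<noteq> 0" using a p by blast
    ultimately have "p = 0" using g(2)[of p] by simp
    then show False using p assms by blast
  qed
  then show ?thesis using a by blast
qed

text \<open>Being orthogonal to \<open>v\<close>, the vector \<open>w\<close> is not free in space.
  It is taken proportional to \<open>v \<times> b\<close> with a generic \<open>b\<close>, since
  \<open>(v \<times> b) \<bullet> p = b \<bullet> (p \<times> v)\<close>. The last condition will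
  separate the abscissas of points that are neither equal nor antipodal.\<close>

lemma ex_generic_frame:
  fixes P :: "(real ^ 3) set"
  assumes "finite P" "P \<subseteq> S2" "P \<noteq> {}"
  shows "\<exists>v w. norm v = 1 \<and> norm w = 1 \<and> v \<bullet> w = 0 \<and> (\<forall>p\<in>P. v \<bullet> p \<noteq> 0 \<and> w \<bullet> p \<noteq> 0) \<and>
    (\<forall>p\<in>P. \<forall>q\<in>P. p \<times> q \<noteq> 0 \<longrightarrow> v \<bullet> (p \<times> q) \<noteq> 0)"
proof -
  have P0: "0 \<notin> P" using assms S2_nonzero by blast
  define Z where "Z = (P \<union> (\<Union>p\<in>P. (\<lambda>q. p \<times> q) ` P)) - {0}"
  have "finite Z" "0 \<notin> Z" using assms by (auto simp: Z_def)
  then obtain v0 where v0: "v0 \<in> S2" "\<forall>p\<in>P. p \<times> v0 \<noteq> 0" "\<forall>z\<in>Z. v0 \<bullet> z \<noteq> 0"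
    using ex_generic_non_parallel[OF assms(1) P0] by blast
  define v where "v = sqrt 2 *\<^sub>R v0"
  have v: "norm v = 1" "\<forall>p\<in>P. p \<times> v \<noteq> 0" "\<forall>z\<in>Z. v \<bullet> z \<noteq> 0"
    using v0 by (auto simp: v_def S2_def cross_mult_right)
  obtain b where b: "norm b = 1" "\<forall>z\<in>(\<lambda>p. p \<times> v) ` P. b \<bullet> z \<noteq> 0"
    using ex_generic_unit_vector[of "(\<lambda>p. p \<times> v) ` P"] assms v(2) by force
  have vb: "(v \<times> b) \<bullet> p = b \<bullet> (p \<times> v)" for p
    using cross_triple[of v b p] cross_triple[of b p v] by (simp add: inner_commute)
  have nz: "v \<times> b \<noteq> 0" using assms(3) b(2) vb by (metis all_not_in_conv image_eqI inner_zero_left)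
  define w where "w = (1 / norm (v \<times> b)) *\<^sub>R (v \<times> b)"
  have "norm w = 1" "v \<bullet> w = 0" using nz by (simp_all add: w_def dot_cross_self)
  moreover have "\<forall>p\<in>P. w \<bullet> p \<noteq> 0" using nz b(2) vb by (simp add: w_def)
  moreover have "\<forall>p\<in>P. v \<bullet> p \<noteq> 0" using v(3) P0 by (auto simp: Z_def)
  moreover have "\<forall>p\<in>P. \<forall>q\<in>P. p \<times> q \<noteq> 0 \<longrightarrow> v \<bullet> (p \<times> q) \<noteq> 0" using v(3) by (auto simp: Z_def)
  ultimately show ?thesis using v(1) by blast
qed

text \<open>The product of the determinants of \<open>(v, w, p)\<close> and \<open>(v, w, q)\<close>
  is the determinant of the mutual inner products, expanded here along its first row.\<close>

lemma gram_cross: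
  fixes v w p q :: "real ^ 3"
  shows "((v \<times> w) \<bullet> p) * ((v \<times> w) \<bullet> q) =
    (v \<bullet> v) * ((w \<bullet> w) * (p \<bullet> q) - (w \<bullet> q) * (w \<bullet> p))
    - (v \<bullet> w) * ((v \<bullet> w) * (p \<bullet> q) - (w \<bullet> q) * (v \<bullet> p))
    + (v \<bullet> q) * ((v \<bullet> w) * (w \<bullet> p) - (w \<bullet> w) * (v \<bullet> p))"
  by (simp add: inner_vec_def sum_3 cross_components algebra_simps)

lemma inner_frame:
  fixes v w p q :: "real ^ 3"
  assumes "norm v = 1" "norm w = 1" "v \<bullet> w = 0"
  shows "p \<bullet> q = ((v \<times> w) \<bullet> p) * ((v \<times> w) \<bullet> q) + (v \<bullet> p) * (v \<bullet> q) + (w \<bullet> p) * (w \<bullet> q)"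
proof -
  have "v \<bullet> v = 1" "w \<bullet> w = 1" using assms by (simp_all add: norm_eq_1)
  then show ?thesis using gram_cross[of v w p q] assms(3) by (simp add: mult.commute)
qed

text \<open>Up to nonzero denominators this minor is the difference of the abscissas of
  \<open>p\<close> and \<open>q\<close> in the projection used below.\<close>

lemma frame_minor:
  fixes v w p q :: "real ^ 3"
  assumes "norm v = 1" "norm w = 1" "v \<bullet> w = 0"
  shows "((v \<times> w) \<bullet> p) * (w \<bullet> q) - ((v \<times> w) \<bullet> q) * (w \<bullet> p) = - (v \<bullet> (p \<times> q))"
proof -
  have "((v \<times> w) \<bullet> p) * (w \<bullet> q) - ((v \<times> w) \<bullet> q) * (w \<bullet> p)
      = (v \<bullet> w) * (w \<bullet> (p \<times> q)) - (w \<bullet> w) * (v \<bullet> (p \<times> q))"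
    by (simp add: inner_vec_def sum_3 cross_components algebra_simps)
  moreover have "w \<bullet> w = 1" using assms by (simp add: norm_eq_1)
  ultimately show ?thesis using assms(3) by simp
qed

section \<open>The incidence bound on the sphere\<close>

text \<open>With \<open>u = v \<times> w\<close>, central projection sends \<open>p\<close> to the
  planar point with coordinates \<open>x p\<close> and \<open>h p\<close>, and the great circle
  polar to \<open>q\<close> to the line \<open>l q\<close>. Both maps identify exactly antipodal
  points, so a planar incidence comes from at most four pairs; this turns the constant
  \<open>7\<close> into \<open>28\<close>.\<close>

lemma sphere_incidences_aux:
  assumes P: "finite P" "P \<subseteq> S2" and A: "A \<subseteq> P" and B: "B \<subseteq> P"
    and k: "card A \<le> 2 ^ k" "k \<ge> 1"
  shows "real (card {(p, q). p \<in> A \<and> q \<in> B \<and> p \<bullet> q = 0})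
    \<le> 28 * real k * ((real (card A) * real (card B)) powr (2 / 3) + real (card A) + real (card B))"
proof (cases "P = {}")
  case False
  define I where "I = {(p, q). p \<in> A \<and> q \<in> B \<and> p \<bullet> q = 0}"
  have fAB: "finite A" "finite B" using assms finite_subset by blast+
  obtain v w where on: "norm v = 1" "norm w = 1" "v \<bullet> w = 0"
    and nz: "\<And>p. p \<in> P \<Longrightarrow> v \<bullet> p \<noteq> 0 \<and> w \<bullet> p \<noteq> 0"
    and gen: "\<And>p q. p \<in> P \<Longrightarrow> q \<in> P \<Longrightarrow> p \<times> q \<noteq> 0 \<Longrightarrow> v \<bullet> (p \<times> q) \<noteq> 0"
    using ex_generic_frame[OF P(1,2) False] by metis
  define u where "u = v \<times> w"
  define x where "x p = (u \<bullet> p) / (w \<bullet> p)" for p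
  define h where "h p = (v \<bullet> p) / (w \<bullet> p)" for p
  define l where "l q = (- (u \<bullet> q) / (v \<bullet> q), - (w \<bullet> q) / (v \<bullet> q))" for q
  have x_inj: "q = p \<or> q = - p" if "p \<in> P" "q \<in> P" "x p = x q" for p q
  proof -
    have "(u \<bullet> p) * (w \<bullet> q) - (u \<bullet> q) * (w \<bullet> p) = 0"
      using that nz[OF that(1)] nz[OF that(2)] by (simp add: x_def field_simps)
    then have "v \<bullet> (p \<times> q) = 0" using frame_minor[OF on, of p q] by (simp add: u_def)
    then have "p \<times> q = 0" using gen that by blast
    then show ?thesis using that P S2_parallel by blast
  qed
  have h_eq: "h p = h q" if "p \<in> P" "q \<in> P" "x p = x q" for p q
    using x_inj[OF that] by (auto simp: h_def)
  have l_inj: "q = p \<or> q = - p" if p: "p \<in> P" and q: "q \<in> P" and eq: "l p = l q" for p q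
  proof -
    define c where "c = (v \<bullet> p) / (v \<bullet> q)"
    have c: "v \<bullet> p = c * (v \<bullet> q)" "u \<bullet> p = c * (u \<bullet> q)" "w \<bullet> p = c * (w \<bullet> q)"
      using eq nz[OF p] nz[OF q] by (simp_all add: c_def l_def field_simps)
    have "p \<bullet> z = (c *\<^sub>R q) \<bullet> z" for z
      using inner_frame[OF on, of p z] inner_frame[OF on, of q z] c
      by (simp add: u_def[symmetric] algebra_simps)
    then have "p = c *\<^sub>R q" using vector_eq_rdot by blast
    then have "q \<times> p = 0" by (simp add: cross_mult_right)
    then have "p = q \<or> p = - q" using P p q S2_parallel by blast
    then show ?thesis by auto
  qed
  \<comment> \<open>The choice is harmless: points with the same abscissa are equal or antipodal and
    have the same \<open>h\<close>.\<close>
  define y where "y t = h (SOME p. p \<in> A \<and> x p = t)" for t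
  have y: "y (x p) = h p" if "p \<in> A" for p
  proof -
    have "(SOME q. q \<in> A \<and> x q = x p) \<in> A \<and> x (SOME q. q \<in> A \<and> x q = x p) = x p"
      by (rule someI[of _ p]) (simp add: that)
    then show ?thesis unfolding y_def using h_eq that A by blast
  qed
  define J where "J = {(t, m). t \<in> x ` A \<and> m \<in> l ` B \<and> on_line y m t}"
  have inc: "on_line y (l q) (x p)" if "p \<in> A" "q \<in> B" "p \<bullet> q = 0" for p q
  proof -
    have 0: "(u \<bullet> p) * (u \<bullet> q) + (v \<bullet> p) * (v \<bullet> q) + (w \<bullet> p) * (w \<bullet> q) = 0"
      using inner_frame[OF on, of p q] that(3) by (simp add: u_def)
    have nz': "w \<bullet> p \<noteq> 0" "v \<bullet> q \<noteq> 0" using nz that A B by blast+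
    have "(v \<bullet> p) * (v \<bullet> q) = - ((u \<bullet> q) * (u \<bullet> p)) - (w \<bullet> q) * (w \<bullet> p)" using 0 by (simp add: mult.commute)
    then have "(v \<bullet> p) / (w \<bullet> p) = - (u \<bullet> q) / (v \<bullet> q) * ((u \<bullet> p) / (w \<bullet> p)) + - (w \<bullet> q) / (v \<bullet> q)"
      using nz' by (simp add: field_simps)
    then show ?thesis using y[OF that(1)] by (simp add: on_line_def l_def x_def h_def)
  qed
  have finI: "finite I" using fAB by (intro finite_subset[of I "Sigma A (\<lambda>_. B)"]) (auto simp: I_def)
  have finJ: "finite J" using fAB by (intro finite_subset[of J "Sigma (x ` A) (\<lambda>_. l ` B)"]) (auto simp: J_def)
  have "card I \<le> 4 * card J"
  proof (rule card_le_fibres[of _ _ "\<lambda>(p, q). (x p, l q)"])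
    show "(\<lambda>(p, q). (x p, l q)) ` I \<subseteq> J" using inc by (auto simp: I_def J_def)
    fix j
    show "card {i \<in> I. (case i of (p, q) \<Rightarrow> (x p, l q)) = j} \<le> 4"
    proof (cases "{i \<in> I. (case i of (p, q) \<Rightarrow> (x p, l q)) = j} = {}")
      case False
      then obtain p0 q0 where pq: "p0 \<in> A" "q0 \<in> B" "j = (x p0, l q0)" by (auto simp: I_def)
      have "{i \<in> I. (case i of (p, q) \<Rightarrow> (x p, l q)) = j} \<subseteq> set [(p0, q0), (- p0, q0), (p0, - q0), (- p0, - q0)]"
      proof
        fix i assume i: "i \<in> {i \<in> I. (case i of (p, q) \<Rightarrow> (x p, l q)) = j}"
        obtain p q where pq': "i = (p, q)" by (cases i)
        have "p \<in> P" "q \<in> P" "x p0 = x p" "l q0 = l q" "p0 \<in> P" "q0 \<in> P"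
          using i pq A B by (auto simp: I_def pq')
        then have "p = p0 \<or> p = - p0" "q = q0 \<or> q = - q0" using x_inj l_inj by blast+
        then show "i \<in> set [(p0, q0), (- p0, q0), (p0, - q0), (- p0, - q0)]" by (auto simp: pq')
      qed
      then have "card {i \<in> I. (case i of (p, q) \<Rightarrow> (x p, l q)) = j} \<le> card (set [(p0, q0), (- p0, q0), (p0, - q0), (- p0, - q0)])"
        by (rule card_mono[rotated]) simp
      also have "\<dots> \<le> 4" by (rule order_trans[OF card_length]) simp
      finally show ?thesis .
    next
      case True
      show ?thesis unfolding True by simp
    qed
  qed (use finI finJ in auto)
  then have "real (card I) \<le> 4 * real (card J)" by linarith
  also have "real (card J) \<le> 7 * real k * ((real (card (x ` A)) * real (card (l ` B))) powr (2 / 3) + real (card (x ` A)) + real (card (l ` B)))"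
    unfolding J_def using fAB k card_image_le[OF fAB(1), of x]
    by (intro incidence_bound) auto
  also have "\<dots> \<le> 7 * real k * ((real (card A) * real (card B)) powr (2 / 3) + real (card A) + real (card B))"
    using fAB by (intro mult_left_mono add_mono powr_mono2 mult_mono) (auto intro: card_image_le)
  finally show ?thesis by (simp add: I_def)
qed (use A B in auto)

lemma ln_ge_1: "n \<ge> 3 \<Longrightarrow> ln (real n) \<ge> 1"
  using exp_le by (subst ln_ge_iff) (auto intro: order_trans)

text \<open>As \<open>ln 2 \<ge> 1 / 2\<close>, the binary logarithm is at most
  \<open>2 * ln n\<close>; rounding up costs at most \<open>1 \<le> ln n\<close>. Hence the constant
  \<open>84 = 28 * 3\<close> in what follows.\<close>

lemma ex_log_bound:
  assumes "n \<ge> (3::nat)"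
  shows "\<exists>k\<ge>1. n \<le> 2 ^ k \<and> real k \<le> 3 * ln (real n)"
proof (intro exI conjI)
  define k where "k = nat \<lceil>log 2 (real n)\<rceil>"
  have lg: "log 2 (real n) > 0" using assms by simp
  have "real n = 2 powr (log 2 (real n))" using assms by simp
  also have "\<dots> \<le> 2 powr (real k)" by (intro powr_mono) (auto simp: k_def real_nat_ceiling_ge)
  finally have "real n \<le> real (2 ^ k)" by (simp add: powr_realpow)
  then show "n \<le> 2 ^ k" by (simp only: of_nat_le_iff)
  show "1 \<le> k" using lg by (simp add: k_def Suc_leI)
  have "exp (1 / 2 :: real) ^ 2 = exp 1" by (simp add: exp_double[symmetric] power2_eq_square flip: exp_add)
  then have "exp (1 / 2 :: real) ^ 2 \<le> 2 ^ 2" using exp_le by simp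
  then have "exp (1 / 2 :: real) \<le> 2" by (rule power2_le_imp_le) simp
  then have "ln 2 \<ge> (1 / 2 :: real)" by (subst ln_ge_iff) auto
  then have "log 2 (real n) \<le> ln (real n) / (1 / 2)"
    unfolding log_def using ln_ge_1[OF assms] by (intro divide_left_mono) auto
  moreover have "real k \<le> log 2 (real n) + 1" using lg unfolding k_def by linarith
  ultimately show "real k \<le> 3 * ln (real n)" using ln_ge_1[OF assms] by simp
qed

lemma sphere_incidences:
  assumes P: "finite P" "P \<subseteq> S2" "card P = n" "n \<ge> 3" and AB: "A \<subseteq> P" "B \<subseteq> P"
  shows "real (card {(p, q). p \<in> A \<and> q \<in> B \<and> p \<bullet> q = 0})
    \<le> 84 * ln (real n) * ((real (card A) * real (card B)) powr (2 / 3) + real (card A) + real (card B))"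
proof -
  obtain k where k: "k \<ge> 1" "n \<le> 2 ^ k" "real k \<le> 3 * ln (real n)"
    using ex_log_bound[OF P(4)] by blast
  have "card A \<le> 2 ^ k" using card_mono[OF P(1) AB(1)] P(3) k by linarith
  then have "real (card {(p, q). p \<in> A \<and> q \<in> B \<and> p \<bullet> q = 0})
      \<le> 28 * real k * ((real (card A) * real (card B)) powr (2 / 3) + real (card A) + real (card B))"
    by (rule sphere_incidences_aux[OF P(1,2) AB _ k(1)])
  also have "\<dots> \<le> 84 * ln (real n) * ((real (card A) * real (card B)) powr (2 / 3) + real (card A) + real (card B))"
    using k by (intro mult_right_mono) auto
  finally show ?thesis .
qed

section \<open>Paths with four vertices\<close>

definition nb :: "(real ^ 3) set \<Rightarrow> real ^ 3 \<Rightarrow> (real ^ 3) set" where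
  "nb P p = {q \<in> P. p \<bullet> q = 0}"

definition orth_pairs :: "(real ^ 3) set \<Rightarrow> (real ^ 3) set \<Rightarrow> ((real ^ 3) \<times> (real ^ 3)) set" where
  "orth_pairs A B = {(p, q). p \<in> A \<and> q \<in> B \<and> p \<bullet> q = 0}"

lemma orth_pairs_Sigma: "B \<subseteq> P \<Longrightarrow> orth_pairs A B = Sigma A (\<lambda>p. nb P p \<inter> B)"
  by (auto simp: orth_pairs_def nb_def)

lemma finite_nb: "finite P \<Longrightarrow> finite (nb P p)"
  by (simp add: nb_def)

lemma finite_orth_pairs: "finite A \<Longrightarrow> finite B \<Longrightarrow> finite (orth_pairs A B)"
  by (rule finite_subset[of _ "Sigma A (\<lambda>_. B)"]) (auto simp: orth_pairs_def)

lemma card_orth_pairs_eq_sum: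
  assumes "finite P" "finite A"
  shows "card (orth_pairs A P) = (\<Sum>p\<in>A. card (nb P p))"
proof -
  have "orth_pairs A P = Sigma A (nb P)" by (auto simp: orth_pairs_def nb_def)
  then show ?thesis using assms by (simp add: card_SigmaI finite_nb)
qed

text \<open>Walks \<open>q, p, t\<close> are counted by their end \<open>t\<close>: there are at
  most two \<open>p\<close> unless \<open>t\<close> is \<open>q\<close> or \<open>- q\<close>, and
  each of these two exceptions contributes at most \<open>n\<close>.\<close>

lemma sum_card_nb_nb_le:
  assumes P: "finite P" "P \<subseteq> S2" "card P = n" and q: "q \<in> P"
  shows "(\<Sum>p\<in>nb P q. card (nb P p)) \<le> 4 * n"
proof -
  have "(\<Sum>p\<in>nb P q. card (nb P p)) = (\<Sum>p\<in>nb P q. card {t \<in> P. p \<bullet> t = 0})"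
    by (simp add: nb_def)
  also have "\<dots> = (\<Sum>t\<in>P. card {p \<in> nb P q. p \<bullet> t = 0})"
    by (rule sum_card_swap) (use P finite_nb in auto)
  also have "\<dots> \<le> (\<Sum>t\<in>P. 2 + (if t \<in> {q, - q} then n else 0))"
  proof (rule sum_mono)
    fix t assume t: "t \<in> P"
    show "card {p \<in> nb P q. p \<bullet> t = 0} \<le> 2 + (if t \<in> {q, - q} then n else 0)"
    proof (cases "t \<in> {q, - q}")
      case True
      have "card {p \<in> nb P q. p \<bullet> t = 0} \<le> card P"
        using P by (intro card_mono) (auto simp: nb_def)
      then show ?thesis using True P by simp
    next
      case False
      have "q \<in> S2" "t \<in> S2" using P q t by auto
      then have c: "finite (common q t)" "card (common q t) \<le> 2"
        using common_neighbours[of q t] False by auto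
      have "{p \<in> nb P q. p \<bullet> t = 0} \<subseteq> common q t"
        using P by (auto simp: nb_def common_def inner_commute)
      then have "card {p \<in> nb P q. p \<bullet> t = 0} \<le> 2" using c card_mono le_trans by blast
      then show ?thesis by simp
    qed
  qed
  also have "\<dots> = 2 * n + (\<Sum>t\<in>P. if t \<in> {q, - q} then n else 0)"
    unfolding sum.distrib using P by simp
  also have "(\<Sum>t\<in>P. if t \<in> {q, - q} then n else 0) = (\<Sum>t\<in>P \<inter> {q, - q}. n)"
    by (rule sum.inter_restrict[OF P(1), symmetric])
  also have "\<dots> \<le> 2 * n"
  proof -
    have "card (P \<inter> {q, - q}) \<le> card (set [q, - q])" by (intro card_mono) auto
    also have "\<dots> \<le> 2" by (rule order_trans[OF card_length]) simp
    finally show ?thesis by simp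
  qed
  finally show ?thesis by simp
qed

text \<open>The incidence bound is solved for the number \<open>a\<close> of points of degree at
  least \<open>r\<close>. If the power term dominates, \<open>a * r ^ 3\<close> is at most of order
  \<open>n ^ 2\<close>; otherwise \<open>a * r\<close> is at most of order \<open>n\<close>.\<close>

lemma rich_bound_arith:
  fixes a r n M :: real
  assumes "a \<ge> 0" "r \<ge> 1" "n \<ge> 1" "M \<ge> 1" "a \<le> n" and I: "r * a \<le> M * ((a * n) powr (2 / 3) + a + n)"
  shows "a * r ^ 3 \<le> 27 * M ^ 3 * (n\<^sup>2 + n * r\<^sup>2)"
proof -
  have M3: "3 * M \<le> 27 * M ^ 3"
  proof -
    have "M * 1 \<le> M * (M * M)" using assms mult_mono[of 1 M 1 M] by (intro mult_left_mono) auto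
    then have "M \<le> M ^ 3" by (simp add: power3_eq_cube)
    then show ?thesis using assms by simp
  qed
  have pos: "n\<^sup>2 \<ge> 0" "n * r\<^sup>2 \<ge> 0" "M ^ 3 \<ge> 0" using assms by auto
  consider (1) "a \<le> (a * n) powr (2 / 3)" "n \<le> (a * n) powr (2 / 3)"
    | (2) "(a * n) powr (2 / 3) \<le> a" "n \<le> a" | (3) "(a * n) powr (2 / 3) \<le> n" "a \<le> n"
    by linarith
  then show ?thesis
  proof cases
    case 1
    then have "M * ((a * n) powr (2 / 3) + a + n) \<le> M * (3 * (a * n) powr (2 / 3))"
      using assms by (intro mult_left_mono) auto
    then have "r * a \<le> 3 * M * (a * n) powr (2 / 3)" using I by simp
    then have "(r * a) ^ 3 \<le> (3 * M * (a * n) powr (2 / 3)) ^ 3"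
      using assms by (intro power_mono) auto
    also have "\<dots> = 27 * M ^ 3 * (a * n)\<^sup>2"
      using assms by (simp add: power_mult_distrib powr_two_thirds_cube)
    finally have *: "a\<^sup>2 * (a * r ^ 3) \<le> a\<^sup>2 * (27 * M ^ 3 * n\<^sup>2)"
      by (simp add: power2_eq_square power3_eq_cube algebra_simps)
    have "a * r ^ 3 \<le> 27 * M ^ 3 * n\<^sup>2"
    proof (cases "a = 0")
      case False
      then have "a\<^sup>2 > 0" by simp
      then show ?thesis using * by (rule mult_left_le_imp_le[rotated])
    qed (use pos in auto)
    also have "\<dots> \<le> 27 * M ^ 3 * (n\<^sup>2 + n * r\<^sup>2)" using pos by (intro mult_left_mono) auto
    finally show ?thesis .
  next
    case 2
    then have "M * ((a * n) powr (2 / 3) + a + n) \<le> M * (3 * n)"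
      using assms by (intro mult_left_mono) auto
    then have "r * a \<le> 3 * M * n" using I by simp
    then have "r * a * r\<^sup>2 \<le> 3 * M * n * r\<^sup>2" by (intro mult_right_mono) auto
    then have "a * r ^ 3 \<le> 3 * M * (n * r\<^sup>2)" by (simp add: power2_eq_square power3_eq_cube algebra_simps)
    also have "\<dots> \<le> 27 * M ^ 3 * (n * r\<^sup>2)" by (rule mult_right_mono[OF M3 pos(2)])
    also have "\<dots> \<le> 27 * M ^ 3 * (n\<^sup>2 + n * r\<^sup>2)" using pos by (intro mult_left_mono) auto
    finally show ?thesis .
  next
    case 3
    then have "M * ((a * n) powr (2 / 3) + a + n) \<le> M * (3 * n)"
      using assms by (intro mult_left_mono) auto
    then have "r * a \<le> 3 * M * n" using I by simp
    then have "r * a * r\<^sup>2 \<le> 3 * M * n * r\<^sup>2" by (intro mult_right_mono) auto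
    then have "a * r ^ 3 \<le> 3 * M * (n * r\<^sup>2)" by (simp add: power2_eq_square power3_eq_cube algebra_simps)
    also have "\<dots> \<le> 27 * M ^ 3 * (n * r\<^sup>2)" by (rule mult_right_mono[OF M3 pos(2)])
    also have "\<dots> \<le> 27 * M ^ 3 * (n\<^sup>2 + n * r\<^sup>2)" using pos by (intro mult_left_mono) auto
    finally show ?thesis .
  qed
qed

lemma cube_le_cubeD: "(x::real) ^ 3 \<le> y ^ 3 \<Longrightarrow> y \<ge> 0 \<Longrightarrow> x \<le> y"
  using power_le_imp_le_base[of x 2 y] by (simp add: eval_nat_numeral)

text \<open>Each of the three terms is at most \<open>K * n ^ 2\<close>, shown by comparing cubes to
  get rid of the power \<open>2 / 3\<close>. The power term needs only
  \<open>a ^ 2 * r ^ 3 \<le> K * n ^ 3\<close> and its analogue; in the linear terms the other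
  degree enters through \<open>s ^ 3 \<le> s ^ 4 \<le> n ^ 2\<close>.\<close>

lemma poor_pair_arith:
  fixes a b r s n K :: real
  assumes nn: "a \<ge> 0" "b \<ge> 0" "r \<ge> 1" "s \<ge> 1" "n \<ge> 1" "K \<ge> 1" "a \<le> n" "b \<le> n"
    and a: "a * r ^ 3 \<le> K * n\<^sup>2" and b: "b * s ^ 3 \<le> K * n\<^sup>2" and rs: "r\<^sup>2 \<le> n" "s\<^sup>2 \<le> n"
  shows "r * s * ((a * b) powr (2 / 3) + a + b) \<le> 3 * K * n\<^sup>2"
proof -
  have aa: "a\<^sup>2 * r ^ 3 \<le> K * n ^ 3" if "a \<ge> 0" "a \<le> n" "a * r ^ 3 \<le> K * n\<^sup>2" for a r
  proof -
    have "a * (a * r ^ 3) \<le> a * (K * n\<^sup>2)" by (rule mult_left_mono[OF that(3,1)])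
    also have "\<dots> \<le> n * (K * n\<^sup>2)" using nn by (intro mult_right_mono that) auto
    finally have "a * (a * r ^ 3) \<le> n * (K * n\<^sup>2)" .
    then show ?thesis by (simp add: power2_eq_square power3_eq_cube algebra_simps)
  qed
  have K3: "K \<le> K ^ 3" "K\<^sup>2 \<le> K ^ 3"
    using nn power_increasing[of 1 3 K] power_increasing[of 2 3 K] by auto
  have 1: "r * s * (a * b) powr (2 / 3) \<le> K * n\<^sup>2"
  proof (rule cube_le_cubeD)
    have "(r * s * (a * b) powr (2 / 3)) ^ 3 = (a\<^sup>2 * r ^ 3) * (b\<^sup>2 * s ^ 3)"
      using nn by (simp add: power_mult_distrib powr_two_thirds_cube)
    also have "\<dots> \<le> (K * n ^ 3) * (K * n ^ 3)" 
      by (rule mult_mono[OF aa[OF nn(1,7) a] aa[OF nn(2,8) b]]) (use nn in auto)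
    also have "\<dots> = K\<^sup>2 * n ^ 6" by (simp add: power2_eq_square eval_nat_numeral)
    also have "\<dots> \<le> K ^ 3 * n ^ 6" using K3 nn by (intro mult_right_mono) auto
    also have "\<dots> = (K * n\<^sup>2) ^ 3" by (simp add: power_mult_distrib flip: power_mult)
    finally show "(r * s * (a * b) powr (2 / 3)) ^ 3 \<le> (K * n\<^sup>2) ^ 3" .
  qed (use nn in auto)
  have 2: "r * s * a \<le> K * n\<^sup>2"
    if "a \<ge> 0" "a \<le> n" "a * r ^ 3 \<le> K * n\<^sup>2" "r \<ge> 1" "s \<ge> 1" "s\<^sup>2 \<le> n" for a r s
  proof (rule cube_le_cubeD)
    have "s ^ 3 \<le> s ^ 4" using that by (intro power_increasing) auto
    also have "\<dots> = (s\<^sup>2)\<^sup>2" by (simp flip: power_mult)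
    also have "\<dots> \<le> n\<^sup>2" using that by (intro power_mono) auto
    finally have s3: "s ^ 3 \<le> n\<^sup>2" .
    have "(r * s * a) ^ 3 = (a\<^sup>2 * r ^ 3) * (a * s ^ 3)" by (simp add: power2_eq_square power3_eq_cube)
    also have "\<dots> \<le> (K * n ^ 3) * (n * n\<^sup>2)"
      by (rule mult_mono[OF aa[OF that(1-3)] mult_mono[OF that(2) s3]]) (use nn that in auto)
    also have "\<dots> = K * n ^ 6" by (simp add: eval_nat_numeral)
    also have "\<dots> \<le> K ^ 3 * n ^ 6" using K3 nn by (intro mult_right_mono) auto
    also have "\<dots> = (K * n\<^sup>2) ^ 3" by (simp add: power_mult_distrib flip: power_mult)
    finally show "(r * s * a) ^ 3 \<le> (K * n\<^sup>2) ^ 3" .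
  qed (use nn in auto)
  have "r * s * ((a * b) powr (2 / 3) + a + b) = r * s * (a * b) powr (2 / 3) + r * s * a + s * r * b"
    by (simp add: algebra_simps)
  then show ?thesis using 1 2[OF nn(1,7) a nn(3,4) rs(2)] 2[OF nn(2,8) b nn(4,3) rs(1)] by linarith
qed

section \<open>Dyadic classes of degrees\<close>

text \<open>Points of degree zero lie in no class; they do not occur in
  \<open>orth_pairs P P\<close> either.\<close>

definition dyadic :: "(real ^ 3) set \<Rightarrow> nat \<Rightarrow> (real ^ 3) set" where
  "dyadic P i = {p \<in> P. 2 ^ i \<le> card (nb P p) \<and> card (nb P p) < 2 ^ Suc i}"

lemma card_dyadic_le:
  assumes P: "finite P" "P \<subseteq> S2" "card P = n" "n \<ge> 3"
  shows "real (card (dyadic P i)) * (2 ^ i) ^ 3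
    \<le> 27 * (84 * ln (real n)) ^ 3 * ((real n)\<^sup>2 + real n * (2 ^ i)\<^sup>2)"
proof (rule rich_bound_arith)
  let ?A = "dyadic P i"
  have A: "?A \<subseteq> P" by (auto simp: dyadic_def)
  then have fA: "finite ?A" using P finite_subset by blast
  show "real (card ?A) \<le> real n" using card_mono[OF P(1) A] P(3) by simp
  have "2 ^ i * card ?A = (\<Sum>p\<in>?A. 2 ^ i)" by simp
  also have "\<dots> \<le> (\<Sum>p\<in>?A. card (nb P p))" by (intro sum_mono) (simp add: dyadic_def)
  also have "\<dots> = card (orth_pairs ?A P)" using card_orth_pairs_eq_sum[OF P(1) fA] by simp
  finally have "real (2 ^ i * card ?A) \<le> real (card (orth_pairs ?A P))" by (rule of_nat_mono)
  also have "\<dots> \<le> 84 * ln (real n) * ((real (card ?A) * real n) powr (2 / 3) + real (card ?A) + real n)"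
    using sphere_incidences[OF P A order_refl] P(3) by (simp add: orth_pairs_def)
  finally show "2 ^ i * real (card ?A) \<le> 84 * ln (real n) * ((real (card ?A) * real n) powr (2 / 3) + real (card ?A) + real n)"
    by simp
qed (use P ln_ge_1[of n] in auto)

lemma orth_pairs_commute: "orth_pairs B A = prod.swap ` orth_pairs A B"
  by (force simp: orth_pairs_def inner_commute)

text \<open>The factor \<open>54 = 2 * 27\<close> in \<open>K\<close> replaces the two terms of
  \<open>card_dyadic_le\<close> by twice the larger one. Which one is larger depends on whether
  \<open>2 ^ i\<close> exceeds the square root of \<open>n\<close>.\<close>

lemma dyadic_weight_le:
  assumes P: "finite P" "P \<subseteq> S2" "card P = n" "n \<ge> 3"
    and K: "K = 54 * (84 * ln (real n)) ^ 3"
  shows "real (\<Sum>(p, q)\<in>orth_pairs (dyadic P i) (dyadic P j). card (nb P p) * card (nb P q))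
    \<le> 12 * (84 * ln (real n)) * K * (real n)\<^sup>2"
proof -
  let ?M = "84 * ln (real n)"
  have M: "?M \<ge> 1" using ln_ge_1[OF P(4)] by simp
  then have K1: "K \<ge> 1" using one_le_power[of ?M 3] by (simp add: K)
  have D: "dyadic P i \<subseteq> P" "finite (dyadic P i)" for i using P by (auto simp: dyadic_def)
  \<comment> \<open>Such a class has at most \<open>K * n / 2 ^ j\<close> points. Each has degree
    below \<open>2 * 2 ^ j\<close>, and the degrees of its neighbours sum to at most
    \<open>4 * n\<close>; the product is \<open>8 * K * n ^ 2\<close>.\<close>
  have rich: "real (\<Sum>(p, q)\<in>orth_pairs (dyadic P i) (dyadic P j). card (nb P p) * card (nb P q)) \<le> 8 * K * (real n)\<^sup>2"
    if j: "real n < (2 ^ j)\<^sup>2" for i j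
  proof -
    let ?B = "dyadic P j" and ?s = "2 ^ j :: real"
    have n2: "real n * real n \<le> real n * ?s\<^sup>2" using j by (intro mult_left_mono) auto
    have "real (card ?B) * ?s ^ 3 \<le> 27 * ?M ^ 3 * ((real n)\<^sup>2 + real n * ?s\<^sup>2)"
      by (rule card_dyadic_le[OF P])
    also have "\<dots> \<le> 27 * ?M ^ 3 * (2 * (real n * ?s\<^sup>2))"
      using n2 M unfolding power2_eq_square[of "real n"] by (intro mult_left_mono) auto
    finally have "(real (card ?B) * ?s) * ?s\<^sup>2 \<le> (K * real n) * ?s\<^sup>2"
      by (simp add: K power2_eq_square power3_eq_cube algebra_simps)
    then have B: "real (card ?B) * ?s \<le> K * real n" by (rule mult_right_le_imp_le) simp
    have "(\<Sum>(p, q)\<in>orth_pairs (dyadic P i) ?B. card (nb P p) * card (nb P q))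
        = (\<Sum>(q, p)\<in>orth_pairs ?B (dyadic P i). card (nb P p) * card (nb P q))"
      unfolding orth_pairs_commute[of "dyadic P i" ?B]
      by (subst sum.reindex) (auto simp: case_prod_beta inj_on_def)
    also have "\<dots> = (\<Sum>q\<in>?B. \<Sum>p\<in>nb P q \<inter> dyadic P i. card (nb P p) * card (nb P q))"
      unfolding orth_pairs_Sigma[OF D(1)] by (subst sum.Sigma) (use D P finite_nb in auto)
    also have "\<dots> = (\<Sum>q\<in>?B. card (nb P q) * (\<Sum>p\<in>nb P q \<inter> dyadic P i. card (nb P p)))"
      by (simp add: sum_distrib_left mult.commute)
    also have "\<dots> \<le> (\<Sum>q\<in>?B. (2 * 2 ^ j) * (4 * n))"
    proof (intro sum_mono mult_mono)
      fix q assume q: "q \<in> ?B"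
      then show "card (nb P q) \<le> 2 * 2 ^ j" by (simp add: dyadic_def)
      have "(\<Sum>p\<in>nb P q \<inter> dyadic P i. card (nb P p)) \<le> (\<Sum>p\<in>nb P q. card (nb P p))"
        using P finite_nb by (intro sum_mono2) auto
      also have "\<dots> \<le> 4 * n" using q D by (intro sum_card_nb_nb_le[OF P(1-3)]) auto
      finally show "(\<Sum>p\<in>nb P q \<inter> dyadic P i. card (nb P p)) \<le> 4 * n" .
    qed auto
    also have "\<dots> = 8 * (card ?B * 2 ^ j) * n" by simp
    finally have "real (\<Sum>(p, q)\<in>orth_pairs (dyadic P i) ?B. card (nb P p) * card (nb P q))
        \<le> real (8 * (card ?B * 2 ^ j) * n)" by (rule of_nat_mono)
    also have "\<dots> = 8 * (real (card ?B) * ?s) * real n" by simp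
    also have "\<dots> \<le> 8 * (K * real n) * real n" using B by (intro mult_right_mono mult_left_mono) auto
    finally show ?thesis by (simp add: power2_eq_square)
  qed
  have fin: "8 * K * (real n)\<^sup>2 \<le> 12 * ?M * K * (real n)\<^sup>2"
    using M K1 by (intro mult_right_mono) auto
  consider "real n < (2 ^ j)\<^sup>2" | "real n < (2 ^ i)\<^sup>2" | "((2::real) ^ i)\<^sup>2 \<le> real n" "((2::real) ^ j)\<^sup>2 \<le> real n"
    by linarith
  then show ?thesis
  proof cases
    case 1
    then show ?thesis by (rule order_trans[OF rich fin])
  next
    case 2
    have swap: "(\<Sum>(p, q)\<in>orth_pairs (dyadic P i) (dyadic P j). card (nb P p) * card (nb P q))
        = (\<Sum>(p, q)\<in>orth_pairs (dyadic P j) (dyadic P i). card (nb P p) * card (nb P q))"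
      unfolding orth_pairs_commute[of "dyadic P i" "dyadic P j"]
      by (subst sum.reindex) (auto simp: case_prod_beta inj_on_def mult.commute)
    show ?thesis unfolding swap by (rule order_trans[OF rich[OF 2] fin])
  next
    case 3
    let ?a = "real (card (dyadic P i))" and ?b = "real (card (dyadic P j))"
    have ab: "?a \<le> real n" "?b \<le> real n" using card_mono[OF P(1) D(1)] P(3) by simp_all
    have poor: "real (card (dyadic P i)) * (2 ^ i) ^ 3 \<le> K * (real n)\<^sup>2"
      if "((2::real) ^ i)\<^sup>2 \<le> real n" for i
    proof -
      have "real (card (dyadic P i)) * (2 ^ i) ^ 3 \<le> 27 * ?M ^ 3 * ((real n)\<^sup>2 + real n * (2 ^ i)\<^sup>2)"
        by (rule card_dyadic_le[OF P])
      also have "\<dots> \<le> 27 * ?M ^ 3 * ((real n)\<^sup>2 + real n * real n)"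
        using that M by (intro mult_left_mono add_left_mono) auto
      also have "\<dots> = K * (real n)\<^sup>2" by (simp add: K power2_eq_square)
      finally show ?thesis .
    qed
    have "(\<Sum>(p, q)\<in>orth_pairs (dyadic P i) (dyadic P j). card (nb P p) * card (nb P q))
        \<le> (\<Sum>e\<in>orth_pairs (dyadic P i) (dyadic P j). (2 * 2 ^ i) * (2 * 2 ^ j))"
    proof (rule sum_mono)
      fix e assume "e \<in> orth_pairs (dyadic P i) (dyadic P j)"
      then obtain p q where e: "e = (p, q)" "p \<in> dyadic P i" "q \<in> dyadic P j" by (auto simp: orth_pairs_def)
      have "card (nb P p) * card (nb P q) \<le> (2 * 2 ^ i) * (2 * 2 ^ j)"
        by (rule mult_le_mono) (use e in \<open>auto simp: dyadic_def\<close>)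
      then show "(case e of (p, q) \<Rightarrow> card (nb P p) * card (nb P q)) \<le> (2 * 2 ^ i) * (2 * 2 ^ j)"
        by (simp only: e(1) prod.case)
    qed
    also have "\<dots> = 4 * (2 ^ i * 2 ^ j) * card (orth_pairs (dyadic P i) (dyadic P j))" by simp
    finally have "real (\<Sum>(p, q)\<in>orth_pairs (dyadic P i) (dyadic P j). card (nb P p) * card (nb P q))
        \<le> real (4 * (2 ^ i * 2 ^ j) * card (orth_pairs (dyadic P i) (dyadic P j)))" by (rule of_nat_mono)
    also have "\<dots> = 4 * (2 ^ i * 2 ^ j) * real (card (orth_pairs (dyadic P i) (dyadic P j)))" by simp
    also have "\<dots> \<le> 4 * (2 ^ i * 2 ^ j) * (?M * ((?a * ?b) powr (2 / 3) + ?a + ?b))"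
      using sphere_incidences[OF P D(1) D(1), of i j] by (intro mult_left_mono) (auto simp: orth_pairs_def)
    also have "\<dots> = 4 * ?M * (2 ^ i * 2 ^ j * ((?a * ?b) powr (2 / 3) + ?a + ?b))" by simp
    also have "\<dots> \<le> 4 * ?M * (3 * K * (real n)\<^sup>2)"
      using M K1 ab poor[OF 3(1)] poor[OF 3(2)] 3 P(4)
      by (intro mult_left_mono poor_pair_arith) auto
    finally show ?thesis by simp
  qed
qed

lemma ex_dyadic:
  assumes "finite P" "card P \<le> 2 ^ k" "p \<in> P" "nb P p \<noteq> {}"
  shows "\<exists>i\<le>k. p \<in> dyadic P i"
proof -
  have "card (nb P p) \<ge> 1" using assms finite_nb[OF assms(1), of p] by (simp add: Suc_le_eq card_gt_0_iff)
  then obtain i where i: "2 ^ i \<le> card (nb P p)" "card (nb P p) < 2 ^ (i + 1)"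
    using ex_power_ivl1[of 2 "card (nb P p)"] by auto
  have "card (nb P p) \<le> card P" using assms by (intro card_mono) (auto simp: nb_def)
  then have "(2::nat) ^ i \<le> 2 ^ k" using i assms(2) by linarith
  then have "i \<le> k" by simp
  then show ?thesis using i assms(3) by (auto simp: dyadic_def)
qed

text \<open>There are at most \<open>(4 * ln n) ^ 2\<close> pairs of classes, and
  \<open>16 * 12 = 192\<close>. Of the six logarithms two come from the classes, three from
  \<open>K\<close> and one from the incidence bound for a pair of classes.\<close>

lemma sum_degree_products_le:
  assumes P: "finite P" "P \<subseteq> S2" "card P = n" "n \<ge> 3"
  shows "real (\<Sum>(p, q)\<in>orth_pairs P P. card (nb P p) * card (nb P q))
    \<le> 192 * 54 * 84 ^ 4 * (real n)\<^sup>2 * ln (real n) ^ 6"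
proof -
  let ?L = "ln (real n)"
  let ?w = "\<lambda>(p, q). card (nb P p) * card (nb P q)"
  define K where "K = 54 * (84 * ?L) ^ 3"
  obtain k where k: "n \<le> 2 ^ k" "real k \<le> 3 * ?L" using ex_log_bound[OF P(4)] by blast
  define g where "g p = (SOME i. i \<le> k \<and> p \<in> dyadic P i)" for p
  have g: "g p \<le> k \<and> p \<in> dyadic P (g p)" if "p \<in> P" "q \<in> P" "p \<bullet> q = 0" for p q
  proof -
    have "nb P p \<noteq> {}" using that by (auto simp: nb_def)
    then have "\<exists>i. i \<le> k \<and> p \<in> dyadic P i" using ex_dyadic[of P k p] P k that by auto
    then show ?thesis unfolding g_def by (rule someI_ex)
  qed
  define T where "T = Sigma {..k} (\<lambda>_. {..k})"
  have fin: "finite (orth_pairs P P)" "finite T" using P by (simp_all add: finite_orth_pairs T_def)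
  have "(\<lambda>(p, q). (g p, g q)) ` orth_pairs P P \<subseteq> T"
  proof
    fix x assume "x \<in> (\<lambda>(p, q). (g p, g q)) ` orth_pairs P P"
    then obtain p q where pq: "p \<in> P" "q \<in> P" "p \<bullet> q = 0" "x = (g p, g q)" by (auto simp: orth_pairs_def)
    then have "q \<bullet> p = 0" by (simp add: inner_commute)
    then show "x \<in> T" using g[OF pq(1-3)] g[OF pq(2,1)] pq(4) by (simp add: T_def)
  qed
  then have "(\<Sum>e\<in>orth_pairs P P. ?w e)
      = (\<Sum>t\<in>T. \<Sum>e\<in>{e \<in> orth_pairs P P. (case e of (p, q) \<Rightarrow> (g p, g q)) = t}. ?w e)"
    by (rule sum.group[OF fin, symmetric])
  also have "real \<dots> \<le> (\<Sum>t\<in>T. 12 * (84 * ?L) * K * (real n)\<^sup>2)"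
    unfolding of_nat_sum
  proof (rule sum_mono)
    fix t assume "t \<in> T"
    obtain i j where t: "t = (i, j)" by (cases t)
    have D: "finite (dyadic P i)" for i using P by (simp add: dyadic_def)
    have "{e \<in> orth_pairs P P. (case e of (p, q) \<Rightarrow> (g p, g q)) = t} \<subseteq> orth_pairs (dyadic P i) (dyadic P j)"
    proof
      fix e assume e: "e \<in> {e \<in> orth_pairs P P. (case e of (p, q) \<Rightarrow> (g p, g q)) = t}"
      obtain p q where pq: "e = (p, q)" by (cases e)
      then have "p \<in> P" "q \<in> P" "p \<bullet> q = 0" "q \<bullet> p = 0" "g p = i" "g q = j"
        using e t by (auto simp: orth_pairs_def inner_commute)
      then show "e \<in> orth_pairs (dyadic P i) (dyadic P j)"
        using g[of p q] g[of q p] by (auto simp: pq orth_pairs_def)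
    qed
    then have "(\<Sum>e\<in>{e \<in> orth_pairs P P. (case e of (p, q) \<Rightarrow> (g p, g q)) = t}. ?w e)
        \<le> (\<Sum>e\<in>orth_pairs (dyadic P i) (dyadic P j). ?w e)"
      using D by (intro sum_mono2 finite_orth_pairs) auto
    then have "real (\<Sum>e\<in>{e \<in> orth_pairs P P. (case e of (p, q) \<Rightarrow> (g p, g q)) = t}. ?w e)
        \<le> real (\<Sum>e\<in>orth_pairs (dyadic P i) (dyadic P j). ?w e)"
      by (rule of_nat_mono)
    also have "\<dots> \<le> 12 * (84 * ?L) * K * (real n)\<^sup>2"
      by (rule dyadic_weight_le[OF P K_def])
    finally show "(\<Sum>e\<in>{e \<in> orth_pairs P P. (case e of (p, q) \<Rightarrow> (g p, g q)) = t}. real (?w e))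
        \<le> 12 * (84 * ?L) * K * (real n)\<^sup>2" by (simp only: of_nat_sum)
  qed
  also have "\<dots> = (real k + 1)\<^sup>2 * (12 * (84 * ?L) * K * (real n)\<^sup>2)"
    by (simp add: T_def card_SigmaI power2_eq_square algebra_simps)
  also have "\<dots> \<le> (4 * ?L)\<^sup>2 * (12 * (84 * ?L) * K * (real n)\<^sup>2)"
    using k(2) ln_ge_1[OF P(4)] by (intro mult_right_mono power_mono) (auto simp: K_def)
  also have "\<dots> = 192 * 54 * 84 ^ 4 * (real n)\<^sup>2 * ?L ^ 6"
    by (simp add: K_def power_mult_distrib power2_eq_square eval_nat_numeral)
  finally show ?thesis .
qed

section \<open>Upper bounds for longer paths\<close>

lemma unit_paths_iff:
  assumes "P \<subseteq> S2"
  shows "p \<in> unit_paths k P \<longleftrightarrow> length p = k \<and> set p \<subseteq> P \<and> distinct p \<and>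
    (\<forall>i. Suc i < k \<longrightarrow> p ! i \<bullet> p ! Suc i = 0)"
proof -
  have "dist (p ! i) (p ! Suc i) = 1 \<longleftrightarrow> p ! i \<bullet> p ! Suc i = 0"
    if "length p = k" "set p \<subseteq> P" "Suc i < k" for i
  proof -
    have "p ! i \<in> set p" "p ! Suc i \<in> set p" using that by auto
    then have "p ! i \<in> S2" "p ! Suc i \<in> S2" using that assms by blast+
    then show ?thesis by (rule dist_eq_1_iff)
  qed
  then show ?thesis unfolding unit_paths_def by blast
qed

lemma unit_paths_drop_take:
  assumes "p \<in> unit_paths k P" "l + m \<le> k"
  shows "take m (drop l p) \<in> unit_paths m P"
proof -
  have len: "length p = k" "set p \<subseteq> P" "distinct p" using assms by (auto simp: unit_paths_def)
  have "dist (p ! (l + i)) (p ! (l + Suc i)) = 1" if "Suc i < m" for i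
    using assms that unfolding unit_paths_def by auto
  then show ?thesis
    using len assms(2) set_take_subset[of m "drop l p"] set_drop_subset[of l p]
    unfolding unit_paths_def by (auto simp: distinct_take distinct_drop)
qed

lemma unit_paths_take: "p \<in> unit_paths k P \<Longrightarrow> m \<le> k \<Longrightarrow> take m p \<in> unit_paths m P"
  using unit_paths_drop_take[of p k P 0 m] by simp

lemma unit_paths_drop:
  assumes "p \<in> unit_paths (l + m) P"
  shows "drop l p \<in> unit_paths m P"
proof -
  have "take m (drop l p) = drop l p" using assms by (simp add: unit_paths_def)
  then show ?thesis using unit_paths_drop_take[OF assms, of l m] by simp
qed

lemma unit_paths_nth:
  assumes "p \<in> unit_paths k P" "i < k"
  shows "p ! i \<in> P"
  using assms by (auto simp: unit_paths_def)

lemma unit_paths_nth_neq: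
  assumes "p \<in> unit_paths k P" "i < k" "j < k" "i \<noteq> j"
  shows "p ! i \<noteq> p ! j"
  using assms by (auto simp: unit_paths_def nth_eq_iff_index_eq)

lemma unit_paths_nth_common:
  assumes "P \<subseteq> S2" "p \<in> unit_paths k P" "Suc (Suc i) < k"
  shows "p ! Suc i \<in> common (p ! i) (p ! Suc (Suc i))"
proof -
  have "p ! i \<bullet> p ! Suc i = 0" "p ! Suc i \<bullet> p ! Suc (Suc i) = 0"
    using assms unit_paths_iff[OF assms(1)] by auto
  then show ?thesis using unit_paths_nth[OF assms(2), of "Suc i"] assms by (auto simp: common_def inner_commute)
qed

lemma card_UN_image_le:
  assumes "finite X" "\<And>x. x \<in> X \<Longrightarrow> finite (Y x) \<and> card (Y x) \<le> c"
    and "A \<subseteq> (\<Union>x\<in>X. f x ` Y x)"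
  shows "card A \<le> c * card X"
proof -
  have "card A \<le> card (\<Union>x\<in>X. f x ` Y x)" using assms by (intro card_mono) auto
  also have "\<dots> \<le> (\<Sum>x\<in>X. card (f x ` Y x))" by (rule card_UN_le[OF assms(1)])
  also have "\<dots> \<le> (\<Sum>x\<in>X. c)" using assms(2) by (intro sum_mono) (meson card_image_le le_trans)
  finally show ?thesis by (simp add: mult.commute)
qed

lemma card_unit_paths_split:
  assumes P: "finite P" "P \<subseteq> S2"
  shows "card {p \<in> unit_paths (i + j + 3) P. p ! (i + 2) \<noteq> - (p ! i)}
    \<le> 2 * card (unit_paths (i + 1) P) * card (unit_paths (j + 1) P)"
proof -
  define U where "U = Sigma (unit_paths (i + 1) P) (\<lambda>_. unit_paths (j + 1) P)"
  \<comment> \<open>Restricting to ends that are neither equal nor antipodal leaves at most two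
    choices for the forgotten vertex, which is sought on the whole sphere. Indices start at 0, so
    the remaining parts have \<open>i + 1\<close> and \<open>j + 1\<close> vertices.\<close>
  define X where "X = {(s, t). (s, t) \<in> U \<and> s ! i \<in> S2 \<and> t ! 0 \<in> S2 \<and> t ! 0 \<noteq> s ! i \<and> t ! 0 \<noteq> - (s ! i)}"
  have fU: "finite U" using P by (simp add: U_def finite_unit_paths)
  have X: "finite X" "card X \<le> card U"
    using fU by (auto simp: X_def intro: finite_subset[of _ U] card_mono)
  have "card {p \<in> unit_paths (i + j + 3) P. p ! (i + 2) \<noteq> - (p ! i)} \<le> 2 * card X"
  proof (rule card_UN_image_le[where Y = "\<lambda>(s, t). common (s ! i) (t ! 0)" and f = "\<lambda>(s, t) z. s @ z # t"])
    show "finite (case x of (s, t) \<Rightarrow> common (s ! i) (t ! 0)) \<and> card (case x of (s, t) \<Rightarrow> common (s ! i) (t ! 0)) \<le> 2"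
      if "x \<in> X" for x
      using that common_neighbours by (auto simp: X_def)
    show "{p \<in> unit_paths (i + j + 3) P. p ! (i + 2) \<noteq> - (p ! i)}
        \<subseteq> (\<Union>x\<in>X. (case x of (s, t) \<Rightarrow> \<lambda>z. s @ z # t) ` (case x of (s, t) \<Rightarrow> common (s ! i) (t ! 0)))"
    proof
      fix p assume p: "p \<in> {p \<in> unit_paths (i + j + 3) P. p ! (i + 2) \<noteq> - (p ! i)}"
      then have pU: "p \<in> unit_paths (i + j + 3) P" by simp
      then have len: "length p = i + j + 3" by (simp add: unit_paths_def)
      define s where "s = take (i + 1) p"
      define t where "t = drop (i + 2) p"
      have "s \<in> unit_paths (i + 1) P" unfolding s_def by (rule unit_paths_take[OF pU]) simp
      moreover have "t \<in> unit_paths (j + 1) P"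
      proof -
        have "i + j + 3 = (i + 2) + (j + 1)" by simp
        then show ?thesis using pU unfolding t_def by (metis unit_paths_drop)
      qed
      moreover have nths: "s ! i = p ! i" "t ! 0 = p ! (i + 2)" using len by (simp_all add: s_def t_def)
      moreover have "p ! i \<in> P" "p ! (i + 2) \<in> P" by (rule unit_paths_nth[OF pU]; simp)+
      moreover have "p ! (i + 2) \<noteq> p ! i" by (rule unit_paths_nth_neq[OF pU]) auto
      ultimately have "(s, t) \<in> X" using p P by (auto simp: X_def U_def)
      moreover have "p = s @ p ! (i + 1) # t"
        using len id_take_nth_drop[of "i + 1" p] by (simp add: s_def t_def)
      moreover have "p ! (i + 1) \<in> common (s ! i) (t ! 0)"
        using unit_paths_nth_common[OF P(2) pU, of i] nths by simp
      ultimately show "p \<in> (\<Union>x\<in>X. (case x of (s, t) \<Rightarrow> \<lambda>z. s @ z # t) ` (case x of (s, t) \<Rightarrow> common (s ! i) (t ! 0)))"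
        by (intro UN_I[of "(s, t)"]) auto
    qed
  qed (rule X)
  also have "\<dots> \<le> 2 * card U" using X by simp
  also have "\<dots> = 2 * card (unit_paths (i + 1) P) * card (unit_paths (j + 1) P)"
    using P by (simp add: U_def card_SigmaI finite_unit_paths)
  finally show ?thesis .
qed

lemma list_split_6_7:
  assumes "length p = j + 8"
  shows "p = take 2 p @ p ! 2 # take 2 (drop 3 p) @ p ! 5 # p ! 6 # drop 7 p"
proof -
  have "p = take 2 p @ p ! 2 # drop 3 p" using id_take_nth_drop[of 2 p] assms by simp
  also have "drop 3 p = take 2 (drop 3 p) @ drop 5 p"
    using append_take_drop_id[of 2 "drop 3 p"] by simp
  also have "drop 5 p = p ! 5 # p ! 6 # drop 7 p"
    using Cons_nth_drop_Suc[of 5 p] Cons_nth_drop_Suc[of 6 p] assms by simp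
  finally show ?thesis .
qed

text \<open>Distinctness of the vertices excludes \<open>p ! 3 = - (p ! 1)\<close> and
  \<open>p ! 7 = - (p ! 3)\<close>, as either would repeat \<open>p ! 5\<close>. So
  \<open>p ! 2\<close> and \<open>p ! 6\<close> can both be forgotten, at two choices each, while
  \<open>p ! 5\<close> is determined by \<open>p ! 3\<close>.\<close>

lemma card_unit_paths_antipodal:
  assumes P: "finite P" "P \<subseteq> S2"
  shows "card {p \<in> unit_paths (j + 8) P. p ! 5 = - (p ! 3)}
    \<le> 4 * card (unit_paths 2 P) * card (unit_paths 2 P) * card (unit_paths (j + 1) P)"
proof -
  define U where "U = Sigma (unit_paths 2 P) (\<lambda>_. Sigma (unit_paths 2 P) (\<lambda>_. unit_paths (j + 1) P))"
  define nonpar where "nonpar u v \<longleftrightarrow> u \<in> S2 \<and> v \<in> S2 \<and> v \<noteq> u \<and> v \<noteq> - u" for u v :: "real ^ 3"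
  define X where "X = {(s, t, w). (s, t, w) \<in> U \<and> nonpar (s ! 1) (t ! 0) \<and> nonpar (t ! 0) (w ! 0)}"
  define Y where "Y = (\<lambda>(s, t, w). Sigma (common (s ! 1) (t ! 0)) (\<lambda>_. common (t ! 0) (w ! 0)) :: ((real ^ 3) \<times> (real ^ 3)) set)"
  define f where "f = (\<lambda>(s, t, w) (z, z'). s @ z # t @ - (t ! 0) # z' # (w :: (real ^ 3) list))"
  have fU: "finite U" using P by (simp add: U_def finite_unit_paths)
  have X: "finite X" "card X \<le> card U"
    using fU by (auto simp: X_def intro: finite_subset[of _ U] card_mono)
  have "card {p \<in> unit_paths (j + 8) P. p ! 5 = - (p ! 3)} \<le> 4 * card X"
  proof (rule card_UN_image_le[where Y = Y and f = f])
    fix x assume "x \<in> X"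
    then obtain s t w where x: "x = (s, t, w)" "nonpar (s ! 1) (t ! 0)" "nonpar (t ! 0) (w ! 0)"
      by (auto simp: X_def)
    have c: "finite (common (s ! 1) (t ! 0))" "card (common (s ! 1) (t ! 0)) \<le> 2"
      "finite (common (t ! 0) (w ! 0))" "card (common (t ! 0) (w ! 0)) \<le> 2"
      using x common_neighbours unfolding nonpar_def by blast+
    have "card (common (s ! 1) (t ! 0)) * card (common (t ! 0) (w ! 0)) \<le> 2 * 2"
      using c by (intro mult_le_mono)
    then show "finite (Y x) \<and> card (Y x) \<le> 4"
      using c by (simp add: Y_def x(1) card_SigmaI)
  next
    show "{p \<in> unit_paths (j + 8) P. p ! 5 = - (p ! 3)} \<subseteq> (\<Union>x\<in>X. f x ` Y x)"
    proof
      fix p assume p: "p \<in> {p \<in> unit_paths (j + 8) P. p ! 5 = - (p ! 3)}"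
      then have pU: "p \<in> unit_paths (j + 8) P" by simp
      then have len: "length p = j + 8" by (simp add: unit_paths_def)
      define s where "s = take 2 p"
      define t where "t = take 2 (drop 3 p)"
      define w where "w = drop 7 p"
      have "s \<in> unit_paths 2 P" unfolding s_def by (rule unit_paths_take[OF pU]) simp
      moreover have "t \<in> unit_paths 2 P" unfolding t_def by (rule unit_paths_drop_take[OF pU]) simp
      moreover have "w \<in> unit_paths (j + 1) P"
        unfolding w_def by (rule unit_paths_drop) (use pU in \<open>simp add: add.commute\<close>)
      ultimately have "(s, t, w) \<in> U" by (simp add: U_def)
      have nths: "s ! 1 = p ! 1" "t ! 0 = p ! 3" "w ! 0 = p ! 7" using len by (simp_all add: s_def t_def w_def)
      have "p ! 1 \<in> S2" "p ! 3 \<in> S2" "p ! 7 \<in> S2"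
        using unit_paths_nth[OF pU, of 1] unit_paths_nth[OF pU, of 3] unit_paths_nth[OF pU, of 7] P by auto
      moreover have "p ! 3 \<noteq> p ! 1" "p ! 5 \<noteq> p ! 1" "p ! 7 \<noteq> p ! 3" "p ! 7 \<noteq> p ! 5"
        using unit_paths_nth_neq[OF pU] by auto
      ultimately have np: "nonpar (s ! 1) (t ! 0)" "nonpar (t ! 0) (w ! 0)"
        using p unfolding nonpar_def nths by auto
      then have "(s, t, w) \<in> X" using \<open>(s, t, w) \<in> U\<close> by (simp add: X_def)
      moreover have "p ! 2 \<in> common (s ! 1) (t ! 0)"
        using unit_paths_nth_common[OF P(2) pU, of 1] nths by (simp add: numeral_2_eq_2 numeral_3_eq_3)
      moreover have "p ! 6 \<in> common (t ! 0) (w ! 0)"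
        using unit_paths_nth_common[OF P(2) pU, of 5] nths p by (simp add: common_def)
      ultimately have "f (s, t, w) (p ! 2, p ! 6) \<in> (\<Union>x\<in>X. f x ` Y x)"
        by (intro UN_I[of "(s, t, w)"] imageI) (auto simp: Y_def)
      moreover have "f (s, t, w) (p ! 2, p ! 6) = p"
        using list_split_6_7[OF len] p nths unfolding f_def s_def t_def w_def by simp
      ultimately show "p \<in> (\<Union>x\<in>X. f x ` Y x)" by simp
    qed
  qed (rule X)
  also have "\<dots> \<le> 4 * card U" using X by simp
  also have "\<dots> = 4 * card (unit_paths 2 P) * card (unit_paths 2 P) * card (unit_paths (j + 1) P)"
    using P by (simp add: U_def card_SigmaI finite_unit_paths)
  finally show ?thesis .
qed

text \<open>The last vertex is determined by \<open>p ! 3\<close>. The remaining five can be cut at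
  \<open>p ! 2\<close>, since \<open>p ! 3 = - (p ! 1)\<close> would give
  \<open>p ! 5 = p ! 1\<close>.\<close>

lemma card_unit_paths_6_antipodal:
  assumes P: "finite P" "P \<subseteq> S2"
  shows "card {p \<in> unit_paths 6 P. p ! 5 = - (p ! 3)}
    \<le> 2 * card (unit_paths 2 P) * card (unit_paths 2 P)"
proof -
  have "inj_on (\<lambda>p. take 5 p) {p \<in> unit_paths 6 P. p ! 5 = - (p ! 3)}"
  proof (rule inj_onI)
    fix p q
    assume pq: "p \<in> {p \<in> unit_paths 6 P. p ! 5 = - (p ! 3)}" "q \<in> {p \<in> unit_paths 6 P. p ! 5 = - (p ! 3)}"
      and eq: "take 5 p = take 5 q"
    have len: "length p = 6" "length q = 6" using pq by (auto simp: unit_paths_def)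
    have "take 5 p ! 3 = take 5 q ! 3" by (simp only: eq)
    then have "p ! 3 = q ! 3" by simp
    then have "p ! 5 = q ! 5" using pq by simp
    moreover have "p = take 5 p @ [p ! 5]" "q = take 5 q @ [q ! 5]"
      using id_take_nth_drop[of 5 p] id_take_nth_drop[of 5 q] len by simp_all
    ultimately show "p = q" using eq by metis
  qed
  moreover have "(\<lambda>p. take 5 p) ` {p \<in> unit_paths 6 P. p ! 5 = - (p ! 3)}
      \<subseteq> {p \<in> unit_paths (1 + 1 + 3) P. p ! (1 + 2) \<noteq> - (p ! 1)}"
  proof (rule image_subsetI)
    fix p assume p: "p \<in> {p \<in> unit_paths 6 P. p ! 5 = - (p ! 3)}"
    then have pU: "p \<in> unit_paths 6 P" by simp
    have "p ! 5 \<noteq> p ! 1" by (rule unit_paths_nth_neq[OF pU]) auto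
    then have "p ! 3 \<noteq> - (p ! 1)" using p by auto
    then show "take 5 p \<in> {p \<in> unit_paths (1 + 1 + 3) P. p ! (1 + 2) \<noteq> - (p ! 1)}"
      using unit_paths_take[OF pU, of 5] by (simp add: numeral_eq_Suc)
  qed
  ultimately have "card {p \<in> unit_paths 6 P. p ! 5 = - (p ! 3)}
      \<le> card {p \<in> unit_paths (1 + 1 + 3) P. p ! (1 + 2) \<noteq> - (p ! 1)}"
    using P by (intro card_inj_on_le[of "\<lambda>p. take 5 p"]) (auto simp: finite_unit_paths)
  also have "\<dots> \<le> 2 * card (unit_paths (1 + 1) P) * card (unit_paths (1 + 1) P)"
    by (rule card_unit_paths_split[OF P])
  finally show ?thesis by (simp add: numeral_2_eq_2)
qed

lemma card_le_add:
  assumes "finite A" "finite B" "U \<subseteq> A \<union> B" "card A \<le> a" "card B \<le> b"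
  shows "card U \<le> a + b"
  using card_mono[OF _ assms(3)] card_Un_le[of A B] assms by fastforce

lemma card_unit_paths_1:
  assumes "finite P"
  shows "card (unit_paths 1 P) \<le> card P"
proof -
  have "unit_paths 1 P \<subseteq> (\<lambda>p. [p]) ` P"
  proof
    fix p assume "p \<in> unit_paths 1 P"
    then have "length p = 1" "set p \<subseteq> P" by (auto simp: unit_paths_def)
    then show "p \<in> (\<lambda>p. [p]) ` P" by (cases p) auto
  qed
  then have "card (unit_paths 1 P) \<le> card ((\<lambda>p. [p]) ` P)" using assms by (intro card_mono) auto
  then show ?thesis using card_image_le[OF assms] le_trans by blast
qed

section \<open>Short paths and recursions for the number of paths\<close>

lemma card_unit_paths_2:
  assumes "finite P" "P \<subseteq> S2"
  shows "card (unit_paths 2 P) \<le> card (orth_pairs P P)"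
proof -
  have "unit_paths 2 P \<subseteq> (\<lambda>(p, q). [p, q]) ` orth_pairs P P"
  proof
    fix p assume p: "p \<in> unit_paths 2 P"
    then have "length p = 2" by (simp add: unit_paths_def)
    then obtain a b where ab: "p = [a, b]" by (auto simp: numeral_eq_Suc length_Suc_conv)
    have "(a, b) \<in> orth_pairs P P"
      using p unit_paths_iff[OF assms(2), of p 2] by (auto simp: ab orth_pairs_def)
    then show "p \<in> (\<lambda>(p, q). [p, q]) ` orth_pairs P P" by (force simp: ab)
  qed
  then have "card (unit_paths 2 P) \<le> card ((\<lambda>(p, q). [p, q]) ` orth_pairs P P)"
    using assms by (intro card_mono finite_imageI finite_orth_pairs)
  then show ?thesis using card_image_le finite_orth_pairs[OF assms(1,1)] le_trans by blast
qed

lemma card_unit_paths_4: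
  assumes "finite P" "P \<subseteq> S2"
  shows "card (unit_paths 4 P) \<le> (\<Sum>(p, q)\<in>orth_pairs P P. card (nb P p) * card (nb P q))"
proof -
  let ?A = "\<lambda>e. (\<lambda>(a, b). [a, fst e, snd e, b]) ` Sigma (nb P (fst e)) (\<lambda>_. nb P (snd e))"
  have "unit_paths 4 P \<subseteq> (\<Union>e\<in>orth_pairs P P. ?A e)"
  proof
    fix p assume p: "p \<in> unit_paths 4 P"
    then have "length p = 4" by (simp add: unit_paths_def)
    then obtain a b c d where ab: "p = [a, b, c, d]"
      by (auto simp: numeral_eq_Suc length_Suc_conv)
    have all: "\<forall>i. Suc i < 4 \<longrightarrow> p ! i \<bullet> p ! Suc i = 0" "set p \<subseteq> P"
      using p unit_paths_iff[OF assms(2), of p 4] by auto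
    have "a \<bullet> b = 0" "b \<bullet> c = 0" "c \<bullet> d = 0"
      using all(1)[rule_format, of 0] all(1)[rule_format, of 1] all(1)[rule_format, of 2] by (simp_all add: ab)
    then have "(b, c) \<in> orth_pairs P P" "a \<in> nb P b" "d \<in> nb P c"
      using all(2) by (auto simp: ab orth_pairs_def nb_def inner_commute)
    then show "p \<in> (\<Union>e\<in>orth_pairs P P. ?A e)"
      unfolding ab by (intro UN_I[of "(b, c)"] image_eqI[of _ _ "(a, d)"]) auto
  qed
  then have "card (unit_paths 4 P) \<le> card (\<Union>e\<in>orth_pairs P P. ?A e)"
    using assms by (intro card_mono finite_UN_I finite_orth_pairs finite_imageI finite_SigmaI finite_nb)
  also have "\<dots> \<le> (\<Sum>e\<in>orth_pairs P P. card (?A e))"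
    using assms by (intro card_UN_le finite_orth_pairs)
  also have "\<dots> \<le> (\<Sum>e\<in>orth_pairs P P. card (nb P (fst e)) * card (nb P (snd e)))"
  proof (rule sum_mono)
    fix e
    have "card (?A e) \<le> card (Sigma (nb P (fst e)) (\<lambda>_. nb P (snd e)))"
      using assms by (intro card_image_le finite_SigmaI finite_nb)
    then show "card (?A e) \<le> card (nb P (fst e)) * card (nb P (snd e))"
      using assms by (simp add: card_SigmaI finite_nb)
  qed
  finally show ?thesis by (simp add: case_prod_beta)
qed

text \<open>The paths \<open>a, b, - a\<close> escape the cut, but they are given by two
  points.\<close>

lemma card_unit_paths_3:
  assumes P: "finite P" "P \<subseteq> S2"
  shows "card (unit_paths 3 P) \<le> 2 * card (unit_paths 1 P) * card (unit_paths 1 P) + card P * card P"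
proof (rule card_le_add)
  let ?B = "(\<lambda>(a, b). [a, b, - a]) ` Sigma P (\<lambda>_. P)"
  show "unit_paths 3 P \<subseteq> {p \<in> unit_paths (0 + 0 + 3) P. p ! (0 + 2) \<noteq> - (p ! 0)} \<union> ?B"
  proof
    fix p assume p: "p \<in> unit_paths 3 P"
    then have "length p = 3" by (simp add: unit_paths_def)
    then obtain a b c where ab: "p = [a, b, c]"
      by (auto simp: numeral_eq_Suc length_Suc_conv)
    have "a \<in> P" "b \<in> P" using p by (auto simp: unit_paths_def ab)
    then show "p \<in> {p \<in> unit_paths (0 + 0 + 3) P. p ! (0 + 2) \<noteq> - (p ! 0)} \<union> ?B"
      using p by (cases "c = - a") (auto simp: ab)
  qed
  show "card {p \<in> unit_paths (0 + 0 + 3) P. p ! (0 + 2) \<noteq> - (p ! 0)} \<le> 2 * card (unit_paths 1 P) * card (unit_paths 1 P)"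
    using card_unit_paths_split[OF P, of 0 0] by simp
  have "card ?B \<le> card (Sigma P (\<lambda>_. P))" using P by (intro card_image_le) auto
  then show "card ?B \<le> card P * card P" using P by (simp add: card_SigmaI)
qed (use P in \<open>auto simp: finite_unit_paths\<close>)

text \<open>As \<open>p ! 4 \<noteq> p ! 0\<close>, the pairs at positions 0, 2 and 2, 4 are not
  both antipodal, so \<open>p ! 1\<close> or \<open>p ! 3\<close> can be forgotten.\<close>

lemma card_unit_paths_5:
  assumes P: "finite P" "P \<subseteq> S2"
  shows "card (unit_paths 5 P) \<le> 4 * card (unit_paths 1 P) * card (unit_paths 3 P)"
proof -
  have "card (unit_paths 5 P) \<le> 2 * card (unit_paths (0 + 1) P) * card (unit_paths (2 + 1) P)
      + 2 * card (unit_paths (2 + 1) P) * card (unit_paths (0 + 1) P)"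
  proof (rule card_le_add[OF _ _ _ card_unit_paths_split[OF P] card_unit_paths_split[OF P]])
    show "unit_paths 5 P \<subseteq> {p \<in> unit_paths (0 + 2 + 3) P. p ! (0 + 2) \<noteq> - (p ! 0)} \<union>
        {p \<in> unit_paths (2 + 0 + 3) P. p ! (2 + 2) \<noteq> - (p ! 2)}"
    proof
      fix p assume p: "p \<in> unit_paths 5 P"
      have "p ! 4 \<noteq> p ! 0" by (rule unit_paths_nth_neq[OF p]) auto
      then show "p \<in> {p \<in> unit_paths (0 + 2 + 3) P. p ! (0 + 2) \<noteq> - (p ! 0)} \<union>
        {p \<in> unit_paths (2 + 0 + 3) P. p ! (2 + 2) \<noteq> - (p ! 2)}"
        using p by (auto simp: numeral_eq_Suc)
    qed
  qed (use P in \<open>auto simp: finite_unit_paths\<close>)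
  then show ?thesis by (simp add: numeral_3_eq_3)
qed

lemma card_unit_paths_6:
  assumes P: "finite P" "P \<subseteq> S2"
  shows "card (unit_paths 6 P) \<le> 2 * card (unit_paths 4 P) * card (unit_paths 1 P)
    + 2 * card (unit_paths 2 P) * card (unit_paths 2 P)"
proof -
  have "card (unit_paths 6 P) \<le> 2 * card (unit_paths (3 + 1) P) * card (unit_paths (0 + 1) P)
      + 2 * card (unit_paths 2 P) * card (unit_paths 2 P)"
    by (rule card_le_add[OF _ _ _ card_unit_paths_split[OF P] card_unit_paths_6_antipodal[OF P]])
      (use P in \<open>auto simp: finite_unit_paths\<close>)
  then show ?thesis by simp
qed

text \<open>The preferred cut forgets \<open>p ! 4\<close>; it is blocked only if
  \<open>p ! 5 = - (p ! 3)\<close>, and then both neighbouring cuts are open.\<close>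

lemma card_unit_paths_rec:
  assumes P: "finite P" "P \<subseteq> S2"
  shows "card (unit_paths (j + 8) P) \<le> 2 * card (unit_paths 4 P) * card (unit_paths (j + 3) P)
    + 4 * card (unit_paths 2 P) * card (unit_paths 2 P) * card (unit_paths (j + 1) P)"
proof -
  have "card (unit_paths (j + 8) P) \<le> 2 * card (unit_paths (3 + 1) P) * card (unit_paths (j + 2 + 1) P)
    + 4 * card (unit_paths 2 P) * card (unit_paths 2 P) * card (unit_paths (j + 1) P)"
    by (rule card_le_add[OF _ _ _ card_unit_paths_split[OF P] card_unit_paths_antipodal[OF P]])
      (use P in \<open>auto simp: finite_unit_paths ac_simps\<close>)
  moreover have "j + 2 + 1 = j + 3" "3 + 1 = (4::nat)" by simp_all
  ultimately show ?thesis by metis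
qed

text \<open>This variant serves \<open>k\<close> equal to 2 mod 5. When the cut at
  \<open>p ! 4\<close> is blocked, only the one at \<open>p ! 2\<close> is made, and the long rest
  stays intact.\<close>

lemma card_unit_paths_rec':
  assumes P: "finite P" "P \<subseteq> S2"
  shows "card (unit_paths (j + 7) P) \<le> 2 * card (unit_paths 4 P) * card (unit_paths (j + 2) P)
    + 2 * card (unit_paths 2 P) * card (unit_paths (j + 4) P)"
proof -
  have "card (unit_paths (j + 7) P) \<le> 2 * card (unit_paths (3 + 1) P) * card (unit_paths (j + 1 + 1) P)
    + 2 * card (unit_paths (1 + 1) P) * card (unit_paths (j + 3 + 1) P)"
  proof (rule card_le_add[OF _ _ _ card_unit_paths_split[OF P] card_unit_paths_split[OF P]])
    show "unit_paths (j + 7) P \<subseteq> {p \<in> unit_paths (3 + (j + 1) + 3) P. p ! (3 + 2) \<noteq> - (p ! 3)} \<union>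
        {p \<in> unit_paths (1 + (j + 3) + 3) P. p ! (1 + 2) \<noteq> - (p ! 1)}"
    proof
      fix p assume p: "p \<in> unit_paths (j + 7) P"
      have "p ! 5 \<noteq> p ! 1" by (rule unit_paths_nth_neq[OF p]) auto
      then have "p ! (3 + 2) \<noteq> - (p ! 3) \<or> p ! (1 + 2) \<noteq> - (p ! 1)"
        by (auto simp: numeral_eq_Suc)
      moreover have eqs: "3 + (j + 1) + 3 = j + 7" "1 + (j + 3) + 3 = j + 7" by simp_all
      ultimately show "p \<in> {p \<in> unit_paths (3 + (j + 1) + 3) P. p ! (3 + 2) \<noteq> - (p ! 3)} \<union>
        {p \<in> unit_paths (1 + (j + 3) + 3) P. p ! (1 + 2) \<noteq> - (p ! 1)}"
        unfolding eqs using p by blast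
    qed
  qed (use P in \<open>auto simp: finite_unit_paths\<close>)
  moreover have "j + 1 + 1 = j + 2" "3 + 1 = (4::nat)" "1 + 1 = (2::nat)" "j + 3 + 1 = j + 4" by simp_all
  ultimately show ?thesis by metis
qed

section \<open>Calculus of upper bounds up to logarithms\<close>

text \<open>Stated for functions of the point set, so that bounds for the same \<open>P\<close> can
  be multiplied. With at least three points the logarithm is at least \<open>1\<close>, and its
  power may be enlarged freely.\<close>

definition soft_upper :: "((real ^ 3) set \<Rightarrow> real) \<Rightarrow> real \<Rightarrow> bool" where
  "soft_upper F e \<longleftrightarrow> (\<exists>C\<ge>0. \<exists>c\<ge>0. \<forall>P. finite P \<and> P \<subseteq> S2 \<and> 3 \<le> card P \<longrightarrow>
     F P \<le> C * real (card P) powr e * ln (real (card P)) powr c)"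

lemma soft_upperI:
  assumes "C \<ge> 0" "c \<ge> 0" "\<And>P. finite P \<Longrightarrow> P \<subseteq> S2 \<Longrightarrow> 3 \<le> card P \<Longrightarrow>
     F P \<le> C * real (card P) powr e * ln (real (card P)) powr c"
  shows "soft_upper F e"
  using assms unfolding soft_upper_def by blast

lemma soft_upper_le:
  assumes "soft_upper G e" "\<And>P. finite P \<Longrightarrow> P \<subseteq> S2 \<Longrightarrow> F P \<le> G P"
  shows "soft_upper F e"
  using assms unfolding soft_upper_def by (meson order_trans)

lemma soft_upper_mono:
  assumes "soft_upper F e" "e \<le> e'"
  shows "soft_upper F e'"
proof -
  obtain C c where C: "C \<ge> 0" "c \<ge> 0" and F: "\<And>P. finite P \<Longrightarrow> P \<subseteq> S2 \<Longrightarrow> 3 \<le> card P \<Longrightarrow>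
      F P \<le> C * real (card P) powr e * ln (real (card P)) powr c"
    using assms(1) unfolding soft_upper_def by blast
  show ?thesis
  proof (rule soft_upperI[OF C])
    fix P :: "(real ^ 3) set" assume P: "finite P" "P \<subseteq> S2" "3 \<le> card P"
    have "F P \<le> C * real (card P) powr e * ln (real (card P)) powr c" by (rule F[OF P])
    also have "\<dots> \<le> C * real (card P) powr e' * ln (real (card P)) powr c"
      using P C assms(2) by (intro mult_right_mono mult_left_mono powr_mono) auto
    finally show "F P \<le> C * real (card P) powr e' * ln (real (card P)) powr c" .
  qed
qed

lemma soft_upper_add:
  assumes "soft_upper F e" "soft_upper G e"
  shows "soft_upper (\<lambda>P. F P + G P) e"
proof -
  obtain C c where C: "C \<ge> 0" "c \<ge> 0" and F: "\<And>P. finite P \<Longrightarrow> P \<subseteq> S2 \<Longrightarrow> 3 \<le> card P \<Longrightarrow>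
      F P \<le> C * real (card P) powr e * ln (real (card P)) powr c"
    using assms(1) unfolding soft_upper_def by blast
  obtain D d where D: "D \<ge> 0" "d \<ge> 0" and G: "\<And>P. finite P \<Longrightarrow> P \<subseteq> S2 \<Longrightarrow> 3 \<le> card P \<Longrightarrow>
      G P \<le> D * real (card P) powr e * ln (real (card P)) powr d"
    using assms(2) unfolding soft_upper_def by blast
  show ?thesis
  proof (rule soft_upperI[of "C + D" "c + d"])
    fix P :: "(real ^ 3) set" assume P: "finite P" "P \<subseteq> S2" "3 \<le> card P"
    let ?n = "real (card P)"
    have L: "ln ?n \<ge> 1" using ln_ge_1[OF P(3)] .
    have "F P + G P \<le> C * ?n powr e * ln ?n powr c + D * ?n powr e * ln ?n powr d"
      using F[OF P] G[OF P] by linarith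
    also have "\<dots> \<le> C * ?n powr e * ln ?n powr (c + d) + D * ?n powr e * ln ?n powr (c + d)"
      using C D L by (intro add_mono mult_left_mono powr_mono) auto
    finally show "F P + G P \<le> (C + D) * ?n powr e * ln ?n powr (c + d)" by (simp add: algebra_simps)
  qed (use C D in auto)
qed

lemma soft_upper_mult:
  assumes "soft_upper F e" "soft_upper G e'" "\<And>P. F P \<ge> 0" "\<And>P. G P \<ge> 0"
  shows "soft_upper (\<lambda>P. F P * G P) (e + e')"
proof -
  obtain C c where C: "C \<ge> 0" "c \<ge> 0" and F: "\<And>P. finite P \<Longrightarrow> P \<subseteq> S2 \<Longrightarrow> 3 \<le> card P \<Longrightarrow>
      F P \<le> C * real (card P) powr e * ln (real (card P)) powr c"
    using assms(1) unfolding soft_upper_def by blast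
  obtain D d where D: "D \<ge> 0" "d \<ge> 0" and G: "\<And>P. finite P \<Longrightarrow> P \<subseteq> S2 \<Longrightarrow> 3 \<le> card P \<Longrightarrow>
      G P \<le> D * real (card P) powr e' * ln (real (card P)) powr d"
    using assms(2) unfolding soft_upper_def by blast
  show ?thesis
  proof (rule soft_upperI[of "C * D" "c + d"])
    fix P :: "(real ^ 3) set" assume P: "finite P" "P \<subseteq> S2" "3 \<le> card P"
    let ?n = "real (card P)"
    have "F P * G P \<le> (C * ?n powr e * ln ?n powr c) * (D * ?n powr e' * ln ?n powr d)"
      by (rule mult_mono[OF F[OF P] G[OF P]]) (use assms(3,4) C in auto)
    also have "\<dots> = C * D * ?n powr (e + e') * ln ?n powr (c + d)"
      by (simp add: powr_add)
    finally show "F P * G P \<le> C * D * ?n powr (e + e') * ln ?n powr (c + d)" .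
  qed (use C D in auto)
qed

lemma soft_upper_cmult:
  assumes "soft_upper F e" "a \<ge> 0"
  shows "soft_upper (\<lambda>P. a * F P) e"
proof -
  obtain C c where C: "C \<ge> 0" "c \<ge> 0" and F: "\<And>P. finite P \<Longrightarrow> P \<subseteq> S2 \<Longrightarrow> 3 \<le> card P \<Longrightarrow>
      F P \<le> C * real (card P) powr e * ln (real (card P)) powr c"
    using assms(1) unfolding soft_upper_def by blast
  show ?thesis
  proof (rule soft_upperI[of "a * C" c])
    fix P :: "(real ^ 3) set" assume P: "finite P" "P \<subseteq> S2" "3 \<le> card P"
    show "a * F P \<le> a * C * real (card P) powr e * ln (real (card P)) powr c"
      using mult_left_mono[OF F[OF P] assms(2)] by (simp add: mult.assoc)
  qed (use C assms in auto)
qed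

definition paths :: "nat \<Rightarrow> (real ^ 3) set \<Rightarrow> real" where
  "paths k P = real (card (unit_paths k P))"

lemma paths_nonneg: "paths k P \<ge> 0"
  by (simp add: paths_def)

section \<open>The exponent and its growth\<close>

definition path_exponent :: "nat \<Rightarrow> real" where
  "path_exponent k = real_of_int \<lfloor>2 * (real k + 3) / 5\<rfloor> - (if k mod 5 = 2 then 2 / 3 else 0)"

lemma path_exponent_add_5: "path_exponent (k + 5) = path_exponent k + 2"
proof -
  have "2 * (real (k + 5) + 3) / 5 = 2 * (real k + 3) / 5 + of_int 2" by (simp add: field_simps)
  then have "\<lfloor>2 * (real (k + 5) + 3) / 5\<rfloor> = \<lfloor>2 * (real k + 3) / 5\<rfloor> + 2" by (metis floor_add_int)
  then show ?thesis by (simp add: path_exponent_def)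
qed

lemma path_exponent_small:
  "path_exponent 0 = 1" "path_exponent 1 = 1" "path_exponent 2 = 4 / 3" "path_exponent 3 = 2"
  "path_exponent 4 = 2" "path_exponent 5 = 3" "path_exponent 6 = 3"
proof -
  have "\<lfloor>(6 :: real) / 5\<rfloor> = 1" "\<lfloor>(8 :: real) / 5\<rfloor> = 1" "\<lfloor>(12 :: real) / 5\<rfloor> = 2"
    "\<lfloor>(14 :: real) / 5\<rfloor> = 2" "\<lfloor>(16 :: real) / 5\<rfloor> = 3" "\<lfloor>(18 :: real) / 5\<rfloor> = 3"
    by (simp_all add: floor_eq_iff)
  then show "path_exponent 0 = 1" "path_exponent 1 = 1" "path_exponent 2 = 4 / 3" "path_exponent 3 = 2"
    "path_exponent 4 = 2" "path_exponent 5 = 3" "path_exponent 6 = 3"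
    by (simp_all add: path_exponent_def)
qed

text \<open>An increment of \<open>2 / 3\<close> pays for two blocks of two vertices, because
  \<open>4 / 3 + 4 / 3 = 2 + 2 / 3\<close>. It fails only on the way from 0 to 2 mod 5.\<close>

lemma path_exponent_add_2:
  "path_exponent (k + 2) \<ge> path_exponent k + (if k mod 5 = 0 then 1 / 3 else 2 / 3)"
proof (induction k rule: less_induct)
  case (less k)
  show ?case
  proof (cases "k < 5")
    case True
    then consider "k = 0" | "k = 1" | "k = 2" | "k = 3" | "k = 4" by linarith
    then show ?thesis
      using path_exponent_small path_exponent_small(3)[unfolded numeral_2_eq_2]
        path_exponent_small(4)[unfolded numeral_3_eq_3] by cases simp_all
  next
    case False
    then obtain j where k: "k = j + 5" using le_Suc_ex[of 5 k] by (auto simp: add.commute)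
    then have "path_exponent (j + 2) \<ge> path_exponent j + (if j mod 5 = 0 then 1 / 3 else 2 / 3)"
      using less[of j] by simp
    moreover have "k + 2 = (j + 2) + 5" by (simp add: k)
    ultimately show ?thesis
      using path_exponent_add_5[of "j + 2"] path_exponent_add_5[of j] by (simp add: k)
  qed
qed

text \<open>For \<open>k + 7\<close> equal to 2 mod 5, cutting off one block of two vertices and
  forgetting the next loses nothing.\<close>

lemma path_exponent_add_7_zero:
  assumes "k mod 5 = 0"
  shows "path_exponent (k + 7) = path_exponent (k + 4) + 4 / 3"
  using assms
proof (induction k rule: less_induct)
  case (less k)
  show ?case
  proof (cases "k < 5")
    case True
    then have "k = 0" using less.prems by simp
    then show ?thesis using path_exponent_small path_exponent_add_5[of 2] by simp
  next
    case False
    then obtain j where k: "k = j + 5" using le_Suc_ex[of 5 k] by (auto simp: add.commute)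
    then have "path_exponent (j + 7) = path_exponent (j + 4) + 4 / 3"
      using less by simp
    moreover have "k + 7 = (j + 7) + 5" "k + 4 = (j + 4) + 5" by (simp_all add: k)
    ultimately show ?thesis
      using path_exponent_add_5[of "j + 7"] path_exponent_add_5[of "j + 4"] by simp
  qed
qed

lemma soft_upper_paths_small:
  "soft_upper (paths 1) 1" "soft_upper (paths 2) (4 / 3)" "soft_upper (paths 3) 2" "soft_upper (paths 4) 2"
proof -
  show 1: "soft_upper (paths 1) 1"
    by (rule soft_upperI[of 1 0]) (use card_unit_paths_1 in \<open>auto simp: paths_def dest: ln_ge_1\<close>)
  show "soft_upper (paths 2) (4 / 3)"
  proof (rule soft_upperI[of 252 1])
    fix P :: "(real ^ 3) set" assume P: "finite P" "P \<subseteq> S2" "3 \<le> card P"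
    let ?n = "real (card P)"
    have "paths 2 P \<le> real (card (orth_pairs P P))"
      unfolding paths_def using card_unit_paths_2[OF P(1,2)] by (rule of_nat_mono)
    also have "\<dots> \<le> 84 * ln ?n * ((?n * ?n) powr (2 / 3) + ?n + ?n)"
      unfolding orth_pairs_def by (rule sphere_incidences[OF P(1,2) refl P(3)]) auto
    also have "(?n * ?n) powr (2 / 3) = ?n powr (4 / 3)"
      using P by (simp add: powr_mult flip: powr_add)
    also have "84 * ln ?n * (?n powr (4 / 3) + ?n + ?n) \<le> 84 * ln ?n * (3 * ?n powr (4 / 3))"
      using powr_mono[of 1 "4 / 3" ?n] P ln_ge_1[OF P(3)] by (intro mult_left_mono) auto
    also have "\<dots> = 252 * ?n powr (4 / 3) * ln ?n powr 1"
      using ln_ge_1[OF P(3)] by simp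
    finally show "paths 2 P \<le> 252 * ?n powr (4 / 3) * ln ?n powr 1" .
  qed auto
  have sq: "soft_upper (\<lambda>P. real (card P) * real (card P)) 2"
    by (rule soft_upperI[of 1 0]) (use ln_ge_1 in \<open>auto simp: power2_eq_square dest: ln_ge_1\<close>)
  have "soft_upper (\<lambda>P. paths 1 P * paths 1 P) 2"
    using soft_upper_mult[OF 1 1 paths_nonneg paths_nonneg] by simp
  then have "soft_upper (\<lambda>P. 2 * (paths 1 P * paths 1 P) + real (card P) * real (card P)) 2"
    by (intro soft_upper_add sq soft_upper_cmult) simp_all
  then show "soft_upper (paths 3) 2"
  proof (rule soft_upper_le)
    fix P :: "(real ^ 3) set" assume P: "finite P" "P \<subseteq> S2"
    show "paths 3 P \<le> 2 * (paths 1 P * paths 1 P) + real (card P) * real (card P)"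
      using of_nat_mono[OF card_unit_paths_3[OF P], where 'a = real] by (simp add: paths_def)
  qed
  show "soft_upper (paths 4) 2"
  proof (rule soft_upperI[of "192 * 54 * 84 ^ 4" 6])
    fix P :: "(real ^ 3) set" assume P: "finite P" "P \<subseteq> S2" "3 \<le> card P"
    let ?n = "real (card P)"
    have "paths 4 P \<le> real (\<Sum>(p, q)\<in>orth_pairs P P. card (nb P p) * card (nb P q))"
      unfolding paths_def using card_unit_paths_4[OF P(1,2)] by (rule of_nat_mono)
    also have "\<dots> \<le> 192 * 54 * 84 ^ 4 * ?n\<^sup>2 * ln ?n ^ 6"
      by (rule sum_degree_products_le[OF P(1,2) refl P(3)])
    also have "\<dots> = 192 * 54 * 84 ^ 4 * ?n powr 2 * ln ?n powr 6"
      using ln_ge_1[OF P(3)] P(3) by (simp add: powr_numeral)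
    finally show "paths 4 P \<le> 192 * 54 * 84 ^ 4 * ?n powr 2 * ln ?n powr 6" .
  qed auto
qed

lemma soft_upper_paths:
  assumes "k \<ge> 1"
  shows "soft_upper (paths k) (path_exponent k)"
  using assms
proof (induction k rule: less_induct)
  case (less k)
  note s = soft_upper_paths_small
  note mult = soft_upper_mult[OF _ _ paths_nonneg paths_nonneg]
  \<comment> \<open>The second alternative is \<open>k\<close> equal to 2 mod 5. Writing such a
    \<open>k\<close> as \<open>j + 8\<close> would give \<open>j mod 5 = 4\<close>, where the
    antipodal term of \<open>card_unit_paths_rec\<close> exceeds the target.\<close>
  have "(\<exists>j. k = j + 8 \<and> j mod 5 \<noteq> 4) \<or> (\<exists>j. k = j + 7 \<and> j mod 5 = 0)" if ge: "k \<ge> 7"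
  proof -
    obtain j where j: "k = j + 7" using le_Suc_ex[OF ge] by (auto simp: add.commute)
    show ?thesis
    proof (cases "j mod 5 = 0")
      case False
      then obtain i where i: "j = Suc i" by (cases j) auto
      then have "k = i + 8" "i mod 5 \<noteq> 4" using j False by (simp, presburger)
      then show ?thesis by blast
    next
      case True
      then have "k = j + 7 \<and> j mod 5 = 0" using j by simp
      then show ?thesis by (intro disjI2 exI)
    qed
  qed
  moreover have "k = 1 \<or> k = 2 \<or> k = 3 \<or> k = 4 \<or> k = 5 \<or> k = 6 \<or> k \<ge> 7"
    using less.prems by linarith
  ultimately consider (1) "k = 1" | (2) "k = 2" | (3) "k = 3" | (4) "k = 4" | (5) "k = 5" | (6) "k = 6"
    | (rec) j where "k = j + 8" "j mod 5 \<noteq> 4" | (rec') j where "k = j + 7" "j mod 5 = 0"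
    by meson
  then show ?case
  proof cases
    case 5
    have "soft_upper (\<lambda>P. 4 * (paths 1 P * paths 3 P)) (path_exponent 5)"
      using mult[OF s(1,3)] by (intro soft_upper_cmult) (simp_all add: path_exponent_small)
    then show ?thesis unfolding 5
    proof (rule soft_upper_le)
      fix P :: "(real ^ 3) set" assume P: "finite P" "P \<subseteq> S2"
      show "paths 5 P \<le> 4 * (paths 1 P * paths 3 P)"
        using of_nat_mono[OF card_unit_paths_5[OF P], where 'a = real] by (simp add: paths_def)
    qed
  next
    case 6
    have "soft_upper (\<lambda>P. 2 * (paths 4 P * paths 1 P)) (path_exponent 6)"
      using mult[OF s(4,1)] by (intro soft_upper_cmult) (simp_all add: path_exponent_small)
    moreover have "soft_upper (\<lambda>P. 2 * (paths 2 P * paths 2 P)) (path_exponent 6)"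
      by (intro soft_upper_cmult soft_upper_mono[OF mult[OF s(2,2)]]) (simp_all add: path_exponent_small)
    ultimately have "soft_upper (\<lambda>P. 2 * (paths 4 P * paths 1 P) + 2 * (paths 2 P * paths 2 P)) (path_exponent 6)"
      by (rule soft_upper_add)
    then show ?thesis unfolding 6
    proof (rule soft_upper_le)
      fix P :: "(real ^ 3) set" assume P: "finite P" "P \<subseteq> S2"
      show "paths 6 P \<le> 2 * (paths 4 P * paths 1 P) + 2 * (paths 2 P * paths 2 P)"
        using of_nat_mono[OF card_unit_paths_6[OF P], where 'a = real] by (simp add: paths_def)
    qed
  next
    case rec
    have IH: "soft_upper (paths (j + 3)) (path_exponent (j + 3))" "soft_upper (paths (j + 1)) (path_exponent (j + 1))"
      using less.IH rec by simp_all
    have e: "path_exponent (j + 8) = path_exponent (j + 3) + 2"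
      using path_exponent_add_5[of "j + 3"] by (simp add: add.commute)
    have "(j + 1) mod 5 \<noteq> 0" using rec(2) by (simp add: mod_Suc)
    then have e': "path_exponent (j + 3) \<ge> path_exponent (j + 1) + 2 / 3"
      using path_exponent_add_2[of "j + 1"] by (simp add: numeral_3_eq_3)
    have "soft_upper (\<lambda>P. 2 * (paths 4 P * paths (j + 3) P)) (path_exponent (j + 8))"
      by (intro soft_upper_cmult soft_upper_mono[OF mult[OF s(4) IH(1)]]) (simp_all add: e)
    moreover have "soft_upper (\<lambda>P. 4 * ((paths 2 P * paths 2 P) * paths (j + 1) P)) (path_exponent (j + 8))"
      by (intro soft_upper_cmult soft_upper_mono[OF soft_upper_mult[OF mult[OF s(2,2)] IH(2)]])
        (use e e' in \<open>simp_all add: paths_nonneg\<close>)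
    ultimately have "soft_upper (\<lambda>P. 2 * (paths 4 P * paths (j + 3) P)
        + 4 * ((paths 2 P * paths 2 P) * paths (j + 1) P)) (path_exponent (j + 8))"
      by (rule soft_upper_add)
    then show ?thesis unfolding rec(1)
    proof (rule soft_upper_le)
      fix P :: "(real ^ 3) set" assume P: "finite P" "P \<subseteq> S2"
      show "paths (j + 8) P \<le> 2 * (paths 4 P * paths (j + 3) P) + 4 * ((paths 2 P * paths 2 P) * paths (j + 1) P)"
        using of_nat_mono[OF card_unit_paths_rec[OF P, of j], where 'a = real] by (simp add: paths_def)
    qed
  next
    case rec'
    have IH: "soft_upper (paths (j + 2)) (path_exponent (j + 2))" "soft_upper (paths (j + 4)) (path_exponent (j + 4))"
      using less.IH rec' by simp_all
    have e: "path_exponent (j + 7) = path_exponent (j + 2) + 2"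
      using path_exponent_add_5[of "j + 2"] by (simp add: add.commute)
    have "soft_upper (\<lambda>P. 2 * (paths 4 P * paths (j + 2) P)) (path_exponent (j + 7))"
      by (intro soft_upper_cmult soft_upper_mono[OF mult[OF s(4) IH(1)]]) (simp_all add: e)
    moreover have "soft_upper (\<lambda>P. 2 * (paths 2 P * paths (j + 4) P)) (path_exponent (j + 7))"
      by (intro soft_upper_cmult soft_upper_mono[OF mult[OF s(2) IH(2)]])
        (simp_all add: path_exponent_add_7_zero[OF rec'(2)])
    ultimately have "soft_upper (\<lambda>P. 2 * (paths 4 P * paths (j + 2) P)
        + 2 * (paths 2 P * paths (j + 4) P)) (path_exponent (j + 7))"
      by (rule soft_upper_add)
    then show ?thesis unfolding rec'(1)
    proof (rule soft_upper_le)
      fix P :: "(real ^ 3) set" assume P: "finite P" "P \<subseteq> S2"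
      show "paths (j + 7) P \<le> 2 * (paths 4 P * paths (j + 2) P) + 2 * (paths 2 P * paths (j + 4) P)"
        using of_nat_mono[OF card_unit_paths_rec'[OF P, of j], where 'a = real] by (simp add: paths_def)
    qed
  next
    case 1
    show ?thesis unfolding 1 path_exponent_small by (rule s)
  next
    case 2
    show ?thesis unfolding 2 path_exponent_small by (rule s)
  next
    case 3
    show ?thesis unfolding 3 path_exponent_small by (rule s)
  next
    case 4
    show ?thesis unfolding 4 path_exponent_small by (rule s)
  qed
qed

section \<open>Constructions with many paths\<close>

text \<open>The size is bounded only up to the factor \<open>D\<close>; adjustment to exactly
  \<open>n\<close> points is left to the end. No logarithms are lost in the constructions.\<close>

definition many_paths :: "nat \<Rightarrow> real \<Rightarrow> bool" where
  "many_paths k e \<longleftrightarrow> (\<exists>D::nat>0. \<exists>d>0. \<forall>m\<ge>1. \<exists>P. finite P \<and> P \<subseteq> S2 \<and> card P \<le> D * m \<and>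
     d * real m powr e \<le> paths k P)"

lemma many_pathsI:
  assumes "D > 0" "d > 0" "\<And>m. m \<ge> 1 \<Longrightarrow> \<exists>P. finite P \<and> P \<subseteq> S2 \<and> card P \<le> D * m \<and>
     d * real m powr e \<le> paths k P"
  shows "many_paths k e"
  using assms unfolding many_paths_def by blast

lemma unit_paths_mono: "P \<subseteq> Q \<Longrightarrow> unit_paths k P \<subseteq> unit_paths k Q"
  by (auto simp: unit_paths_def)

lemma unit_paths_snoc:
  assumes "p \<in> unit_paths k P" "k \<ge> 1" "P \<subseteq> Q" "Q \<subseteq> S2" "z \<in> Q" "z \<notin> set p" "last p \<bullet> z = 0"
  shows "p @ [z] \<in> unit_paths (k + 1) Q"
proof -
  have P: "P \<subseteq> S2" using assms by blast
  have p: "length p = k" "set p \<subseteq> P" "distinct p" "\<And>i. Suc i < k \<Longrightarrow> p ! i \<bullet> p ! Suc i = 0"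
    using assms(1) unit_paths_iff[OF P] by auto
  have "(p @ [z]) ! i \<bullet> (p @ [z]) ! Suc i = 0" if "Suc i < k + 1" for i
  proof (cases "Suc i < k")
    case False
    then have i: "i = k - 1" "Suc i = k" using that by auto
    have "last p = p ! i" using p(1) assms(2) i by (metis last_conv_nth length_0_conv not_one_le_zero)
    then show ?thesis using assms(7) p(1) i by (simp add: nth_append)
  qed (use p in \<open>simp add: nth_append\<close>)
  then show ?thesis using unit_paths_iff[OF assms(4), of "p @ [z]" "k + 1"] p assms by auto
qed

text \<open>The points \<open>hat (p \<times> a)\<close> lie on the great circle orthogonal to \<open>a\<close>, which misses \<open>P\<close> for a
  generic \<open>a\<close>.\<close>

lemma extend_to_circle:
  assumes P: "finite P" "P \<subseteq> S2" and k: "k \<ge> 1"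
  obtains Q a where "finite Q" "Q \<subseteq> S2" "a \<in> S2" "a \<notin> Q" "- a \<notin> Q" "card Q \<le> 2 * card P"
    "card (unit_paths k P) \<le> card {q \<in> unit_paths (k + 1) Q. last q \<bullet> a = 0}"
proof -
  have P0: "0 \<notin> P" using P S2_nonzero by blast
  obtain a where a: "a \<in> S2" "\<forall>p\<in>P. p \<times> a \<noteq> 0" "\<forall>p\<in>P. a \<bullet> p \<noteq> 0"
    using ex_generic_non_parallel[OF P(1) P0 P(1) P0] by blast
  define f where "f p = hat (p \<times> a)" for p
  have f: "f p \<in> S2" "f p \<bullet> a = 0" "p \<bullet> f p = 0" if "p \<in> P" for p
    using a(2) that hat_mem_S2 by (auto simp: f_def inner_hat_eq_0_iff dot_cross_self inner_commute[of p])
  have aa: "a \<bullet> a \<noteq> 0" using S2_nonzero[OF a(1)] by simp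
  define Q where "Q = P \<union> f ` P"
  have "a \<times> a = 0" "(- a) \<times> a = 0" by simp_all
  then have "a \<notin> P" "- a \<notin> P" using a(2) by blast+
  moreover have "a \<notin> f ` P" "- a \<notin> f ` P"
    using f(2) aa by (metis imageE, metis imageE inner_minus_left neg_0_equal_iff_equal)
  moreover have "card Q \<le> 2 * card P"
    unfolding Q_def using card_Un_le[of P "f ` P"] card_image_le[OF P(1), of f] by linarith
  moreover have "card (unit_paths k P) \<le> card {q \<in> unit_paths (k + 1) Q. last q \<bullet> a = 0}"
  proof (rule card_inj_on_le[of "\<lambda>p. p @ [f (last p)]"])
    show "inj_on (\<lambda>p. p @ [f (last p)]) (unit_paths k P)" by (auto simp: inj_on_def)
    show "(\<lambda>p. p @ [f (last p)]) ` unit_paths k P \<subseteq> {q \<in> unit_paths (k + 1) Q. last q \<bullet> a = 0}"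
    proof (rule image_subsetI)
      fix p assume p: "p \<in> unit_paths k P"
      have "p \<noteq> []" "set p \<subseteq> P" using p k by (auto simp: unit_paths_def)
      then have l: "last p \<in> P" by auto
      have "f (last p) \<notin> P" using f(2)[OF l] a(3) by (force simp: inner_commute)
      then have "f (last p) \<notin> set p" using \<open>set p \<subseteq> P\<close> by blast
      then have "p @ [f (last p)] \<in> unit_paths (k + 1) Q"
        using l f P by (intro unit_paths_snoc[OF p k]) (auto simp: Q_def)
      then show "p @ [f (last p)] \<in> {q \<in> unit_paths (k + 1) Q. last q \<bullet> a = 0}"
        using f(2)[OF l] by simp
    qed
  qed (use P in \<open>simp add: finite_unit_paths Q_def\<close>)
  moreover have "finite Q" "Q \<subseteq> S2" using P f(1) by (auto simp: Q_def)
  ultimately show thesis using a(1) by (intro that[of Q a]) (simp_all add: Q_def)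
qed

lemma many_paths_Suc:
  assumes "many_paths k e" "k \<ge> 1"
  shows "many_paths (k + 1) e"
proof -
  obtain D :: nat and d where D: "D > 0" "d > 0"
    and *: "\<And>m. m \<ge> 1 \<Longrightarrow> \<exists>P. finite P \<and> P \<subseteq> S2 \<and> card P \<le> D * m \<and> d * real m powr e \<le> paths k P"
    using assms(1) unfolding many_paths_def by blast
  show ?thesis
  proof (rule many_pathsI[of "2 * D" d])
    fix m :: nat assume "m \<ge> 1"
    then obtain P where P: "finite P" "P \<subseteq> S2" "card P \<le> D * m" "d * real m powr e \<le> paths k P"
      using * by blast
    obtain Q a where Q: "finite Q" "Q \<subseteq> S2" "a \<in> S2" "a \<notin> Q" "- a \<notin> Q" "card Q \<le> 2 * card P"
      "card (unit_paths k P) \<le> card {q \<in> unit_paths (k + 1) Q. last q \<bullet> a = 0}"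
      by (rule extend_to_circle[OF P(1,2) assms(2)])
    have "card {q \<in> unit_paths (k + 1) Q. last q \<bullet> a = 0} \<le> card (unit_paths (k + 1) Q)"
      using Q by (intro card_mono) (auto simp: finite_unit_paths)
    then have "paths k P \<le> paths (k + 1) Q" using Q(7) by (simp add: paths_def)
    then show "\<exists>P. finite P \<and> P \<subseteq> S2 \<and> card P \<le> 2 * D * m \<and> d * real m powr e \<le> paths (k + 1) P"
      using Q P by (intro exI[of _ Q]) auto
  qed (use D in auto)
qed

text \<open>A generic \<open>b\<close> would be orthogonal to none of finitely many points, yet
  \<open>hat (a \<times> b)\<close> lies on the circle and is orthogonal to
  \<open>b\<close>.\<close>

lemma infinite_circle:
  assumes "a \<in> S2"
  shows "infinite {x \<in> S2. x \<bullet> a = 0}"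
proof
  let ?F = "{x \<in> S2. x \<bullet> a = 0}"
  assume "finite ?F"
  then obtain b where b: "a \<times> b \<noteq> 0" "\<forall>z\<in>?F. b \<bullet> z \<noteq> 0"
    using ex_generic_non_parallel[of "{a}" ?F] assms S2_nonzero by force
  have "hat (a \<times> b) \<bullet> a = 0" "b \<bullet> hat (a \<times> b) = 0"
    using inner_hat_eq_0_iff[OF b(1)] by (simp_all add: dot_cross_self inner_commute[of b])
  moreover from this have "hat (a \<times> b) \<in> ?F" using hat_mem_S2[OF b(1)] by simp
  ultimately show False using b(2) by blast
qed

lemma infinite_obtain_card_avoiding:
  assumes "infinite S" "finite T"
  obtains F where "F \<subseteq> S - T" "finite F" "card F = m"
  using infinite_arbitrarily_large[of "S - T" m] assms by (metis Diff_infinite_finite)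

text \<open>The two poles of a great circle are adjacent to all of its points; this is what makes the
  number of paths grow by a factor \<open>m\<^sup>2\<close>.\<close>

lemma extend_through_poles:
  assumes P: "finite P" "P \<subseteq> S2" and k: "k \<ge> 1" and a: "a \<in> S2" "a \<notin> P" "- a \<notin> P"
  obtains Q where "finite Q" "Q \<subseteq> S2" "card Q \<le> card P + 2 + 2 * m"
    "card {q \<in> unit_paths k P. last q \<bullet> a = 0} * m\<^sup>2 \<le> card (unit_paths (k + 4) Q)"
proof -
  let ?C = "{x \<in> S2. x \<bullet> a = 0}"
  let ?W = "{q \<in> unit_paths k P. last q \<bullet> a = 0}"
  obtain X where X: "X \<subseteq> ?C - P" "finite X" "card X = m"
    using infinite_obtain_card_avoiding[OF infinite_circle[OF a(1)] P(1)] by blast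
  \<comment> \<open>\<open>X\<close> and \<open>Y\<close> avoid \<open>P\<close> and each other, so
    all \<open>m ^ 2\<close> choices of \<open>x\<close> and \<open>y\<close> yield paths with
    distinct vertices.\<close>
  obtain Y where Y: "Y \<subseteq> ?C - (P \<union> X)" "finite Y" "card Y = m"
    using infinite_obtain_card_avoiding[OF infinite_circle[OF a(1)], of "P \<union> X"] P(1) X(2) by blast
  define Q where "Q = P \<union> {a, - a} \<union> X \<union> Y"
  have fQ: "finite Q" using P X Y by (simp add: Q_def)
  have QS: "Q \<subseteq> S2" using P X Y a by (auto simp: Q_def)
  have aa: "a \<bullet> a \<noteq> 0" using S2_nonzero[OF a(1)] by simp
  have na: "a \<notin> X \<union> Y" "- a \<notin> X \<union> Y" using X(1) Y(1) aa by auto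
  have "card Q \<le> card (P \<union> {a, - a} \<union> X) + card Y" unfolding Q_def by (rule card_Un_le)
  also have "card (P \<union> {a, - a} \<union> X) \<le> card (P \<union> {a, - a}) + card X" by (rule card_Un_le)
  also have "card (P \<union> {a, - a}) \<le> card P + card {a, - a}" by (rule card_Un_le)
  also have "card {a, - a} \<le> 2" by (simp add: card_insert_if)
  finally have cQ: "card Q \<le> card P + 2 + 2 * m" using X Y by simp
  have "card (Sigma ?W (\<lambda>_. Sigma X (\<lambda>_. Y))) \<le> card (unit_paths (k + 4) Q)"
  proof (rule card_inj_on_le[of "\<lambda>(q, x, y). q @ [a, x, - a, y]"])
    show "inj_on (\<lambda>(q, x, y). q @ [a, x, - a, y]) (Sigma ?W (\<lambda>_. Sigma X (\<lambda>_. Y)))"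
      by (auto simp: inj_on_def)
    show "(\<lambda>(q, x, y). q @ [a, x, - a, y]) ` Sigma ?W (\<lambda>_. Sigma X (\<lambda>_. Y)) \<subseteq> unit_paths (k + 4) Q"
    proof (rule image_subsetI, clarify)
      fix q x y assume q: "q \<in> unit_paths k P" "last q \<bullet> a = 0" and x: "x \<in> X" and y: "y \<in> Y"
      have set: "set q \<subseteq> P" using q by (simp add: unit_paths_def)
      have xP: "x \<notin> P" "x \<bullet> a = 0" "a \<bullet> x = 0" using X(1) x by (auto simp: inner_commute)
      have yP: "y \<notin> P" "y \<notin> X" "y \<bullet> a = 0" "a \<bullet> y = 0" using Y(1) y by (auto simp: inner_commute)
      have ne: "x \<noteq> a" "x \<noteq> - a" "y \<noteq> a" "y \<noteq> - a" "x \<noteq> y" "a \<noteq> - a"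
        using na x y yP S2_neq_uminus[OF a(1)] by auto
      have mem: "a \<in> Q" "x \<in> Q" "- a \<in> Q" "y \<in> Q" "P \<subseteq> Q" using x y by (auto simp: Q_def)
      have 1: "q @ [a] \<in> unit_paths (k + 1) Q"
        using q set a mem by (intro unit_paths_snoc[OF q(1) k _ QS]) auto
      have 2: "(q @ [a]) @ [x] \<in> unit_paths (k + 1 + 1) Q"
        using set xP mem ne by (intro unit_paths_snoc[OF 1 _ order_refl QS]) auto
      have 3: "((q @ [a]) @ [x]) @ [- a] \<in> unit_paths (k + 1 + 1 + 1) Q"
        using set a xP mem ne by (intro unit_paths_snoc[OF 2 _ order_refl QS]) auto
      have 4: "(((q @ [a]) @ [x]) @ [- a]) @ [y] \<in> unit_paths (k + 1 + 1 + 1 + 1) Q"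
        using set yP mem ne by (intro unit_paths_snoc[OF 3 _ order_refl QS]) auto
      have k4: "k + 4 = k + 1 + 1 + 1 + 1" by simp
      show "q @ [a, x, - a, y] \<in> unit_paths (k + 4) Q" unfolding k4 using 4 by simp
    qed
  qed (simp add: finite_unit_paths fQ)
  moreover have "finite ?W" using P by (simp add: finite_unit_paths)
  ultimately have "card ?W * m\<^sup>2 \<le> card (unit_paths (k + 4) Q)"
    using X Y by (simp add: card_SigmaI power2_eq_square)
  then show thesis using that fQ QS cQ by blast
qed

lemma many_paths_add_5:
  assumes "many_paths k e" "k \<ge> 1"
  shows "many_paths (k + 5) (e + 2)"
proof -
  obtain D :: nat and d where D: "D > 0" "d > 0"
    and *: "\<And>m. m \<ge> 1 \<Longrightarrow> \<exists>P. finite P \<and> P \<subseteq> S2 \<and> card P \<le> D * m \<and> d * real m powr e \<le> paths k P"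
    using assms(1) unfolding many_paths_def by blast
  show ?thesis
  \<comment> \<open>Linking to the circle doubles the set; the poles and the two new families add
    \<open>2 + 2 * m \<le> 4 * m\<close> points.\<close>
  proof (rule many_pathsI[of "2 * D + 4" d])
    fix m :: nat assume m: "m \<ge> 1"
    then obtain P where P: "finite P" "P \<subseteq> S2" "card P \<le> D * m" "d * real m powr e \<le> paths k P"
      using * by blast
    obtain Q a where Q: "finite Q" "Q \<subseteq> S2" "a \<in> S2" "a \<notin> Q" "- a \<notin> Q" "card Q \<le> 2 * card P"
      "card (unit_paths k P) \<le> card {q \<in> unit_paths (k + 1) Q. last q \<bullet> a = 0}"
      by (rule extend_to_circle[OF P(1,2) assms(2)])
    have k1: "k + 1 \<ge> 1" by simp
    obtain R where R: "finite R" "R \<subseteq> S2" "card R \<le> card Q + 2 + 2 * m"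
      "card {q \<in> unit_paths (k + 1) Q. last q \<bullet> a = 0} * m\<^sup>2 \<le> card (unit_paths (k + 1 + 4) R)"
      by (rule extend_through_poles[OF Q(1,2) k1 Q(3-5)])
    have k5: "k + 5 = k + 1 + 4" by simp
    have "card (unit_paths k P) * m\<^sup>2 \<le> card (unit_paths (k + 5) R)"
      unfolding k5 by (rule order_trans[OF mult_right_mono[OF Q(7)] R(4)]) simp
    then have "real (card (unit_paths k P) * m\<^sup>2) \<le> real (card (unit_paths (k + 5) R))" by (rule of_nat_mono)
    then have "paths k P * (real m)\<^sup>2 \<le> paths (k + 5) R" by (simp add: paths_def)
    moreover have "d * real m powr (e + 2) = (d * real m powr e) * (real m)\<^sup>2"
      using m by (simp add: powr_add powr_numeral)
    moreover have "(d * real m powr e) * (real m)\<^sup>2 \<le> paths k P * (real m)\<^sup>2"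
      using P(4) by (rule mult_right_mono) simp
    ultimately have "d * real m powr (e + 2) \<le> paths (k + 5) R" by linarith
    moreover have "card R \<le> (2 * D + 4) * m"
    proof -
      have "card R \<le> 2 * (D * m) + 2 + 2 * m" using R(3) Q(6) P(3) by linarith
      also have "\<dots> \<le> 2 * (D * m) + 2 * m + 2 * m" using m by linarith
      finally show ?thesis by (simp add: algebra_simps)
    qed
    ultimately show "\<exists>P. finite P \<and> P \<subseteq> S2 \<and> card P \<le> (2 * D + 4) * m \<and> d * real m powr (e + 2) \<le> paths (k + 5) P"
      using R by blast
  qed (use D in auto)
qed

lemma singleton_unit_paths: "(\<lambda>x. [x]) ` P \<subseteq> unit_paths 1 P"
  by (auto simp: unit_paths_def)

lemma many_paths_1: "many_paths 1 1"
proof (rule many_pathsI[of 1 1])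
  fix m :: nat assume "m \<ge> 1"
  obtain P where P: "finite P" "card P = m" "P \<subseteq> S2"
    using infinite_arbitrarily_large[OF infinite_S2] by blast
  have "card P = card ((\<lambda>x. [x]) ` P)" by (simp add: card_image inj_on_def)
  also have "\<dots> \<le> card (unit_paths 1 P)"
    using P by (intro card_mono singleton_unit_paths finite_unit_paths)
  finally have "m \<le> card (unit_paths 1 P)" using P by simp
  then show "\<exists>P. finite P \<and> P \<subseteq> S2 \<and> card P \<le> 1 * m \<and> 1 * real m powr 1 \<le> paths 1 P"
    using P by (intro exI[of _ P]) (simp add: paths_def)
qed auto

text \<open>The starting points already lie on the circle polar to \<open>a\<close>. No linking
  vertex is spent, and all three vertices on the circle are free.\<close>

lemma many_paths_5: "many_paths 5 3"
proof (rule many_pathsI[of 5 1])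
  fix m :: nat assume m: "m \<ge> 1"
  have "S2 \<noteq> {}" using infinite_S2 by auto
  then obtain a where a: "a \<in> S2" by blast
  obtain X where X: "X \<subseteq> {x \<in> S2. x \<bullet> a = 0} - {}" "finite X" "card X = m"
    using infinite_obtain_card_avoiding[OF infinite_circle[OF a], of "{}"] by blast
  have aX: "a \<notin> X" "- a \<notin> X" using X(1) a by (auto simp: mem_S2_iff)
  have XS: "X \<subseteq> S2" using X(1) by blast
  obtain R where R: "finite R" "R \<subseteq> S2" "card R \<le> card X + 2 + 2 * m"
    "card {q \<in> unit_paths 1 X. last q \<bullet> a = 0} * m\<^sup>2 \<le> card (unit_paths (1 + 4) R)"
    by (rule extend_through_poles[OF X(2) XS order_refl a aX])
  have "m = card ((\<lambda>x. [x]) ` X)" using X(3) by (simp add: card_image inj_on_def)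
  also have "\<dots> \<le> card {q \<in> unit_paths 1 X. last q \<bullet> a = 0}"
    using X singleton_unit_paths[of X] by (intro card_mono) (auto simp: finite_unit_paths)
  finally have m1: "m \<le> card {q \<in> unit_paths 1 X. last q \<bullet> a = 0}" .
  have "m * m\<^sup>2 \<le> card (unit_paths (1 + 4) R)"
    by (rule order_trans[OF mult_right_mono[OF m1] R(4)]) simp
  then have "m * m\<^sup>2 \<le> card (unit_paths 5 R)" by simp
  then have "real (m ^ 3) \<le> paths 5 R"
    unfolding paths_def by (intro of_nat_mono) (simp add: power2_eq_square power3_eq_cube)
  moreover have "real m powr 3 = real (m ^ 3)" using m by (simp add: powr_numeral)
  moreover have "card R \<le> 5 * m" using R(3) X(3) m by linarith
  ultimately show "\<exists>P. finite P \<and> P \<subseteq> S2 \<and> card P \<le> 5 * m \<and> 1 * real m powr 3 \<le> paths 5 P"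
    using R by (intro exI[of _ R]) auto
qed auto

text \<open>The upper bound on the number of paths with five vertices turns into a lower bound for three.\<close>

lemma many_paths_3: "many_paths 3 2"
proof -
  obtain D :: nat and d where D: "D > 0" "d > 0"
    and *: "\<And>m. m \<ge> 1 \<Longrightarrow> \<exists>P. finite P \<and> P \<subseteq> S2 \<and> card P \<le> D * m \<and> d * real m powr 3 \<le> paths 5 P"
    using many_paths_5 unfolding many_paths_def by blast
  show ?thesis
  proof (rule many_pathsI[of D "d / (4 * real D)"])
    fix m :: nat assume m: "m \<ge> 1"
    then obtain P where P: "finite P" "P \<subseteq> S2" "card P \<le> D * m" "d * real m powr 3 \<le> paths 5 P"
      using * by blast
    have "paths 5 P \<le> 4 * paths 1 P * paths 3 P"
      using of_nat_mono[OF card_unit_paths_5[OF P(1,2)], where 'a = real] by (simp add: paths_def)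
    also have "paths 1 P \<le> real D * real m"
      using of_nat_mono[OF le_trans[OF card_unit_paths_1[OF P(1)] P(3)], where 'a = real] by (simp add: paths_def)
    finally have "paths 5 P \<le> 4 * (real D * real m) * paths 3 P"
      by (simp add: mult_right_mono paths_nonneg)
    then have "d * real m powr 3 \<le> 4 * (real D * real m) * paths 3 P" using P(4) by linarith
    moreover have "real m powr 3 = real m * real m powr 2" using m by (simp add: powr_numeral eval_nat_numeral)
    ultimately have "real m * (d * real m powr 2) \<le> real m * (4 * real D * paths 3 P)" by (simp add: ac_simps)
    then have "d * real m powr 2 \<le> 4 * real D * paths 3 P" using m by simp
    then have "d / (4 * real D) * real m powr 2 \<le> paths 3 P" using D by (simp add: field_simps)
    then show "\<exists>P. finite P \<and> P \<subseteq> S2 \<and> card P \<le> D * m \<and> d / (4 * real D) * real m powr 2 \<le> paths 3 P"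
      using P(1-3) by (intro exI[of _ P]) simp
  qed (use D in auto)
qed

section \<open>A grid with many incidences\<close>

lemma hat_eqD:
  assumes "hat u = hat v" "u $ i = v $ i" "u $ i \<noteq> 0"
  shows "u = v"
proof -
  define c where "c = 1 / (sqrt 2 * norm u)"
  define c' where "c' = 1 / (sqrt 2 * norm v)"
  have eq: "c *\<^sub>R u = c' *\<^sub>R v" using assms(1) by (simp add: hat_def c_def c'_def)
  then have "c * u $ i = c' * v $ i" by (metis real_scaleR_def vector_scaleR_component)
  then have "c = c'" using assms(2,3) by simp
  moreover have "u \<noteq> 0" using assms(3) by auto
  then have "c \<noteq> 0" by (simp add: c_def)
  ultimately show ?thesis using eq by simp
qed

lemma inner_hat_hat: "x \<bullet> y = 0 \<Longrightarrow> hat x \<bullet> hat y = 0"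
  by (simp add: hat_def)

lemma pair_mem_unit_paths_2:
  assumes "P \<subseteq> S2" "p \<in> P" "q \<in> P" "p \<bullet> q = 0"
  shows "[p, q] \<in> unit_paths 2 P"
proof -
  have "p \<noteq> q" using assms by (auto simp: mem_S2_iff)
  then show ?thesis
    using assms by (auto simp: unit_paths_iff[OF assms(1)] less_Suc_eq numeral_2_eq_2)
qed

definition grid_point :: "nat \<Rightarrow> nat \<Rightarrow> real ^ 3" where
  "grid_point x y = hat (vector [real x, real y, 1])"

text \<open>The normal vector of the line \<open>y = s x + b\<close> in the plane at height \<open>1\<close>.\<close>

definition grid_line :: "nat \<Rightarrow> nat \<Rightarrow> real ^ 3" where
  "grid_line s b = hat (vector [real s, - 1, real b])"

lemma grid_mem_S2: "grid_point x y \<in> S2" "grid_line s b \<in> S2"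
proof -
  have "(vector [real x, real y, 1] :: real ^ 3) \<noteq> 0" "(vector [real s, - 1, real b] :: real ^ 3) \<noteq> 0"
    by (simp_all add: vec_eq_iff forall_3)
  then show "grid_point x y \<in> S2" "grid_line s b \<in> S2"
    by (simp_all add: grid_point_def grid_line_def hat_mem_S2)
qed

lemma grid_point_eqD:
  assumes "grid_point x y = grid_point x' y'"
  shows "x = x'" "y = y'"
proof -
  have "(vector [real x, real y, 1] :: real ^ 3) = vector [real x', real y', 1]"
    by (rule hat_eqD[of _ _ 3]) (use assms in \<open>simp_all add: grid_point_def\<close>)
  then show "x = x'" "y = y'" by (simp_all add: vec_eq_iff forall_3)
qed

lemma grid_line_eqD:
  assumes "grid_line x y = grid_line x' y'"
  shows "x = x'" "y = y'"
proof -
  have "(vector [real x, - 1, real y] :: real ^ 3) = vector [real x', - 1, real y']"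
    by (rule hat_eqD[of _ _ 2]) (use assms in \<open>simp_all add: grid_line_def\<close>)
  then show "x = x'" "y = y'" by (simp_all add: vec_eq_iff forall_3)
qed

lemma grid_incidence: "grid_point x (s * x + b) \<bullet> grid_line s b = 0"
  unfolding grid_point_def grid_line_def
  by (rule inner_hat_hat) (simp add: inner_vec_def sum_3)

text \<open>Elekes' construction: slopes up to \<open>N\<close> and intercepts up to
  \<open>N ^ 2\<close> keep \<open>s * x + b\<close> within \<open>2 * N ^ 2\<close> for
  \<open>x\<close> up to \<open>N\<close>. So each of the \<open>N ^ 3\<close> lines passes through
  a grid point in each of the \<open>N\<close> columns.\<close>

lemma grid_paths:
  "\<exists>P. finite P \<and> P \<subseteq> S2 \<and> card P \<le> 3 * N ^ 3 \<and> N ^ 4 \<le> card (unit_paths 2 P)"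
proof -
  define A where "A = (\<lambda>(x, y). grid_point x y) ` Sigma {1..N} (\<lambda>_. {1..2 * N\<^sup>2})"
  define B where "B = (\<lambda>(s, b). grid_line s b) ` Sigma {1..N} (\<lambda>_. {1..N\<^sup>2})"
  define P where "P = A \<union> B"
  have fin: "finite A" "finite B" by (simp_all add: A_def B_def)
  have PS: "P \<subseteq> S2" using grid_mem_S2 by (auto simp: P_def A_def B_def)
  have "card A \<le> card (Sigma {1..N} (\<lambda>_. {1..2 * N\<^sup>2}))" unfolding A_def by (intro card_image_le) simp
  moreover have "card B \<le> card (Sigma {1..N} (\<lambda>_. {1..N\<^sup>2}))" unfolding B_def by (intro card_image_le) simp
  ultimately have "card A + card B \<le> 3 * N ^ 3" by (simp add: power2_eq_square power3_eq_cube)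
  then have cP: "card P \<le> 3 * N ^ 3" unfolding P_def using card_Un_le[of A B] by linarith
  let ?T = "Sigma {1..N} (\<lambda>_. Sigma {1..N} (\<lambda>_. {1..N\<^sup>2}))"
  have "card ?T \<le> card (unit_paths 2 P)"
  proof (rule card_inj_on_le[of "\<lambda>(x, s, b). [grid_point x (s * x + b), grid_line s b]"])
    show "inj_on (\<lambda>(x, s, b). [grid_point x (s * x + b), grid_line s b]) ?T"
      by (rule inj_onI) (auto dest: grid_point_eqD grid_line_eqD)
    show "(\<lambda>(x, s, b). [grid_point x (s * x + b), grid_line s b]) ` ?T \<subseteq> unit_paths 2 P"
    proof (rule image_subsetI, clarify)
      fix x s b assume x: "x \<in> {1..N}" and s: "s \<in> {1..N}" and b: "b \<in> {1..N\<^sup>2}"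
      have "s * x \<le> N * N" using x s by (intro mult_le_mono) auto
      then have "s * x + b \<in> {1..2 * N\<^sup>2}" using b by (simp add: power2_eq_square)
      then have "grid_point x (s * x + b) \<in> P" "grid_line s b \<in> P"
        using x s b by (auto simp: P_def A_def B_def)
      then show "[grid_point x (s * x + b), grid_line s b] \<in> unit_paths 2 P"
        by (intro pair_mem_unit_paths_2 PS grid_incidence)
    qed
  qed (use fin in \<open>simp add: P_def finite_unit_paths\<close>)
  then have "N ^ 4 \<le> card (unit_paths 2 P)" by (simp add: power2_eq_square eval_nat_numeral)
  then show ?thesis using PS fin cP by (intro exI[of _ P]) (simp add: P_def)
qed

lemma many_paths_2: "many_paths 2 (4 / 3)"
proof (rule many_pathsI[of 3 "1 / 16"])
  fix m :: nat assume m: "m \<ge> 1"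
  \<comment> \<open>Rounding down at most halves the cube root of \<open>m\<close>; its fourth power
    then loses the factor \<open>16\<close>.\<close>
  define N where "N = nat \<lfloor>real m powr (1 / 3)\<rfloor>"
  have m3: "(real m powr (1 / 3)) ^ 3 = real m"
    using m powr_realpow[of "real m powr (1 / 3)" 3] powr_powr[of "real m" "1 / 3" 3] by simp
  have ge1: "real m powr (1 / 3) \<ge> 1" using m by (simp add: ge_one_powr_ge_zero)
  then have N: "real N \<le> real m powr (1 / 3)" "real m powr (1 / 3) \<le> real N + 1" "N \<ge> 1"
    unfolding N_def by linarith+
  have "real N ^ 3 \<le> real m" using power_mono[OF N(1), of 3] m3 by simp
  then have N3: "N ^ 3 \<le> m" by (metis of_nat_le_iff of_nat_power)
  have "real m powr (1 / 3) \<le> 2 * real N" using N by linarith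
  then have "(real m powr (1 / 3)) ^ 4 \<le> (2 * real N) ^ 4" by (intro power_mono) auto
  moreover have "(real m powr (1 / 3)) ^ 4 = real m powr (4 / 3)"
    using m powr_realpow[of "real m powr (1 / 3)" 4] powr_powr[of "real m" "1 / 3" 4] by simp
  ultimately have N4: "1 / 16 * real m powr (4 / 3) \<le> real (N ^ 4)" by (simp add: power_mult_distrib)
  obtain P where P: "finite P" "P \<subseteq> S2" "card P \<le> 3 * N ^ 3" "N ^ 4 \<le> card (unit_paths 2 P)"
    using grid_paths by blast
  have "real (N ^ 4) \<le> paths 2 P" unfolding paths_def by (rule of_nat_mono[OF P(4)])
  then have "1 / 16 * real m powr (4 / 3) \<le> paths 2 P" using N4 by linarith
  moreover have "card P \<le> 3 * m" using P(3) N3 by linarith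
  ultimately show "\<exists>P. finite P \<and> P \<subseteq> S2 \<and> card P \<le> 3 * m \<and> 1 / 16 * real m powr (4 / 3) \<le> paths 2 P"
    using P by (intro exI[of _ P]) simp
qed auto

text \<open>Prolongation by five vertices needs a path to start from, so \<open>k = 5\<close> is a
  base case of its own.\<close>

lemma many_paths_path_exponent:
  assumes "k \<ge> 1"
  shows "many_paths k (path_exponent k)"
  using assms
proof (induction k rule: less_induct)
  case (less k)
  show ?case
  proof (cases "k \<ge> 6")
    case True
    then obtain j where j: "k = j + 5" using le_Suc_ex[of 5 k] by (auto simp: add.commute)
    then have "many_paths j (path_exponent j)" "j \<ge> 1" using less.IH True by simp_all
    then show ?thesis unfolding j path_exponent_add_5 by (rule many_paths_add_5)
  next
    case False
    then consider (1) "k = 1" | (2) "k = 2" | (3) "k = 3" | (4) "k = 3 + 1" | (5) "k = 5"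
      using less.prems by linarith
    then show ?thesis
    proof cases
      case 1
      show ?thesis unfolding 1 path_exponent_small by (rule many_paths_1)
    next
      case 2
      show ?thesis unfolding 2 path_exponent_small by (rule many_paths_2)
    next
      case 3
      show ?thesis unfolding 3 path_exponent_small by (rule many_paths_3)
    next
      case 4
      have "path_exponent (3 + 1) = 2" using path_exponent_small by simp
      then show ?thesis using many_paths_Suc[OF many_paths_3] unfolding 4 by simp
    next
      case 5
      show ?thesis unfolding 5 path_exponent_small by (rule many_paths_5)
    qed
  qed
qed

section \<open>From constructions and bounds to the maximum\<close>

lemma P_S_ge:
  assumes "finite P" "P \<subseteq> S2" "card P = n"
  shows "card (unit_paths k P) \<le> P_S k n"
  unfolding P_S_def using assms
  by (intro Max_ge finite_unit_path_counts) (auto simp: unit_path_counts_def)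

lemma P_S_attained: "\<exists>P. finite P \<and> P \<subseteq> S2 \<and> card P = n \<and> P_S k n = card (unit_paths k P)"
proof -
  have "P_S k n \<in> unit_path_counts k n"
    unfolding P_S_def by (rule Max_in[OF finite_unit_path_counts unit_path_counts_nonempty])
  then show ?thesis by (auto simp: unit_path_counts_def)
qed

text \<open>With \<open>m = n div D\<close> the construction has at most \<open>n\<close> points and
  is padded with arbitrary further ones, which destroy no paths. Since
  \<open>n \<le> 2 * D * m\<close>, only the constant suffers.\<close>

lemma P_S_lower:
  assumes "many_paths k e" "e \<ge> 0"
  shows "\<exists>C>0. \<forall>\<^sub>F n in sequentially. real n powr e \<le> C * real (P_S k n)"
proof -
  obtain D :: nat and d where D: "D > 0" "d > 0"
    and *: "\<And>m. m \<ge> 1 \<Longrightarrow> \<exists>P. finite P \<and> P \<subseteq> S2 \<and> card P \<le> D * m \<and> d * real m powr e \<le> paths k P"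
    using assms(1) unfolding many_paths_def by blast
  define C where "C = real (2 * D) powr e / d"
  have "real n powr e \<le> C * real (P_S k n)" if n: "n \<ge> D" for n
  proof -
    define m where "m = n div D"
    have m: "m \<ge> 1" using n D by (simp add: m_def Suc_le_eq div_greater_zero_iff)
    have mn: "D * m \<le> n" by (simp add: m_def)
    have "n < D + m * D" unfolding m_def by (rule dividend_less_div_times[OF D(1)])
    also have "\<dots> \<le> m * D + m * D" using m by simp
    finally have nm: "n \<le> 2 * D * m" by (simp add: ac_simps)
    obtain P where P: "finite P" "P \<subseteq> S2" "card P \<le> D * m" "d * real m powr e \<le> paths k P"
      using *[OF m] by blast
    obtain F where F: "F \<subseteq> S2 - P" "finite F" "card F = n - card P"
      by (rule infinite_obtain_card_avoiding[OF infinite_S2 P(1)])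
    have "P \<inter> F = {}" using F(1) by blast
    then have "card (P \<union> F) = n" using P F mn by (simp add: card_Un_disjoint)
    then have "card (unit_paths k (P \<union> F)) \<le> P_S k n"
      using P F by (intro P_S_ge) auto
    moreover have "card (unit_paths k P) \<le> card (unit_paths k (P \<union> F))"
      using P F by (intro card_mono finite_unit_paths unit_paths_mono) auto
    ultimately have "paths k P \<le> real (P_S k n)" by (simp add: paths_def)
    then have dm: "d * real m powr e \<le> real (P_S k n)" using P(4) by linarith
    have "real n powr e \<le> real (2 * D * m) powr e"
      using of_nat_mono[OF nm, where 'a = real] assms(2) by (intro powr_mono2) auto
    also have "\<dots> = C * (d * real m powr e)" using D by (simp add: C_def powr_mult)
    also have "\<dots> \<le> C * real (P_S k n)" using dm D by (intro mult_left_mono) (auto simp: C_def)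
    finally show ?thesis .
  qed
  then have "\<forall>\<^sub>F n in sequentially. real n powr e \<le> C * real (P_S k n)"
    by (rule eventually_sequentiallyI)
  moreover have "C > 0" using D by (simp add: C_def)
  ultimately show ?thesis by blast
qed

lemma P_S_upper:
  assumes "soft_upper (paths k) e"
  shows "\<exists>C>0. \<exists>c>0. \<forall>n\<ge>3. real (P_S k n) \<le> C * real n powr e * ln (real n) powr c"
proof -
  obtain C c where C: "C \<ge> 0" "c \<ge> 0" and F: "\<And>P. finite P \<Longrightarrow> P \<subseteq> S2 \<Longrightarrow> 3 \<le> card P \<Longrightarrow>
      paths k P \<le> C * real (card P) powr e * ln (real (card P)) powr c"
    using assms(1) unfolding soft_upper_def by blast
  \<comment> \<open>Adding \<open>1\<close> to both constants makes them positive, as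
    \<open>soft_theta\<close> demands.\<close>
  have "real (P_S k n) \<le> (C + 1) * real n powr e * ln (real n) powr (c + 1)" if n: "n \<ge> 3" for n
  proof -
    obtain P where P: "finite P" "P \<subseteq> S2" "card P = n" "P_S k n = card (unit_paths k P)"
      using P_S_attained by blast
    have "real (P_S k n) \<le> C * real n powr e * ln (real n) powr c"
      using F[OF P(1,2)] P n by (simp add: paths_def)
    also have "\<dots> \<le> (C + 1) * real n powr e * ln (real n) powr (c + 1)"
      using C ln_ge_1[OF n] n by (intro mult_mono powr_mono) auto
    finally show ?thesis .
  qed
  moreover have "C + 1 > 0" "c + 1 > 0" using C by auto
  ultimately show ?thesis by blast
qed

lemma path_exponent_nonneg: "path_exponent k \<ge> 0"
proof -
  have "2 * (real k + 3) / 5 \<ge> of_int 1" by simp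
  then have "\<lfloor>2 * (real k + 3) / 5\<rfloor> \<ge> 1" by (simp only: le_floor_iff)
  then have "real_of_int \<lfloor>2 * (real k + 3) / 5\<rfloor> \<ge> 1" by linarith
  moreover have "(if k mod 5 = 2 then 2 / 3 else 0 :: real) \<le> 1" by simp
  ultimately show ?thesis unfolding path_exponent_def by linarith
qed

lemma soft_theta_P_S:
  assumes "k \<ge> 1"
  shows "soft_theta (\<lambda>n. real (P_S k n)) (\<lambda>n. real n powr path_exponent k)"
proof -
  obtain C where C: "C > 0" "\<forall>\<^sub>F n in sequentially. real n powr path_exponent k \<le> C * real (P_S k n)"
    using P_S_lower[OF many_paths_path_exponent[OF assms] path_exponent_nonneg] by blast
  obtain D c where D: "D > 0" "c > 0"
    and up: "\<And>n. n \<ge> 3 \<Longrightarrow> real (P_S k n) \<le> D * real n powr path_exponent k * ln (real n) powr c"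
    using P_S_upper[OF soft_upper_paths[OF assms]] by blast
  \<comment> \<open>\<open>soft_theta\<close> asks for the same constants on both sides:
    \<open>C + D\<close> dominates both, and the logarithmic factor, being at least
    \<open>1\<close>, only weakens the lower bound.\<close>
  have "\<forall>\<^sub>F n in sequentially.
      real n powr path_exponent k / ((C + D) * ln (real n) powr c) \<le> real (P_S k n) \<and>
      real (P_S k n) \<le> (C + D) * real n powr path_exponent k * ln (real n) powr c"
    using C(2) eventually_ge_at_top[of 3]
  proof eventually_elim
    case (elim n)
    have L: "ln (real n) powr c \<ge> 1" using ln_ge_1[OF elim(2)] D by (simp add: ge_one_powr_ge_zero)
    have "C * 1 \<le> (C + D) * ln (real n) powr c" using L C(1) D by (intro mult_mono) auto
    then have "C * real (P_S k n) \<le> ((C + D) * ln (real n) powr c) * real (P_S k n)"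
      by (intro mult_right_mono) auto
    then have "real n powr path_exponent k \<le> real (P_S k n) * ((C + D) * ln (real n) powr c)"
      using elim(1) by (simp add: mult.commute)
    moreover have "(C + D) * ln (real n) powr c > 0" using C(1) D L by (intro mult_pos_pos) auto
    ultimately have "real n powr path_exponent k / ((C + D) * ln (real n) powr c) \<le> real (P_S k n)"
      by (simp add: pos_divide_le_eq)
    moreover have "D * real n powr path_exponent k * ln (real n) powr c
        \<le> (C + D) * real n powr path_exponent k * ln (real n) powr c"
      using C(1) by (intro mult_right_mono) auto
    ultimately show ?case using up[OF elim(2)] by linarith
  qed
  then show ?thesis
    unfolding soft_theta_def using C(1) D by (intro exI[of _ "C + D"] exI[of _ c] conjI) auto
qed

theorem theorem1:
  fixes k :: nat
  assumes "k \<ge> 1"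
  shows "(k mod 5 \<in> {0, 1, 3, 4} \<longrightarrow>
            soft_theta (\<lambda>n. real (P_S k n))
              (\<lambda>n. real n powr real_of_int \<lfloor>2 * (real k + 3) / 5\<rfloor>)) \<and>
         (k mod 5 = 2 \<longrightarrow>
            soft_theta (\<lambda>n. real (P_S k n))
              (\<lambda>n. real n powr (real_of_int \<lfloor>2 * (real k + 3) / 5\<rfloor> - 2 / 3)))"
proof (intro conjI impI)
  assume "k mod 5 \<in> {0, 1, 3, 4}"
  then have "path_exponent k = real_of_int \<lfloor>2 * (real k + 3) / 5\<rfloor>" by (auto simp: path_exponent_def)
  then show "soft_theta (\<lambda>n. real (P_S k n)) (\<lambda>n. real n powr real_of_int \<lfloor>2 * (real k + 3) / 5\<rfloor>)"
    using soft_theta_P_S[OF assms] by simp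
next
  assume "k mod 5 = 2"
  then have "path_exponent k = real_of_int \<lfloor>2 * (real k + 3) / 5\<rfloor> - 2 / 3" by (simp add: path_exponent_def)
  then show "soft_theta (\<lambda>n. real (P_S k n)) (\<lambda>n. real n powr (real_of_int \<lfloor>2 * (real k + 3) / 5\<rfloor> - 2 / 3))"
    using soft_theta_P_S[OF assms] by simp
qed

end
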